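(* There exists an integer $N$ such that the following holds. Let $\mathrm{P}\subset\mathbb{R}^2$ be a convex polygon with vertex set $X$ and let $p$ be a point in the interior of $\mathrm{P}$ such that $\mathrm{P}$ is balanced with respect to $p$. If $|X|\geq N$, then there exists a line segment $\varepsilon$ such that $\mathcal{F}_\varepsilon(\mathrm{P},X\cup\{p\})$ is not a strongly convex subgraph of $\mathcal{F}(\mathrm{P},X\cup\{p\})$.
   Context: A simple polygon is a compact subset $\mathrm{P}$ of $\mathbb{R}^2$ whose boundary is a Jordan curve that is a union of finitely many line segments (its edges) with pairwise disjoint relative interiors; the endpoints of the edges are the vertices. A vertex has interior angle different from $\pi$. A simple polygon $\mathrm{P}$ is balanced with respect to a point $x$ when the number of vertices of $\mathrm{P}$ in any open half-plane bounded by a line through $x$ is never greater than $3/2$ times the smallest number of vertices of $\mathrm{P}$ in any such half-plane. Let $Y$ be a finite subset of $\mathrm{P}$ containing all the vertices of $\mathrm{P}$. Points of $Y$ in the interior of $\mathrm{P}$ are called punctures. Two line segments are crossing when their relative interiors are non-disjoint. A triangulation of $\mathrm{P}$ with vertex set $Y$ is an inclusion-wise maximal set of pairwise non-crossing line segments (called arcs), each of them contained in $\mathrm{P}$, having two distinct endpoints in $Y$, and containing no point of $Y$ in its relative interior. Such a set decomposes $\mathrm{P}$ into triangles. The flip-graph $\mathcal{F}(\mathrm{P},Y)$ is the graph whose vertices are the triangulations of $\mathrm{P}$ with vertex set $Y$ and whose edges connect two triangulations that differ by a single arc (that is, one is obtained from the other by removing one arc and inserting another one). For a line segment $\varepsilon$,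 $\mathcal{F}_\varepsilon(\mathrm{P},Y)$ is the subgraph of $\mathcal{F}(\mathrm{P},Y)$ induced by the triangulations that contain $\varepsilon$. It is strongly convex in $\mathcal{F}(\mathrm{P},Y)$ when every geodesic (shortest path) in $\mathcal{F}(\mathrm{P},Y)$ between two vertices of $\mathcal{F}_\varepsilon(\mathrm{P},Y)$ remains entirely in $\mathcal{F}_\varepsilon(\mathrm{P},Y)$. *)

theory Defs
  imports "HOL-Analysis.Analysis" "Graph_Theory.Digraph_Component"
begin

type_synonym point = "real^2"
type_synonym segment = "point set"

definition crossing :: "segment \<Rightarrow> segment \<Rightarrow> bool" where
  "crossing s t \<longleftrightarrow> rel_interior s \<inter> rel_interior t \<noteq> {}"

definition noncrossing :: "segment set \<Rightarrow> bool" where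
  "noncrossing S \<longleftrightarrow> pairwise (\<lambda>s t. \<not> crossing s t) S"

definition line_segment :: "segment \<Rightarrow> bool" where
  "line_segment s \<longleftrightarrow> (\<exists>a b. a \<noteq> b \<and> s = closed_segment a b)"

definition angle_at :: "point \<Rightarrow> point \<Rightarrow> point \<Rightarrow> real" where
  "angle_at v a b = arccos (((a - v) \<bullet> (b - v)) / (norm (a - v) * norm (b - v)))"

(* If va and vb are the two edges of P at the vertex v, the interior angle of P at v is either
   angle_at v a b or 2 * pi - angle_at v a b, and always the former when P is convex.
   In both cases it differs from pi iff angle_at v a b does. *)
definition polygon_edges :: "point set \<Rightarrow> segment set \<Rightarrow> bool" where
  "polygon_edges P E \<longleftrightarrow>
     finite E \<and> (\<forall>e\<in>E. line_segment e) \<and> noncrossing E \<and> \<Union>E = frontier P \<and>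
     (\<forall>v a b. closed_segment v a \<in> E \<and> closed_segment v b \<in> E \<and> a \<noteq> b
        \<longrightarrow> angle_at v a b \<noteq> pi)"

definition segment_endpoints :: "segment set \<Rightarrow> point set" where
  "segment_endpoints E = {v. \<exists>w. v \<noteq> w \<and> closed_segment v w \<in> E}"

(* P is a simple polygon whose vertex set is X *)
definition simple_polygon :: "point set \<Rightarrow> point set \<Rightarrow> bool" where
  "simple_polygon P X \<longleftrightarrow>
     compact P \<and>
     (\<exists>g. simple_path g \<and> pathfinish g = pathstart g \<and> path_image g = frontier P) \<and>
     (\<exists>E. polygon_edges P E \<and> X = segment_endpoints E)"

definition open_half_planes_through :: "point \<Rightarrow> point set set" where
  "open_half_planes_through x = {{y. u \<bullet> (y - x) > 0} | u. u \<noteq> 0}"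

(* X is the vertex set of the polygon *)
definition balanced :: "point set \<Rightarrow> point \<Rightarrow> bool" where
  "balanced X x \<longleftrightarrow>
     (\<forall>H \<in> open_half_planes_through x.
        real (card (X \<inter> H)) \<le> 3/2 * real (INF H' \<in> open_half_planes_through x. card (X \<inter> H')))"

definition triangulation_arc :: "point set \<Rightarrow> point set \<Rightarrow> segment \<Rightarrow> bool" where
  "triangulation_arc P Y s \<longleftrightarrow>
     (\<exists>a\<in>Y. \<exists>b\<in>Y. a \<noteq> b \<and> s = closed_segment a b) \<and> s \<subseteq> P \<and> rel_interior s \<inter> Y = {}"

definition noncrossing_arcs :: "point set \<Rightarrow> point set \<Rightarrow> segment set \<Rightarrow> bool" where
  "noncrossing_arcs P Y T \<longleftrightarrow> (\<forall>s\<in>T. triangulation_arc P Y s) \<and> noncrossing T"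

definition triangulation :: "point set \<Rightarrow> point set \<Rightarrow> segment set \<Rightarrow> bool" where
  "triangulation P Y T \<longleftrightarrow>
     noncrossing_arcs P Y T \<and> (\<forall>T'. noncrossing_arcs P Y T' \<and> T \<subseteq> T' \<longrightarrow> T' = T)"

definition flip :: "segment set \<Rightarrow> segment set \<Rightarrow> bool" where
  "flip T T' \<longleftrightarrow> (\<exists>s\<in>T. \<exists>s'. s' \<notin> T \<and> T' = insert s' (T - {s}))"

(* An undirected edge is represented by the two opposite directed arcs. *)
definition flip_graph ::
    "point set \<Rightarrow> point set \<Rightarrow> (segment set, segment set \<times> segment set) pre_digraph" where
  "flip_graph P Y =
     \<lparr>verts = {T. triangulation P Y T},
      arcs = {(T, T'). triangulation P Y T \<and> triangulation P Y T' \<and> flip T T'},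
      tail = fst, head = snd\<rparr>"

definition flip_graph_containing ::
    "segment \<Rightarrow> point set \<Rightarrow> point set \<Rightarrow> (segment set, segment set \<times> segment set) pre_digraph"
  where
  "flip_graph_containing \<epsilon> P Y = flip_graph P Y \<restriction> {T. triangulation P Y T \<and> \<epsilon> \<in> T}"

definition geodesic :: "('a, 'b) pre_digraph \<Rightarrow> 'a \<Rightarrow> 'b list \<Rightarrow> 'a \<Rightarrow> bool" where
  "geodesic G u p v \<longleftrightarrow>
     pre_digraph.awalk G u p v \<and> (\<forall>q. pre_digraph.awalk G u q v \<longrightarrow> length p \<le> length q)"

definition strongly_convex_in :: "('a, 'b) pre_digraph \<Rightarrow> ('a, 'b) pre_digraph \<Rightarrow> bool" where
  "strongly_convex_in H G \<longleftrightarrow>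
     (\<forall>u \<in> verts H. \<forall>v \<in> verts H. \<forall>p. geodesic G u p v \<longrightarrow> pre_digraph.awalk H u p v)"

end

theory Submission
  imports Defs
begin

text \<open>
The proof exhibits two triangulations that share a segment \<open>\<epsilon>\<close>, yet every path between them that is
shortest must lose some common segment. Suppose on the contrary that all the subgraphs are strongly
convex. Then a geodesic keeps all the segments that its two ends have in common. As each piece of a
geodesic is a geodesic, a segment of the first end never comes back once it has been removed, and a
segment of the last end never leaves once it has been inserted: a geodesic is a monotone walk. It
remains to find two triangulations that are closer to each other in the flip-graph than the ends of a
monotone walk can be.

The flips take place among 1821 vertices of the polygon and the puncture \<open>p\<close>, numbered from 0 to 1821
along a closed curve on which \<open>p\<close>, with number 1353, is a reflex corner between 1352 and 1354. The
numbers form the hub 0, the block \<open>X\<close> of 1 to 751, the block \<open>A\<close> of 752 to 1352, the puncture, the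
vertex \<open>\<alpha>\<close> = 1354, and the block \<open>Y\<close> of 1355 to 1821. Everything that the proof needs to know about
the position of these points is on which side of each diagonal the puncture lies. Balance yields
vertices for which the diagonal \<open>ij\<close> passes on the outer side of \<open>p\<close> exactly if \<open>forb i j\<close>, that is, the
diagonals from \<open>X\<close> to \<open>\<alpha>\<close> and from \<open>A\<close> to \<open>\<alpha>\<close> or \<open>Y\<close> leave the curve (\<open>placement\<close>). A fixed maximal set of segments
outside the curve completes each triangulation of the curve to one of the polygon
(\<open>Full_triangulation\<close>, \<open>triangulation_Full\<close>), so that flips become purely combinatorial.

The two triangulations \<open>arcsT\<close> and \<open>arcsT'\<close> share only \<open>\<epsilon>\<close> = (1, 1821), which cuts off the hub. If \<open>\<epsilon>\<close>
is removed, then all the arcs can be replaced by arcs at the hub, one flip for each arc, and only 3626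
flips lead from one triangulation to the other (\<open>short_walk_exists\<close>). A walk that keeps \<open>\<epsilon>\<close> has no
arc at the hub. If it is monotone, it removes each of the 1818 other arcs of \<open>arcsT\<close> once and inserts
each of the 1818 other arcs of \<open>arcsT'\<close> once, so that its length is 3636 minus the number of flips
that exchange an arc of \<open>arcsT\<close> directly for an arc of \<open>arcsT'\<close>, plus the number of flips between
intermediate arcs, those of neither triangulation. In a walk of length at most 3626 the direct
exchanges exceed the others by at least 10 (\<open>WW_TT\<close>).

But direct exchanges are rare. The ladder arcs, from \<open>X\<close> to \<open>Y\<close>, cannot be exchanged for arcs from
\<open>X\<close> to \<open>A\<close> or at \<open>\<alpha>\<close>: the quadrilateral of the flip would have a side that leaves the curve. They can be
exchanged for one of the 15 caps (j, 1371). An arc within \<open>A\<close> can be exchanged for an arc to an apex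
\<open>t\<close> in \<open>X\<close>, but at that time two other arcs go from \<open>t\<close> to \<open>A\<close>, and as \<open>t\<close> has at most two such arcs
in \<open>arcsT'\<close>, each such exchange is paid for by an intermediate arc at \<open>t\<close> (\<open>apex_le\<close>). Hence almost all
the caps arise directly and there are only a few intermediate flips other than those which pay for
apices. Direct exchanges for caps happen when almost all the vertices 452 to 750 are cut off by arcs
within \<open>X\<close> (\<open>hub_exists\<close>, \<open>uncovered_ladder\<close>), because very few intermediate ladder arcs occur. At the
end these vertices are not cut off, and freeing them one by one takes an intermediate flip or uses an
intermediate arc between \<open>X\<close> and \<open>A\<close>; counting both kinds leaves at least 81 of the 299 vertices
without an explanation. The 150 vertices 301 to 450, which all have the neighbour 1052 in \<open>arcsT'\<close>,
prevent the walk from doing the work for distant parts of \<open>X\<close> at once: arcs within \<open>X\<close> never span 50 of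
them (\<open>no_span\<close>).
\<close>

section \<open>Triangulations of a polygon with one reflex vertex\<close>

type_synonym arc = "nat \<times> nat"

definition xing :: "arc \<Rightarrow> arc \<Rightarrow> bool" where
  "xing e f \<longleftrightarrow> fst e < fst f \<and> fst f < snd e \<and> snd e < snd f
     \<or> fst f < fst e \<and> fst e < snd f \<and> snd f < snd e"

text \<open>The diagonals that leave the closed curve: they would pass on the outer side of the reflex corner
1353. This depends on the position of the corner relative to all other points, and the two cases
correspond to the blocks from which the neighbour 1354 and the vertices after it are hidden.\<close>

definition forb :: "nat \<Rightarrow> nat \<Rightarrow> bool" where
  "forb i j \<longleftrightarrow> 1 \<le> i \<and> i < 1353 \<and> 1353 < j \<and> (j = 1354 \<or> 751 < i)"

definition okarc :: "arc \<Rightarrow> bool" where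
  "okarc e \<longleftrightarrow> fst e + 2 \<le> snd e \<and> snd e \<le> 1821 \<and> e \<noteq> (0, 1821) \<and> \<not> forb (fst e) (snd e)"

definition tri :: "arc set \<Rightarrow> bool" where
  "tri R \<longleftrightarrow> (\<forall>e\<in>R. okarc e) \<and> (\<forall>e\<in>R. \<forall>f\<in>R. \<not> xing e f)
     \<and> (\<forall>e. okarc e \<and> (\<forall>f\<in>R. \<not> xing e f) \<longrightarrow> e \<in> R)"

definition edge :: "arc set \<Rightarrow> nat \<Rightarrow> nat \<Rightarrow> bool" where
  "edge R i j \<longleftrightarrow> (i, j) \<in> R \<or> j = Suc i \<and> j \<le> 1821 \<or> i = 0 \<and> j = 1821"

lemma xing_simp [simp]: "xing (a,b) (c,d) \<longleftrightarrow> a < c \<and> c < b \<and> b < d \<or> c < a \<and> a < d \<and> d < b"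
  by (auto simp: xing_def)

lemma okarc_simp: "okarc (i,j) \<longleftrightarrow> i + 2 \<le> j \<and> j \<le> 1821 \<and> \<not> (i = 0 \<and> j = 1821) \<and> \<not> forb i j"
  by (auto simp: okarc_def)

lemma xing_commute: "xing e f \<longleftrightarrow> xing f e"
  by (auto simp: xing_def)

lemma tri_ok: "tri R \<Longrightarrow> e \<in> R \<Longrightarrow> okarc e"
  by (simp add: tri_def)

lemma tri_non: "tri R \<Longrightarrow> e \<in> R \<Longrightarrow> f \<in> R \<Longrightarrow> \<not> xing e f"
  by (simp add: tri_def)

lemma tri_max: "tri R \<Longrightarrow> okarc e \<Longrightarrow> (\<And>k l. (k,l) \<in> R \<Longrightarrow> \<not> xing e (k,l)) \<Longrightarrow> e \<in> R"
  unfolding tri_def by (metis surj_pair)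

lemma tri_bounds: "tri R \<Longrightarrow> (i,j) \<in> R \<Longrightarrow> i + 2 \<le> j \<and> j \<le> 1821"
  by (drule (1) tri_ok) (simp add: okarc_simp)

lemma edge_bounds: "tri R \<Longrightarrow> edge R i j \<Longrightarrow> i < j \<and> j \<le> 1821"
  by (auto simp: edge_def dest: tri_bounds)

lemma edge_non: "tri R \<Longrightarrow> edge R i j \<Longrightarrow> (k,l) \<in> R \<Longrightarrow> \<not> xing (i,j) (k,l)"
  by (auto simp: edge_def dest: tri_non tri_bounds)

lemma tri_finite: assumes "tri R" shows "finite R"
proof (rule finite_subset)
  show "R \<subseteq> {..1821} \<times> {..1821}" using tri_bounds[OF assms] by fastforce
qed simp

text \<open>The smallest and the largest neighbour of a vertex span its visible range. The shortest edge above this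
range is the range itself, unless joining its ends to the vertex is impossible: such a join would cross
nothing and would have to be there by maximality.\<close>

lemma vertex_hull:
  assumes R: "tri R" and v: "0 < v" "v < 1821"
  obtains k l c d where "edge R k v" "edge R v l" "\<And>w. edge R w v \<Longrightarrow> k \<le> w" "\<And>w. edge R v w \<Longrightarrow> w \<le> l"
    "edge R c d" "c \<le> k" "l \<le> d" "c < k \<Longrightarrow> \<not> okarc (c,v)" "l < d \<Longrightarrow> \<not> okarc (v,d)"
proof -
  define k where "k = Min {w. edge R w v}"
  define l where "l = Max {w. edge R v w}"
  have f1: "finite {w. edge R w v}" by (rule finite_subset[of _ "{..v}"]) (use edge_bounds[OF R] in fastforce)+
  have f2: "finite {w. edge R v w}" by (rule finite_subset[of _ "{..1821}"]) (use edge_bounds[OF R] in fastforce)+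
  have e1: "edge R (v-1) v" and e2: "edge R v (Suc v)" using v by (auto simp: edge_def)
  have k: "edge R k v" "\<And>w. edge R w v \<Longrightarrow> k \<le> w"
    unfolding k_def using Min_in[OF f1] e1 f1 by auto
  have l: "edge R v l" "\<And>w. edge R v w \<Longrightarrow> w \<le> l"
    unfolding l_def using Max_in[OF f2] e2 f2 by auto
  have kv: "k < v" and vl: "v < l" "l \<le> 1821" using edge_bounds[OF R] k(1) l(1) by auto
  have between: "x \<le> k \<and> l \<le> y" if "(x,y) \<in> R" "x < v" "v < y" for x y
    using edge_non[OF R k(1) that(1)] edge_non[OF R l(1) that(1)] that
    by simp
  \<comment> \<open>the shortest edge above the range from \<open>k\<close> to \<open>l\<close>; the edge from 0 to 1821 is one such edge\<close>
  define m where "m = (LEAST m. \<exists>c d. edge R c d \<and> c \<le> k \<and> l \<le> d \<and> m = d - c)"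
  have ex: "\<exists>m c d. edge R c d \<and> c \<le> k \<and> l \<le> d \<and> m = d - c"
    by (rule exI, rule exI[of _ 0], rule exI[of _ 1821]) (auto simp: edge_def vl)
  then obtain c d where cd: "edge R c d" "c \<le> k" "l \<le> d" "m = d - c"
    unfolding m_def using LeastI_ex[OF ex] by auto
  have least: "d - c \<le> y - x" if "edge R x y" "x \<le> k" "l \<le> y" for x y
    unfolding cd(4)[symmetric] m_def by (rule Least_le) (use that in blast)
  have d: "d \<le> 1821" using edge_bounds[OF R cd(1)] by simp
  have narrow: False if "(x,y) \<in> R" "x < v" "v < y" "c \<le> x" "y \<le> d" "c < x \<or> y < d" for x y
    using least[of x y] between[OF that(1-3)] that cd kv vl by (auto simp: edge_def)
  have "\<not> okarc (c,v)" if "c < k"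
  proof
    assume "okarc (c,v)"
    moreover have "\<not> xing (c,v) (x,y)" if e: "(x,y) \<in> R" for x y
      using edge_non[OF R cd(1) e] narrow[OF e] \<open>c < k\<close> kv vl cd by force
    ultimately have "(c,v) \<in> R" by (rule tri_max[OF R])
    then show False using k(2)[of c] \<open>c < k\<close> by (auto simp: edge_def)
  qed
  moreover have "\<not> okarc (v,d)" if "l < d"
  proof
    assume "okarc (v,d)"
    moreover have "\<not> xing (v,d) (x,y)" if e: "(x,y) \<in> R" for x y
      using edge_non[OF R cd(1) e] narrow[OF e] \<open>l < d\<close> kv vl cd by force
    ultimately have "(v,d) \<in> R" by (rule tri_max[OF R])
    then show False using l(2)[of d] \<open>l < d\<close> by (auto simp: edge_def)
  qed
  ultimately show ?thesis using that k l cd by blast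
qed

text \<open>Maximality of a triangulation refers to the arcs that stay inside. Nevertheless a diagonal that leaves
the curve is always crossed, namely by an arc at the reflex corner, since otherwise the visible range of
this corner would itself leave the curve. Consequently sides of quadrilaterals are never such diagonals.\<close>

lemma forb_crossed:
  assumes R: "tri R" and ij: "forb i j" 
  shows "\<exists>x y. (x,y) \<in> R \<and> xing (i,j) (x,y)"
proof (rule ccontr)
  assume non: "\<not> ?thesis"
  have b: "1 \<le> i" "i < 1353" "1353 < j" "j = 1354 \<or> 751 < i" using ij by (auto simp: forb_def)
  obtain k l c d where h: "edge R k 1353" "edge R 1353 l"
    "edge R c d" "c \<le> k" "l \<le> d" "c < k \<Longrightarrow> \<not> okarc (c,1353)" "l < d \<Longrightarrow> \<not> okarc (1353,d)"
    by (rule vertex_hull[OF R, of 1353], simp, simp, blast)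
  have "k < 1353" "1353 < l" "d \<le> 1821" using h(1,2,3) edge_bounds[OF R] by auto
  have k: "i \<le> k" using non h(1) b by (force simp: edge_def)
  have l: "l \<le> j" using non h(2) b by (force simp: edge_def)
  have "c = k" using h(4) h(6) \<open>k < 1353\<close> by (cases "c < k") (auto simp: okarc_simp forb_def)
  have "d = l" using h(5) h(7) \<open>1353 < l\<close> \<open>d \<le> 1821\<close> by (cases "l < d") (auto simp: okarc_simp forb_def)
  have "forb k l" using k l b \<open>k < 1353\<close> \<open>1353 < l\<close> by (auto simp: forb_def)
  moreover have "(k,l) \<in> R" using h(3) \<open>c = k\<close> \<open>d = l\<close> k b \<open>k < 1353\<close> \<open>1353 < l\<close> by (auto simp: edge_def)
  ultimately show False using tri_ok[OF R] by (auto simp: okarc_simp)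
qed

lemma edge_iff: 
  assumes R: "tri R" and ij: "i < j" "j \<le> 1821"
  shows "edge R i j \<longleftrightarrow> (\<forall>x y. (x,y) \<in> R \<longrightarrow> \<not> xing (i,j) (x,y))"
proof
  show "edge R i j \<Longrightarrow> \<forall>x y. (x,y) \<in> R \<longrightarrow> \<not> xing (i,j) (x,y)" using edge_non[OF R] by blast
next
  assume non: "\<forall>x y. (x,y) \<in> R \<longrightarrow> \<not> xing (i,j) (x,y)"
  have "\<not> forb i j" using forb_crossed[OF R, of i j] non by blast
  then have "okarc (i,j)" if "j \<noteq> Suc i" "\<not> (i = 0 \<and> j = 1821)"
    using that ij by (simp add: okarc_simp)
  moreover have "(i,j) \<in> R" if "okarc (i,j)" using tri_max[OF R that] non by blast
  ultimately show "edge R i j" unfolding edge_def using ij by blast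
qed

lemma edge_not_forb: "tri R \<Longrightarrow> edge R i j \<Longrightarrow> \<not> forb i j"
  using forb_crossed edge_non by blast

text \<open>An arc that crosses a side of the quadrilateral without crossing its diagonals cannot exist, so that by
maximality all four sides are edges before and after the flip.\<close>

lemma flip_quad:
  assumes R: "tri R" and R': "tri R'" and e: "R' = insert s' (R - {s})" "s \<in> R" "s' \<notin> R"
  obtains a b c d where "a < b" "b < c" "c < d" "d \<le> 1821" "s = (a,c) \<and> s' = (b,d) \<or> s = (b,d) \<and> s' = (a,c)"
    "edge R a b" "edge R b c" "edge R c d" "edge R a d"
    "edge R' a b" "edge R' b c" "edge R' c d" "edge R' a d"
proof -
  have s'R: "s' \<in> R'" using e by simp
  then obtain f where f: "f \<in> R" "xing s' f" using e(3) R R' unfolding tri_def by blast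
  then have "f = s" using s'R e R' unfolding tri_def by blast
  with f have x: "xing s s'" by (simp add: xing_commute)
  then obtain a b c d where o: "a < b" "b < c" "c < d" and q: "s = (a,c) \<and> s' = (b,d) \<or> s = (b,d) \<and> s' = (a,c)"
    by (cases s, cases s') (auto 0 3)
  have d: "d \<le> 1821" using q e(2) s'R tri_bounds[OF R, of b d] tri_bounds[OF R', of b d] by auto
  have n1: "\<not> xing (x,y) (a,c)" "\<not> xing (x,y) (b,d)" if "(x,y) \<in> R" "(x,y) \<noteq> s" for x y
  proof -
    have "(x,y) \<in> R'" using that e by auto
    then show "\<not> xing (x,y) (a,c)" "\<not> xing (x,y) (b,d)"
      using q that(1) e(2) s'R R R' unfolding tri_def by blast+
  qed
  have E: "edge R i j" if ij: "i < j" "j \<le> 1821" and ng: "\<And>x y. x < y \<Longrightarrow> \<not> xing (x,y) (a,c) \<Longrightarrow> \<not> xing (x,y) (b,d) \<Longrightarrow> \<not> xing (i,j) (x,y)"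
    and ns: "\<not> xing (i,j) s" for i j
    unfolding edge_iff[OF R ij]
  proof (intro allI impI)
    fix x y assume xy: "(x,y) \<in> R"
    show "\<not> xing (i,j) (x,y)"
    proof (cases "(x,y) = s")
      case True then show ?thesis using ns by simp
    next
      case False
      have "x < y" using tri_bounds[OF R xy] by simp
      then show ?thesis using ng n1[OF xy False] by blast
    qed
  qed
  have 1: "edge R a b" by (rule E) (use o d q in \<open>auto\<close>)
  have 2: "edge R b c" by (rule E) (use o d q in \<open>auto\<close>)
  have 3: "edge R c d" by (rule E) (use o d q in \<open>auto\<close>)
  have 4: "edge R a d" by (rule E) (use o d q in \<open>auto\<close>)
  have t: "edge R i j \<Longrightarrow> (i,j) \<noteq> s \<Longrightarrow> edge R' i j" for i j using e by (auto simp: edge_def)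
  show ?thesis using that[OF o d q 1 2 3 4] 1 2 3 4 t o q by auto
qed

lemma quad_diagonal_unique:
  assumes "a < b" "b < c" "c < d" "x < (y::nat)" and "xing (x,y) (a,c)"
    and "\<not> xing (x,y) (a,b)" "\<not> xing (x,y) (b,c)" "\<not> xing (x,y) (c,d)" "\<not> xing (x,y) (a,d)"
  shows "(x,y) = (b,d)"
proof -
  consider "x < a" "a < y" "y < c" | "a < x" "x < c" "c < y" using assms(5) by auto
  then show ?thesis
  proof cases
    case 1 then show ?thesis using assms by simp
  next
    case 2
    have "y = d" using 2 assms by simp
    moreover have "x = b" using 2 assms by simp
    ultimately show ?thesis by simp
  qed
qed

lemma quad_diagonal_unique':
  assumes "a < b" "b < c" "c < d" "x < (y::nat)" and "xing (x,y) (b,d)"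
    and "\<not> xing (x,y) (a,b)" "\<not> xing (x,y) (b,c)" "\<not> xing (x,y) (c,d)" "\<not> xing (x,y) (a,d)"
  shows "(x,y) = (a,c)"
proof -
  consider "x < b" "b < y" "y < d" | "b < x" "x < d" "d < y" using assms(5) by auto
  then show ?thesis
  proof cases
    case 2 then show ?thesis using assms by simp
  next
    case 1
    have "y = c" using 1 assms by simp
    moreover have "x = a" using 1 assms by simp
    ultimately show ?thesis by simp
  qed
qed

lemma tri_flip:
  assumes R: "tri R" and o: "a < b" "b < c" "c < d" 
    and q: "s = (a,c) \<and> s' = (b,d) \<or> s = (b,d) \<and> s' = (a,c)" and s: "s \<in> R" and ok: "okarc s'"
    and E: "edge R a b" "edge R b c" "edge R c d" "edge R a d"
  shows "s' \<notin> R" "tri (insert s' (R - {s}))"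
proof -
  have x: "xing s s'" using q o by auto
  show s': "s' \<notin> R" using x s R unfolding tri_def by blast
  let ?R = "insert s' (R - {s})"
  have E': "edge ?R a b" "edge ?R b c" "edge ?R c d" "edge ?R a d" using E o q by (auto simp: edge_def)
  have n: "\<not> xing (x,y) s'" if e: "(x,y) \<in> R - {s}" for x y
  proof -
    have "\<not> xing (x,y) s" using e s R unfolding tri_def by blast
    moreover have "x < y" using e tri_bounds[OF R, of x y] by simp
    moreover have "(x,y) \<noteq> s" using e by simp
    moreover have "\<not> xing (x,y) (i,j)" if "edge R i j" for i j
      using edge_non[OF R that, of x y] e xing_commute[of "(x,y)"] by simp
    ultimately have "\<not> xing (x,y) (b,d)" if "s = (a,c)" and "\<not> xing (x,y) (a,c) \<or> s = (a,c)"
      using quad_diagonal_unique'[OF o, of x y] E that by metis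
    moreover have "\<not> xing (x,y) (a,c)" if "s = (b,d)"
      using quad_diagonal_unique[OF o, of x y] E that \<open>x < y\<close> \<open>(x,y) \<noteq> s\<close>
        \<open>\<And>i j. edge R i j \<Longrightarrow> \<not> xing (x,y) (i,j)\<close> by metis
    ultimately show ?thesis using q by blast
  qed
  have mx: "(x,y) \<in> ?R" if ok: "okarc (x,y)" and non: "\<And>e. e \<in> ?R \<Longrightarrow> \<not> xing (x,y) e" for x y
  proof (cases "xing (x,y) s")
    case False
    then have "(x,y) \<in> R" using tri_max[OF R ok] non by (metis Diff_iff insertCI singletonD)
    then show ?thesis using non[of s'] x by (auto simp: xing_commute)
  next
    case True
    have xy: "x < y" "y \<le> 1821" using ok by (auto simp: okarc_simp)
    have nx: "\<not> xing (x,y) (i,j)" if "edge ?R i j" for i j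
      using that unfolding edge_def
    proof (elim disjE)
      assume "(i,j) \<in> ?R" then show ?thesis by (rule non)
    qed (use xy in auto)
    have "(x,y) = s'" using q
    proof (elim disjE conjE)
      assume *: "s = (a,c)" "s' = (b,d)"
      show ?thesis unfolding *(2)
        by (rule quad_diagonal_unique[OF o xy(1) True[unfolded *(1)] nx[OF E'(1)] nx[OF E'(2)] nx[OF E'(3)] nx[OF E'(4)]])
    next
      assume *: "s = (b,d)" "s' = (a,c)"
      show ?thesis unfolding *(2)
        by (rule quad_diagonal_unique'[OF o xy(1) True[unfolded *(1)] nx[OF E'(1)] nx[OF E'(2)] nx[OF E'(3)] nx[OF E'(4)]])
    qed
    then show ?thesis by simp
  qed
  show "tri ?R" unfolding tri_def
  proof (intro conjI ballI allI impI)
    fix e assume "e \<in> ?R" then show "okarc e" using ok tri_ok[OF R, of e] by blast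
  next
    have ns: "\<not> xing s' s'" by (cases s') auto
    fix e f assume "e \<in> ?R" "f \<in> ?R"
    then consider "e = s'" "f = s'" | "e = s'" "f \<in> R - {s}" | "e \<in> R - {s}" "f = s'" | "e \<in> R" "f \<in> R" by blast
    then show "\<not> xing e f"
    proof cases
      case 2 then show ?thesis using n by (cases f) (auto simp: xing_commute)
    next
      case 3 then show ?thesis using n by (cases e) auto
    qed (use ns tri_non[OF R] in auto)
  next
    fix e assume "okarc e \<and> (\<forall>f\<in>?R. \<not> xing e f)"
    then show "e \<in> ?R" using mx by (cases e) auto
  qed
qed

section \<open>Two triangulations and monotone walks between them\<close>

text \<open>The zigzag path that triangulates the block of 752 to 1352 has arcs of two consecutive constant sums.
All the zigzags below are described by sums in this way.\<close>

definition arcsTA :: "arc set" where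
  "arcsTA = {(i,j). 752 \<le> i \<and> i + 2 \<le> j \<and> j \<le> 1352 \<and> (i + j = 2104 \<or> i + j = 2105)}"

definition arcsT :: "arc set" where
  "arcsT = arcsTA \<union> {(751,1353), (752,1353), (1353,1355)}
     \<union> {(i,j). 1 \<le> i \<and> i \<le> 451 \<and> 1371 \<le> j \<and> j \<le> 1821 \<and> (i + j = 1822 \<or> i + j = 1823)}
     \<union> {(i,j). 451 \<le> i \<and> i \<le> 751 \<and> j = 1370} \<union> {(i,j). i = 751 \<and> 1355 \<le> j \<and> j \<le> 1370}"

definition isXA :: "arc \<Rightarrow> bool" where
  "isXA e \<longleftrightarrow> 1 \<le> fst e \<and> fst e \<le> 751 \<and> 752 \<le> snd e \<and> snd e \<le> 1352"

definition arcsXA :: "arc set" where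
  "arcsXA = {(i,j). isXA (i,j) \<and> i + 2 \<le> j
     \<and> (451 \<le> i \<and> j \<le> 1052 \<and> (i + j = 1502 \<or> i + j = 1503)
       \<or> 301 \<le> i \<and> i \<le> 450 \<and> j = 1052
       \<or> i \<le> 300 \<and> 1052 \<le> j \<and> (i + j = 1352 \<or> i + j = 1353))}"

definition caps :: "arc set" where
  "caps = {(i,j). 1355 \<le> i \<and> i \<le> 1369 \<and> j = 1371}"

definition arcsT' :: "arc set" where
  "arcsT' = arcsXA \<union> caps \<union> {(1,1821), (1,1353), (1353,1821)} \<union> {(i,j). i = 1354 \<and> 1371 \<le> j \<and> j \<le> 1821}"

lemma isXA_simp [simp]: "isXA (i,j) \<longleftrightarrow> 1 \<le> i \<and> i \<le> 751 \<and> 752 \<le> j \<and> j \<le> 1352"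
  by (simp add: isXA_def)

definition flips :: "arc set \<Rightarrow> arc set \<Rightarrow> arc \<Rightarrow> arc \<Rightarrow> bool" where
  "flips R R' s s' \<longleftrightarrow> tri R \<and> tri R' \<and> s \<in> R \<and> s' \<notin> R \<and> R' = insert s' (R - {s})"

lemma flips_sym: "flips R R' s s' \<Longrightarrow> flips R' R s' s"
  unfolding flips_def by (elim conjE, intro conjI) auto

text \<open>The vertex is cut off from the rest of the curve by an arc between vertices of the first block.\<close>

definition covered :: "arc set \<Rightarrow> nat \<Rightarrow> bool" where
  "covered R x \<longleftrightarrow> (\<exists>c d. (c,d) \<in> R \<and> c < x \<and> x < d \<and> d \<le> 751)"

lemma covered_edge: "edge R c d \<Longrightarrow> c < x \<Longrightarrow> x < d \<Longrightarrow> d \<le> 751 \<Longrightarrow> covered R x"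
  by (auto simp: edge_def covered_def)

text \<open>At the flip that cuts off a vertex, the removed arc ends at that vertex, and its other end is a common
neighbour of the ends of the new arc. Read backwards, this describes how a vertex is freed.\<close>

lemma cover_flip:
  assumes f: "flips R R' s s'" and n: "\<not> covered R x" and c: "covered R' x"
  obtains c d w where "s' = (c,d)" "c < x" "x < d" "d \<le> 751" "s = (x,w)" "751 < w"
    "edge R c w" "edge R d w" "edge R' c w" "edge R' d w"
proof -
  have f': "tri R" "tri R'" "s \<in> R" "s' \<notin> R" "R' = insert s' (R - {s})"
    using f unfolding flips_def by auto
  obtain c d where cd: "(c,d) \<in> R'" "c < x" "x < d" "d \<le> 751" using c unfolding covered_def by auto
  then have s': "s' = (c,d)" using n f'(5) unfolding covered_def by auto
  obtain p1 p2 p3 p4 where p: "p1 < p2" "p2 < p3" "p3 < p4" "p4 \<le> 1821"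
    and q: "s = (p1,p3) \<and> s' = (p2,p4) \<or> s = (p2,p4) \<and> s' = (p1,p3)"
    and e: "edge R p1 p2" "edge R p2 p3" "edge R p3 p4" "edge R p1 p4"
    and e': "edge R' p1 p2" "edge R' p2 p3" "edge R' p3 p4" "edge R' p1 p4"
    by (rule flip_quad[OF f'(1,2,5,3,4)])
  have ne: "\<not> (u < x \<and> x < v \<and> v \<le> 751)" if "edge R u v" for u v
    using covered_edge[OF that] n by blast
  have "\<not> (s = (p1,p3) \<and> s' = (p2,p4))" using ne[OF e(4)] s' cd p by auto
  then have s: "s = (p2,p4)" "c = p1" "d = p3" using q s' by auto
  have "x = p2" using ne[OF e(1)] ne[OF e(2)] cd s p by auto
  moreover have "751 < p4" using ne[OF e(4)] cd s p by auto
  ultimately show ?thesis using that[of c d p4] s' cd s e e' by auto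
qed

lemma last_true:
  assumes "P k" "\<not> P n" "k \<le> (n::nat)"
  obtains m where "k \<le> m" "m < n" "P m" "\<not> P (Suc m)"
proof -
  define m where "m = Max {m. m \<le> n \<and> P m}"
  have fin: "finite {m. m \<le> n \<and> P m}" by simp
  have "m \<in> {m. m \<le> n \<and> P m}" unfolding m_def by (rule Max_in[OF fin]) (use assms in auto)
  moreover have mx: "i \<le> m" if "i \<le> n" "P i" for i unfolding m_def using that fin by simp
  ultimately have "m \<le> n" "P m" by auto
  moreover have "m \<noteq> n" using \<open>P m\<close> assms by auto
  moreover have "\<not> P (Suc m)" using mx[of "Suc m"] \<open>m \<le> n\<close> \<open>m \<noteq> n\<close> by auto
  ultimately show ?thesis using that[of m] mx[of k] assms by auto
qed

lemma first_true:
  assumes "\<not> P 0" "P k"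
  obtains m where "m < k" "\<not> P m" "P (Suc m)"
proof -
  obtain m where "m < k" "\<not> P m" "P (Suc m)"
    using last_true[of "\<lambda>m. \<not> P m" 0 k] assms by auto
  then show ?thesis by (rule that)
qed

text \<open>A monotone walk that contains the arc (1, 1821) throughout.\<close>

locale short_walk =
  fixes R :: "nat \<Rightarrow> arc set" and s s' :: "nat \<Rightarrow> arc" and L :: nat
  assumes L: "L \<le> 3626"
    and fl: "\<And>k. k < L \<Longrightarrow> flips (R k) (R (Suc k)) (s k) (s' k)"
    and R0: "R 0 = arcsT" and RL: "R L = arcsT'"
    and eps: "\<And>k. k \<le> L \<Longrightarrow> (1,1821) \<in> R k"
    and tri0: "tri arcsT" and cT: "card arcsT = 1819" and cT': "card arcsT' = 1819"
    and monoT: "\<And>k m e. e \<in> arcsT \<Longrightarrow> k \<le> m \<Longrightarrow> m \<le> L \<Longrightarrow> e \<in> R m \<Longrightarrow> e \<in> R k"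
    and monoT': "\<And>k m e. e \<in> arcsT' \<Longrightarrow> k \<le> m \<Longrightarrow> m \<le> L \<Longrightarrow> e \<in> R k \<Longrightarrow> e \<in> R m"
begin

lemma tr: "k \<le> L \<Longrightarrow> tri (R k)"
  using fl[of "k - 1"] tri0 R0 by (cases k) (auto simp: flips_def)

lemma no_zero: assumes "k \<le> L" "(i,j) \<in> R k" shows "1 \<le> i"
proof (rule ccontr)
  assume "\<not> 1 \<le> i"
  then have "i = 0" by simp
  have "okarc (i,j)" using tri_ok tr assms by blast
  then have "xing (i,j) (1,1821)" using \<open>i = 0\<close> by (auto simp: okarc_simp)
  then show False using tri_non[OF tr] assms eps by blast
qed

lemma st:
  assumes "k < L"
  shows "s k \<in> R k" "s k \<notin> R (Suc k)" "s' k \<notin> R k" "s' k \<in> R (Suc k)" 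
    "s k \<noteq> (1,1821)" "s' k \<noteq> (1,1821)" "s k \<notin> arcsT'" "s' k \<notin> arcsT" "R (Suc k) = insert (s' k) (R k - {s k})"
proof -
  show a: "s k \<in> R k" "s' k \<notin> R k" "R (Suc k) = insert (s' k) (R k - {s k})"
    using fl[OF assms] unfolding flips_def by blast+
  show b: "s k \<notin> R (Suc k)" "s' k \<in> R (Suc k)"
    unfolding a(3) using a(1,2) by auto
  show "s k \<noteq> (1,1821)" using b(1) eps[of "Suc k"] assms by fastforce
  show "s' k \<noteq> (1,1821)" using a(2) eps[of k] assms by fastforce
  show "s k \<notin> arcsT'" using a(1) b(1) monoT'[of "s k" k "Suc k"] assms by fastforce
  show "s' k \<notin> arcsT" using a(2) b(2) monoT[of "s' k" k "Suc k"] assms by fastforce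
qed

lemma quad:
  assumes "k < L"
  obtains a b c d where "1 \<le> a" "a < b" "b < c" "c < d" "d \<le> 1821"
    "s k = (a,c) \<and> s' k = (b,d) \<or> s k = (b,d) \<and> s' k = (a,c)"
    "edge (R k) a b" "edge (R k) b c" "edge (R k) c d" "edge (R k) a d"
    "edge (R (Suc k)) a b" "edge (R (Suc k)) b c" "edge (R (Suc k)) c d" "edge (R (Suc k)) a d"
proof -
  have t: "tri (R k)" "tri (R (Suc k))" using tr assms by auto
  obtain a b c d where *: "a < b" "b < c" "c < d" "d \<le> 1821"
    "s k = (a,c) \<and> s' k = (b,d) \<or> s k = (b,d) \<and> s' k = (a,c)"
    "edge (R k) a b" "edge (R k) b c" "edge (R k) c d" "edge (R k) a d"
    "edge (R (Suc k)) a b" "edge (R (Suc k)) b c" "edge (R (Suc k)) c d" "edge (R (Suc k)) a d"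
    by (rule flip_quad[OF t st(9)[OF assms] st(1)[OF assms] st(3)[OF assms]])
  have "(a,c) \<in> R k \<or> (a,c) \<in> R (Suc k)" using *(5) st(1,4)[OF assms] by metis
  then have "1 \<le> a" using no_zero[of k a c] no_zero[of "Suc k" a c] assms by linarith
  then show ?thesis using * that by blast
qed

lemma xk: assumes "k < L" shows "xing (s k) (s' k)"
  by (rule quad[OF assms]) auto

lemma nf: "k \<le> L \<Longrightarrow> edge (R k) i j \<Longrightarrow> \<not> forb i j"
  using edge_not_forb[OF tr] by blast

lemma inserted:
  assumes "k \<le> L" "e \<in> R k" "e \<notin> arcsT"
  obtains m where "m < k" "s' m = e"
proof -
  obtain m where "m < k" "e \<notin> R m" "e \<in> R (Suc m)"
    by (rule first_true[of "\<lambda>k. e \<in> R k" k]) (use assms R0 in auto)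
  then show ?thesis using that st(9)[of m] assms by auto
qed

lemma removed:
  assumes "k \<le> L" "e \<in> R k" "e \<notin> arcsT'"
  obtains m where "k \<le> m" "m < L" "s m = e"
proof -
  obtain m where "k \<le> m" "m < L" "e \<in> R m" "e \<notin> R (Suc m)"
    by (rule last_true[of "\<lambda>k. e \<in> R k" k L]) (use assms RL in auto)
  then show ?thesis using that st(9)[of m] assms by auto
qed

lemma inj_s: "inj_on s {k. k < L \<and> s k \<in> arcsT}"
proof (rule linorder_inj_onI')
  fix i j assume "i \<in> {k. k < L \<and> s k \<in> arcsT}" "j \<in> {k. k < L \<and> s k \<in> arcsT}" "i < j"
  then show "s i \<noteq> s j" using monoT[of "s i" "Suc i" j] st(1)[of j] st(2)[of i] by auto
qed

lemma inj_s': "inj_on s' {k. k < L \<and> s' k \<in> arcsT'}"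
proof (rule linorder_inj_onI')
  fix i j assume "i \<in> {k. k < L \<and> s' k \<in> arcsT'}" "j \<in> {k. k < L \<and> s' k \<in> arcsT'}" "i < j"
  then show "s' i \<noteq> s' j" using monoT'[of "s' i" "Suc i" j] st(4)[of i] st(3)[of j] by auto
qed

lemma card_s: assumes "finite B" "B \<subseteq> arcsT" shows "card {k. k < L \<and> s k \<in> B} \<le> card B"
  by (rule card_inj_on_le[of s]) (use assms in \<open>auto intro: inj_on_subset[OF inj_s]\<close>)

lemma card_s': assumes "finite B" "B \<subseteq> arcsT'" shows "card {k. k < L \<and> s' k \<in> B} \<le> card B"
  by (rule card_inj_on_le[of s']) (use assms in \<open>auto intro: inj_on_subset[OF inj_s']\<close>)

lemma eps_T: "(1,1821) \<in> arcsT" "(1,1821) \<in> arcsT'" by (auto simp: arcsT_def arcsT'_def)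

lemma card_removed: "card {k. k < L \<and> s k \<in> arcsT} = 1818"
proof -
  have "s ` {k. k < L \<and> s k \<in> arcsT} = arcsT - {(1,1821)}"
  proof (intro equalityI subsetI)
    fix e assume e: "e \<in> arcsT - {(1,1821)}"
    then have "e \<notin> arcsT'" by (auto simp: arcsT_def arcsT'_def arcsTA_def caps_def arcsXA_def)
    then show "e \<in> s ` {k. k < L \<and> s k \<in> arcsT}" using removed[of 0 e] e R0 by blast
  qed (use st(5) in fastforce)
  then show ?thesis using card_image[OF inj_s] cT eps_T by (simp add: card_Diff_singleton)
qed

lemma card_inserted: "card {k. k < L \<and> s' k \<in> arcsT'} = 1818"
proof -
  have "s' ` {k. k < L \<and> s' k \<in> arcsT'} = arcsT' - {(1,1821)}"
  proof (intro equalityI subsetI)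
    fix e assume e: "e \<in> arcsT' - {(1,1821)}"
    then have "e \<notin> arcsT" by (auto simp: arcsT_def arcsT'_def arcsTA_def caps_def arcsXA_def)
    then show "e \<in> s' ` {k. k < L \<and> s' k \<in> arcsT'}" using inserted[of L e] e RL by blast
  qed (use st(6) in fastforce)
  then show ?thesis using card_image[OF inj_s'] cT' eps_T by (simp add: card_Diff_singleton)
qed

text \<open>The names of the following sets of flips list the kinds of the removed and of the inserted arc: \<open>T\<close> for
the arcs of the first or last triangulation, \<open>W\<close> for the intermediate ones. By monotonicity, removed arcs
are never arcs of the last triangulation and inserted arcs never arcs of the first one. The two frequent
kinds of direct exchanges are \<open>TJ\<close>, which insert caps, and \<open>TA S\<close>, which replace an arc inside the second
block by an arc with apex in \<open>S\<close>. The set \<open>WW\<close> is split into the flips \<open>Is S\<close> that insert an arc from the first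
to the second block and the others, \<open>Wn\<close>; the removals of two special arcs are counted separately.\<close>

definition "WW = {k. k < L \<and> s k \<notin> arcsT \<and> s' k \<notin> arcsT'}"
definition "TT = {k. k < L \<and> s k \<in> arcsT \<and> s' k \<in> arcsT'}"
definition "TJ = {k. k < L \<and> s k \<in> arcsT \<and> s' k \<in> caps}"
definition "TA S = {k. k < L \<and> s k \<in> arcsTA \<and> s' k \<in> arcsT' \<and> isXA (s' k) \<and> fst (s' k) \<in> S}"
definition "Wn = {k \<in> WW. \<not> isXA (s' k)}"
definition "Is S = {k \<in> WW. isXA (s' k) \<and> fst (s' k) \<in> S}"
definition "SP = {k. k < L \<and> s k \<in> {(751,1353), (752,1353)}}"
definition "SPs S = {k. k < L \<and> s k \<in> {(751,1353), (752,1353)} \<and> isXA (s' k) \<and> fst (s' k) \<in> S}"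

lemma fin [simp]: "finite WW" "finite TT" "finite TJ" "finite (TA S)" "finite Wn" "finite (Is S)" "finite (SPs S)" "finite SP"
  by (auto simp: WW_def TT_def TJ_def TA_def Wn_def Is_def SPs_def SP_def)

text \<open>Removals of arcs of the first triangulation and insertions of arcs of the last one number 1818 each,
and a flip that is neither is counted by \<open>WW\<close>, one that is both by \<open>TT\<close>.\<close>

lemma WW_TT: "card WW + 10 \<le> card TT"
proof -
  let ?A = "{k. k < L \<and> s k \<in> arcsT}" and ?B = "{k. k < L \<and> s' k \<in> arcsT'}"
  have "card (?A \<union> ?B) + card (?A \<inter> ?B) = 3636"
    using card_Un_Int[of ?A ?B] card_removed card_inserted by simp
  moreover have "?A \<inter> ?B = TT" by (auto simp: TT_def)
  moreover have "card ((?A \<union> ?B) \<union> WW) = card (?A \<union> ?B) + card WW"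
    by (rule card_Un_disjoint) (auto simp: WW_def)
  moreover have "(?A \<union> ?B) \<union> WW = {..<L}" by (auto simp: WW_def)
  ultimately show ?thesis using L by simp
qed

text \<open>One of the sides of the quadrilateral would leave the curve.\<close>

lemma ladder_flip:
  assumes "k < L" "s k = (x,y)" "x \<le> 751" "1355 \<le> y"
  shows "\<not> isXA (s' k)" "fst (s' k) \<noteq> 1354"
proof -
  obtain a b c d where q: "1 \<le> a" "a < b" "b < c" "c < d" "d \<le> 1821"
    "s k = (a,c) \<and> s' k = (b,d) \<or> s k = (b,d) \<and> s' k = (a,c)"
    "edge (R k) a b" "edge (R k) b c" "edge (R k) c d" "edge (R k) a d"
    by (rule quad[OF assms(1)])
  show "\<not> isXA (s' k)" using q(1-6) nf[OF _ q(9)] assms by (auto simp: forb_def)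
  show "fst (s' k) \<noteq> 1354" using q(1-6) nf[OF _ q(7)] assms by (auto simp: forb_def)
qed

lemma kinds_T:
  assumes "(x,y) \<in> arcsT"
  shows "x \<le> 751 \<and> 1355 \<le> y \<or> (x,y) \<in> {(751,1353),(752,1353),(1353,1355)} \<or> (x,y) \<in> arcsTA"
  using assms by (auto simp: arcsT_def)

lemma insert_XA:
  assumes "k < L" "isXA (s' k)"
  shows "s k \<notin> arcsT \<or> s k \<in> arcsTA \<or> s k \<in> {(751,1353),(752,1353)}"
proof -
  obtain x y where xy: "s k = (x,y)" by force
  obtain i j where ij: "s' k = (i,j)" by force
  show ?thesis using ladder_flip(1)[OF assms(1) xy] kinds_T[of x y] xk[OF assms(1)] assms(2) xy ij by auto
qed

lemma TA_quad:
  assumes k: "k < L" and s: "s k \<in> arcsTA" and x: "isXA (s' k)"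
  obtains t a l u where "s k = (l,u)" "s' k = (t,a)" "l < a" "a < u" "1 \<le> t" "t \<le> 751" "752 \<le> l" "u \<le> 1352"
    "u + l = 2104 \<or> u + l = 2105" "l + 2 \<le> u" "edge (R k) t l" "edge (R k) t u"
proof -
  obtain a b c d where q: "1 \<le> a" "a < b" "b < c" "c < d" "d \<le> 1821"
    "s k = (a,c) \<and> s' k = (b,d) \<or> s k = (b,d) \<and> s' k = (a,c)"
    "edge (R k) a b" "edge (R k) b c" "edge (R k) c d" "edge (R k) a d"
    by (rule quad[OF k])
  have "s k = (b,d) \<and> s' k = (a,c)" using q(2,6) s x by (auto simp: arcsTA_def)
  then show ?thesis using that[of b d a c] q s x by (auto simp: arcsTA_def)
qed

text \<open>Apart from five exceptional arcs, direct exchanges insert caps or replace an arc inside the second block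
by one to an apex in the first block.\<close>

lemma TT_le: "card TT \<le> card TJ + card (TA {1..751}) + 5"
proof -
  \<comment> \<open>the five exceptional arcs\<close>
  let ?B = "{k. k < L \<and> s' k \<in> {(1,1353),(1353,1821)}}" and ?C = "{k. k < L \<and> s k \<in> {(751,1353),(752,1353),(1353,1355)}}"
  have "TT \<subseteq> TJ \<union> TA {1..751} \<union> ?B \<union> ?C"
  proof
    fix k assume "k \<in> TT"
    then have k: "k < L" "s k \<in> arcsT" "s' k \<in> arcsT'" by (auto simp: TT_def)
    obtain x y where xy: "s k = (x,y)" by force
    obtain i j where ij: "s' k = (i,j)" by force
    have T': "isXA (i,j) \<or> (i,j) \<in> caps \<or> (i,j) \<in> {(1,1353),(1353,1821)} \<or> i = 1354"
      using k(3) ij st(6)[OF k(1)] by (auto simp: arcsT'_def arcsXA_def)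
    consider "x \<le> 751" "1355 \<le> y" | "(x,y) \<in> {(751,1353),(752,1353),(1353,1355)}" | "(x,y) \<in> arcsTA"
      using kinds_T k(2) xy by metis
    then show "k \<in> TJ \<union> TA {1..751} \<union> ?B \<union> ?C"
    proof cases
      case 1
      then show ?thesis using ladder_flip[OF k(1) xy] T' ij k by (auto simp: TJ_def)
    next
      case 2 then show ?thesis using k xy by auto
    next
      case 3
      then have "isXA (i,j) \<or> (i,j) = (1,1353)"
        using T' xk[OF k(1)] xy ij by (auto simp: arcsTA_def caps_def)
      then show ?thesis using k 3 xy ij by (auto simp: TA_def)
    qed
  qed
  then have "card TT \<le> card (TJ \<union> TA {1..751} \<union> ?B \<union> ?C)" by (intro card_mono) auto
  also have "\<dots> \<le> card TJ + card (TA {1..751}) + card ?B + card ?C"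
    by (intro order_trans[OF card_Un_le] add_mono) auto
  also have "card ?B \<le> 2" by (rule order_trans[OF card_s']) (auto simp: arcsT'_def)
  also have "card ?C \<le> 3" by (rule order_trans[OF card_s]) (auto simp: arcsT_def)
  finally show ?thesis by simp
qed

lemma SP_le: "card (SPs S) \<le> 2" "card SP \<le> 2"
proof -
  show "card SP \<le> 2" unfolding SP_def by (rule order_trans[OF card_s]) (auto simp: arcsT_def)
  moreover have "card (SPs S) \<le> card SP" by (rule card_mono) (auto simp: SPs_def SP_def)
  ultimately show "card (SPs S) \<le> 2" by simp
qed

lemma XA_degree: "finite {a. (t,a) \<in> arcsXA}" "card {a. (t,a) \<in> arcsXA} \<le> 2"
proof -
  have sub: "{a. (t,a) \<in> arcsXA} \<subseteq> {1502-t,1503-t} \<or> {a. (t,a) \<in> arcsXA} \<subseteq> {1052}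
     \<or> {a. (t,a) \<in> arcsXA} \<subseteq> {1352-t,1353-t}"
  proof -
    consider "t \<le> 300" | "301 \<le> t" "t \<le> 450" | "451 \<le> t" by linarith
    then show ?thesis
    proof cases
      case 1 
      then have "{a. (t,a) \<in> arcsXA} \<subseteq> {1352-t,1353-t}" by (auto simp: arcsXA_def)
      then show ?thesis by blast
    next
      case 2
      then have "{a. (t,a) \<in> arcsXA} \<subseteq> {1052}" by (auto simp: arcsXA_def)
      then show ?thesis by blast
    next
      case 3
      then have "{a. (t,a) \<in> arcsXA} \<subseteq> {1502-t,1503-t}" by (auto simp: arcsXA_def)
      then show ?thesis by blast
    qed
  qed
  show "finite {a. (t,a) \<in> arcsXA}" using sub by (auto intro: finite_subset)
  have le: "card B \<le> 2" if "B \<subseteq> {x,y}" for B and x y :: nat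
    using card_mono[OF _ that] card_insert_le_m1[of 2 "{y}" x] by (auto simp: card_insert_if split: if_splits)
  show "card {a. (t,a) \<in> arcsXA} \<le> 2" using sub le[of _ 1052 1052] le by (metis insert_absorb2)
qed

text \<open>Before the first flip with apex \<open>t\<close> two arcs join \<open>t\<close> to the second block. Those among them that belong to
the last triangulation use up one of the at most two such arcs at \<open>t\<close> and leave fewer of them for direct
exchanges; each of the others was inserted by an intermediate flip or by removing one of two special arcs.\<close>

lemma apex_le: "card (TA {t}) \<le> card (Is {t}) + card (SPs {t})"
proof (cases "TA {t} = {}")
  case False
  then obtain k9 where k9: "k9 \<in> TA {t}" by blast
  \<comment> \<open>the first flip with apex \<open>t\<close>, directly or not\<close>
  define k0 where "k0 = (LEAST k. k < L \<and> s k \<in> arcsTA \<and> isXA (s' k) \<and> fst (s' k) = t)"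
  have ex: "k9 < L \<and> s k9 \<in> arcsTA \<and> isXA (s' k9) \<and> fst (s' k9) = t" using k9 by (auto simp: TA_def)
  have k0: "k0 < L" "s k0 \<in> arcsTA" "isXA (s' k0)" "fst (s' k0) = t"
    using LeastI[of "\<lambda>k. k < L \<and> s k \<in> arcsTA \<and> isXA (s' k) \<and> fst (s' k) = t", OF ex] unfolding k0_def by auto
  have least: "\<not> (s k \<in> arcsTA \<and> isXA (s' k) \<and> fst (s' k) = t)" if "k < k0" for k
    using not_less_Least[OF that[unfolded k0_def]] that k0(1) by auto
  have "(t, snd (s' k9)) \<in> arcsXA" using k9 by (cases "s' k9") (auto simp: TA_def arcsT'_def caps_def)
  then have t750: "t \<le> 750" by (auto simp: arcsXA_def)
  obtain a l u where q: "s k0 = (l,u)" "s' k0 = (t,a)" "l < a" "a < u" "1 \<le> t" "t \<le> 751" "752 \<le> l" "u \<le> 1352"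
    "edge (R k0) t l" "edge (R k0) t u"
    by (rule TA_quad[OF k0(1-3)]) (use k0(4) in auto)
  have arcs: "(t,l) \<in> R k0" "(t,u) \<in> R k0" using q t750 by (auto simp: edge_def)
  have nT: "(t,l) \<notin> arcsT" "(t,u) \<notin> arcsT" using q by (auto simp: arcsT_def arcsTA_def)
  obtain k1 where k1: "k1 < k0" "s' k1 = (t,l)" using inserted[OF _ arcs(1) nT(1)] k0 by auto
  obtain k2 where k2: "k2 < k0" "s' k2 = (t,u)" using inserted[OF _ arcs(2) nT(2)] k0 by auto
  define D where "D = {a. (t,a) \<in> arcsXA}"
  define E where "E = (snd \<circ> s') ` TA {t}"
  have nk: "s k1 \<notin> arcsTA" "s k2 \<notin> arcsTA" "k1 < L" "k2 < L" "isXA (s' k1)" "isXA (s' k2)"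
    using least[OF k1(1)] least[OF k2(1)] k1 k2 q k0(1) by auto
  have cE: "card E = card (TA {t})" unfolding E_def
  proof (rule card_image, rule inj_onI)
    fix x y assume xy: "x \<in> TA {t}" "y \<in> TA {t}" "(snd \<circ> s') x = (snd \<circ> s') y"
    then have "s' x = s' y" by (auto simp: TA_def prod_eq_iff)
    then show "x = y" using xy inj_s' by (auto simp: TA_def inj_on_def)
  qed
  have ED: "E \<subseteq> D" by (auto simp: E_def D_def TA_def arcsT'_def caps_def)
  have El: "E \<inter> {l,u} = {}"
  proof -
    have *: "False" if "k \<in> TA {t}" "s' k = s' m" "s m \<notin> arcsTA" "m < L" for k m
      using that inj_s' by (auto simp: TA_def inj_on_def)
    have "w \<notin> E" if m: "s' m = (t,w)" "s m \<notin> arcsTA" "m < L" for m w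
    proof
      assume "w \<in> E"
      then obtain k where k: "k \<in> TA {t}" "w = snd (s' k)" unfolding E_def by auto
      then have "s' k = s' m" using m by (simp add: TA_def prod_eq_iff)
      then show False using *[OF k(1) _ m(2,3)] by blast
    qed
    then show ?thesis using k1 k2 nk by blast
  qed
  have sub: "{l,u} - D \<subseteq> (snd \<circ> s') ` (Is {t} \<union> SPs {t})"
  proof -
    have "m \<in> Is {t} \<union> SPs {t}" if "s' m = (t,w)" "w \<notin> D" "s m \<notin> arcsTA" "m < L" "isXA (s' m)" for m w
      using insert_XA[OF that(4,5)] that by (auto simp: Is_def SPs_def WW_def D_def arcsT'_def caps_def)
    then show ?thesis using k1 k2 nk by force
  qed
  have "card ({l,u} - D) \<le> card (Is {t} \<union> SPs {t})" by (rule surj_card_le[OF _ sub]) simp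
  also have "\<dots> \<le> card (Is {t}) + card (SPs {t})" by (rule card_Un_le)
  finally have 1: "card ({l,u} - D) \<le> card (Is {t}) + card (SPs {t})" .
  have finE: "finite E" using ED XA_degree(1) finite_subset D_def by blast
  have "card (E \<union> ({l,u} \<inter> D)) = card E + card ({l,u} \<inter> D)"
    by (rule card_Un_disjoint) (use El finE in auto)
  moreover have "card (E \<union> ({l,u} \<inter> D)) \<le> card D" by (rule card_mono) (use ED XA_degree(1) D_def in auto)
  moreover have "card D \<le> 2" using XA_degree(2) D_def by simp
  moreover have "card ({l,u} \<inter> D) + card ({l,u} - D) = 2"
    using card_Int_Diff[of "{l,u}" D] q(3,4) by simp
  ultimately show ?thesis using 1 cE by linarith
qed simp

lemma apexes_le: assumes "finite S" shows "card (TA S) \<le> card (Is S) + card (SPs S)"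
  using assms
proof induction
  case empty then show ?case by (simp add: TA_def)
next
  case (insert t S)
  have "TA (insert t S) = TA {t} \<union> TA S" by (auto simp: TA_def)
  then have "card (TA (insert t S)) \<le> card (TA {t}) + card (TA S)" by (simp add: card_Un_le)
  moreover have "card (Is (insert t S)) = card (Is {t} \<union> Is S)" by (rule arg_cong[of _ _ card]) (auto simp: Is_def)
  moreover have "card (Is {t} \<union> Is S) = card (Is {t}) + card (Is S)"
    by (rule card_Un_disjoint) (use insert in \<open>auto simp: Is_def\<close>)
  moreover have "card (SPs (insert t S)) = card (SPs {t} \<union> SPs S)" by (rule arg_cong[of _ _ card]) (auto simp: SPs_def)
  moreover have "card (SPs {t} \<union> SPs S) = card (SPs {t}) + card (SPs S)"
    by (rule card_Un_disjoint) (use insert in \<open>auto simp: SPs_def\<close>)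
  ultimately show ?case using apex_le[of t] insert.IH by linarith
qed

text \<open>All the arcs of the first triangulation above a vertex of the second block are nested, and an arc from
this vertex to the first block crosses those that remain.\<close>

lemma TA_once:
  assumes "k < m" "m < L" "s k \<in> arcsTA" "isXA (s' k)" "s m \<in> arcsTA" "isXA (s' m)" "snd (s' k) = snd (s' m)"
  shows False
proof -
  obtain t a l u where q: "s k = (l,u)" "s' k = (t,a)" by (cases "s k", cases "s' k") auto
  obtain t' a' l' u' where q': "s m = (l',u')" "s' m = (t',a')" "l' < a'" "a' < u'" "t' \<le> 751" "752 \<le> l'"
    using TA_quad[OF assms(2,5,6)] by metis
  have "(l',u') \<in> arcsT" using q'(1) assms(5) by (simp add: arcsT_def)
  then have "(l',u') \<in> R (Suc k)" using monoT[of "(l',u')" "Suc k" m] st(1)[of m] assms q' by auto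
  moreover have "(t,a) \<in> R (Suc k)" using st(4)[of k] assms q by auto
  moreover have "xing (t,a) (l',u')" using q q' assms(4,7) by auto
  ultimately show False using tri_non[OF tr] assms(1,2) by (metis Suc_leI less_imp_le_nat less_trans)
qed

text \<open>The vertices 301 to 450 have no neighbour but 1052 in the second block, in the last triangulation, and
only one direct exchange ends at 1052.\<close>

lemma TA_gap: "card (TA {301..450}) \<le> 1"
proof -
  have g: "snd (s' k) = 1052" if "k \<in> TA {301..450}" for k
    using that by (cases "s' k") (auto simp: TA_def arcsT'_def caps_def arcsXA_def)
  have "x = y" if "x \<in> TA {301..450}" "y \<in> TA {301..450}" for x y
    using TA_once[of x y] TA_once[of y x] that g[OF that(1)] g[OF that(2)] by (fastforce simp: TA_def)
  then show ?thesis by (auto simp: card_le_Suc0_iff_eq)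
qed

lemma card_split: "card WW = card Wn + card (Is S) + card (Is ({1..751} - S))"
proof -
  have "card (Wn \<union> (Is S \<union> Is ({1..751} - S))) = card Wn + card (Is S \<union> Is ({1..751} - S))"
    by (rule card_Un_disjoint) (auto simp: Wn_def Is_def)
  moreover have "card (Is S \<union> Is ({1..751} - S)) = card (Is S) + card (Is ({1..751} - S))"
    by (rule card_Un_disjoint) (auto simp: Is_def)
  moreover have "Wn \<union> (Is S \<union> Is ({1..751} - S)) = WW" by (auto simp: Wn_def Is_def isXA_def)
  ultimately show ?thesis by simp
qed

lemma TA_split: assumes "S \<subseteq> {1..751}" shows "card (TA {1..751}) \<le> card (TA S) + card (TA ({1..751} - S))"
proof -
  have "TA {1..751} = TA S \<union> TA ({1..751} - S)" using assms by (auto simp: TA_def)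
  then show ?thesis by (simp add: card_Un_le)
qed

lemma TJ_le: "card TJ \<le> 15" and card_caps: "card caps = 15" and fin_caps: "finite caps"
proof -
  have c: "caps = (\<lambda>i. (i,1371)) ` {1355..1369}" by (auto simp: caps_def)
  show f: "finite caps" by (simp add: c)
  show cc: "card caps = 15" unfolding c by (subst card_image) (auto simp: inj_on_def)
  have "card TJ \<le> card {k. k < L \<and> s' k \<in> caps}" by (rule card_mono) (auto simp: TJ_def)
  also have "\<dots> \<le> 15" using card_s'[OF f] cc by (auto simp: arcsT'_def)
  finally show "card TJ \<le> 15" .
qed

text \<open>The apices outside 301 to 450 are paid for by intermediate flips, and these cancel in the surplus of the
direct exchanges. What remains of it is bounded by the number of caps.\<close>

lemma ineqA: "card Wn + card (Is {301..450}) + 2 \<le> card TJ"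
  using WW_TT TT_le card_split[of "{301..450}"] TA_split[of "{301..450}"] TA_gap
    apexes_le[of "{1..751} - {301..450}"] SP_le(1)[of "{1..751} - {301..450}"] by simp

lemma ineqB: "card (Is {401..751}) \<le> card (TA {401..751}) + 12"
  using WW_TT TT_le card_split[of "{401..751}"] TA_split[of "{401..751}"] TJ_le
    apexes_le[of "{1..751} - {401..751}"] SP_le(1)[of "{1..751} - {401..751}"] by simp

end

section \<open>Monotone walks are long\<close>

lemma card_Un3: "card (A \<union> B \<union> C) \<le> card A + card B + card C"
  using card_Un_le[of "A \<union> B" C] card_Un_le[of A B] by linarith

context short_walk begin

lemma Wn_le: "card Wn \<le> 13" "card Wn + card (Is {301..450}) \<le> 13"
  using ineqA TJ_le by auto

lemma ladder_in_T':
  assumes "(x,y) \<in> arcsT'" "x \<le> 751" "1355 \<le> y" shows "(x,y) = (1,1821)"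
  using assms by (auto simp: arcsT'_def arcsXA_def caps_def)

text \<open>The ladder arcs that belong to neither triangulation. As soon as (751, 1371) is present, only these join the
vertices between 451 and 751 to vertices beyond 751.\<close>

definition "Lad = {(x,y). x \<le> 751 \<and> 1355 \<le> y \<and> (x,y) \<notin> arcsT \<and> (\<exists>k\<le>L. (x,y) \<in> R k)}"

lemma fin_Lad [simp]: "finite Lad"
proof (rule finite_subset)
  show "Lad \<subseteq> {..751} \<times> {..1821}" using tri_bounds[OF tr] by (fastforce simp: Lad_def)
qed simp

text \<open>Each of these arcs has to be removed, and the arc that replaces it can be neither an arc to the second
block nor one at 1354: it is intermediate, one of two arcs at the reflex corner, or a cap that does not
arise directly from an arc of the first triangulation.\<close>

lemma Lad_le: "card Lad \<le> 15"
proof -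
  let ?B = "{k. k < L \<and> s' k \<in> {(1,1353),(1353,1821)}}" and ?C = "{k. k < L \<and> s' k \<in> caps} - TJ"
  have "Lad \<subseteq> s ` (Wn \<union> ?B \<union> ?C)"
  proof
    fix e assume "e \<in> Lad"
    then obtain x y k where e: "e = (x,y)" "x \<le> 751" "1355 \<le> y" "(x,y) \<notin> arcsT" "k \<le> L" "(x,y) \<in> R k"
      by (auto simp: Lad_def)
    have nT': "(x,y) \<notin> arcsT'" using ladder_in_T' e eps_T by metis
    obtain m where m: "m < L" "s m = (x,y)" using removed[OF e(5,6) nT'] by blast
    note l = ladder_flip[OF m e(2,3)]
    have "m \<in> Wn \<union> ?B \<union> ?C"
    proof (cases "s' m \<in> arcsT'")
      case False
      then show ?thesis using m e l by (auto simp: Wn_def WW_def)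
    next
      case True
      then show ?thesis using m e l st(6)[OF m(1)] by (cases "s' m") (auto simp: TJ_def arcsT'_def arcsXA_def)
    qed
    then show "e \<in> s ` (Wn \<union> ?B \<union> ?C)" by (rule rev_image_eqI) (simp add: m e)
  qed
  then have "card Lad \<le> card (Wn \<union> ?B \<union> ?C)" by (rule surj_card_le[rotated]) auto
  also have "\<dots> \<le> card Wn + card ?B + card ?C" by (rule card_Un3)
  also have "card ?B \<le> 2" by (rule order_trans[OF card_s']) (auto simp: arcsT'_def)
  finally have "card Lad \<le> card Wn + 2 + card ?C" by simp
  moreover have "card ?C = card {k. k < L \<and> s' k \<in> caps} - card TJ"
    by (rule card_Diff_subset) (auto simp: TJ_def)
  moreover have "card {k. k < L \<and> s' k \<in> caps} \<le> 15" using card_s'[OF fin_caps] card_caps by (auto simp: arcsT'_def)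
  ultimately show ?thesis using ineqA TJ_le by arith
qed

lemma TJ_kinds:
  assumes "k \<in> TJ"
  obtains x y j where "s k = (x,y)" "s' k = (j,1371)" "x \<le> 751" "y \<le> 1370" "j < y" "1355 \<le> j" "edge (R k) x 1371"
    "x = 751 \<or> y = 1370"
proof -
  have k: "k < L" "s k \<in> arcsT" "s' k \<in> caps" using assms by (auto simp: TJ_def)
  obtain x y where xy: "s k = (x,y)" by force
  obtain j where j: "s' k = (j,1371)" "1355 \<le> j" "j \<le> 1369" using k(3) by (auto simp: caps_def)
  obtain a b c d where q: "1 \<le> a" "a < b" "b < c" "c < d" "d \<le> 1821"
    "s k = (a,c) \<and> s' k = (b,d) \<or> s k = (b,d) \<and> s' k = (a,c)"
    "edge (R k) a b" "edge (R k) b c" "edge (R k) c d" "edge (R k) a d"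
    by (rule quad[OF k(1)])
  have x: "x \<le> 1353" "1355 \<le> y \<Longrightarrow> x = 1353 \<or> x \<le> 751" using k(2) xy by (auto simp: arcsT_def arcsTA_def)
  then have "s k = (a,c) \<and> s' k = (b,d)" using q(2-6) xy j by auto
  then have *: "a = x" "c = y" "b = j" "d = 1371" using xy j by auto
  have 1: "y < 1371" "1355 < y" "x \<le> 751" using * q j x k(2) xy by (auto simp: arcsT_def arcsTA_def)
  have 2: "x = 751 \<or> y = 1370" using 1 k(2) xy by (auto simp: arcsT_def arcsTA_def)
  show ?thesis using that[OF xy j(1) 1(3) _ _ j(2) _ 2] 1 q * by simp
qed

text \<open>Direct exchanges for caps remove arcs (751, j) or (x, 1370), and the arc that joins the lower end to 1371
is a side of the quadrilateral. Two of them cannot both remove arcs at 1370, because the first of the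
two caps crosses all such arcs that are left.\<close>

lemma hub_exists: obtains \<sigma> where "\<sigma> < L" "(751,1371) \<in> R \<sigma>"
proof -
  have "2 \<le> card TJ" using ineqA by simp
  then obtain k m where "k \<in> TJ" "m \<in> TJ" "k < m"
    by (metis card_le_Suc0_iff_eq fin(3) linorder_neqE_nat not_less_eq_eq numeral_2_eq_2)
  obtain x y j where k: "s k = (x,y)" "s' k = (j,1371)" "x \<le> 751" "y \<le> 1370" "j < y" "1355 \<le> j" "edge (R k) x 1371" "x = 751 \<or> y = 1370"
    by (rule TJ_kinds[OF \<open>k \<in> TJ\<close>])
  obtain x' y' j' where m: "s m = (x',y')" "s' m = (j',1371)" "x' \<le> 751" "y' \<le> 1370" "j' < y'" "1355 \<le> j'" "edge (R m) x' 1371" "x' = 751 \<or> y' = 1370"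
    by (rule TJ_kinds[OF \<open>m \<in> TJ\<close>])
  have kL: "k < L" "m < L" "s m \<in> arcsT" using \<open>k \<in> TJ\<close> \<open>m \<in> TJ\<close> by (auto simp: TJ_def)
  have "False" if "x \<noteq> 751" "x' \<noteq> 751"
  proof -
    have "(x',y') \<in> R (Suc k)" using monoT[of "(x',y')" "Suc k" m] st(1)[OF kL(2)] m(1) kL \<open>k < m\<close> by auto
    moreover have "(j,1371) \<in> R (Suc k)" using st(4)[OF kL(1)] k(2) by simp
    ultimately show False using tri_non[OF tr[of "Suc k"], of "(x',y')" "(j,1371)"] kL k m that by auto
  qed
  then consider "x = 751" | "x' = 751" by blast
  then show ?thesis
  proof cases
    case 1 then show ?thesis using that[of k] k(7) kL by (simp add: edge_def)
  next
    case 2 then show ?thesis using that[of m] m(7) kL by (simp add: edge_def)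
  qed
qed

text \<open>The arc (751, 1371) shields the vertices before 751 from the second block and from the vertices up to
1370. What remains visible is reached by intermediate ladder arcs only.\<close>

lemma uncovered_ladder:
  assumes \<sigma>: "\<sigma> < L" "(751,1371) \<in> R \<sigma>" and x: "452 \<le> x" "x \<le> 750" and n: "\<not> covered (R \<sigma>) x"
  shows "x \<in> fst ` Lad"
proof -
  have tri: "tri (R \<sigma>)" using tr \<sigma> by simp
  obtain k l c d where h: "edge (R \<sigma>) k x" "edge (R \<sigma>) x l" "edge (R \<sigma>) c d" "c \<le> k" "l \<le> d" 
      "c < k \<Longrightarrow> \<not> okarc (c,x)" "l < d \<Longrightarrow> \<not> okarc (x,d)"
    by (rule vertex_hull[OF tri, of x]) (use x in auto)
  have b: "k < x" "x < l" "d \<le> 1821" using edge_bounds[OF tri] h(1-3) by auto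
  have "c = k" using h(4) h(6) b x by (cases "c < k") (auto simp: okarc_simp forb_def)
  show ?thesis
  proof (cases "l \<le> 751")
    case True
    have "d = l"
    proof (rule ccontr)
      assume "d \<noteq> l"
      then have "l < d" using h(5) by simp
      then have "forb x d" using h(7) b x by (auto simp: okarc_simp)
      then have "d = 1354" using x by (auto simp: forb_def)
      then have "1 \<le> c" using h(3) no_zero[of \<sigma> c d] \<sigma> by (cases "c = 0") (auto simp: edge_def)
      moreover have "\<not> forb c d" using nf[OF _ h(3)] \<sigma> by simp
      ultimately show False using \<open>d = 1354\<close> \<open>c = k\<close> b x by (auto simp: forb_def)
    qed
    then show ?thesis using covered_edge[OF h(3)] n True b \<open>c = k\<close> by auto
  next
    case False
    then have xl: "(x,l) \<in> R \<sigma>" using h(2) x by (auto simp: edge_def)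
    have "\<not> xing (x,l) (751,1371)" using tri_non[OF tri xl \<sigma>(2)] .
    then have "1371 \<le> l" using False x by auto
    then have "(x,l) \<in> Lad" using xl \<sigma>(1) x by (auto simp: Lad_def arcsT_def arcsTA_def intro!: exI[of _ \<sigma>])
    then show ?thesis by force
  qed
qed

lemma ladder_edge:
  assumes "k \<le> L" "edge (R k) x y" "1 \<le> x" "x \<le> 751" "1372 \<le> y" "x \<noteq> 1822 - y" "x \<noteq> 1823 - y"
  shows "(x,y) \<in> Lad"
proof -
  have "(x,y) \<in> R k" using assms by (auto simp: edge_def)
  then show ?thesis using assms by (auto simp: Lad_def arcsT_def arcsTA_def)
qed

lemma no_XX: "(x,y) \<in> arcsT \<union> arcsT' \<Longrightarrow> 751 < y"
  by (auto simp: arcsT_def arcsTA_def arcsT'_def arcsXA_def caps_def)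

definition "CV = {x. 301 \<le> x \<and> x \<le> 450 \<and> (\<exists>k\<le>L. covered (R k) x)}"

text \<open>When one of these vertices is cut off for the first time, the removed arc is intermediate or it is an arc
of the zigzag to the last block. In the second case the far end \<open>w\<close> of the removed arc is adjacent to
both ends of the new arc, which are on different sides of the vertex. As \<open>w\<close> has only two, consecutive,
neighbours in the zigzag, one of these adjacencies is an intermediate ladder arc.\<close>

lemma CV_le: "card CV \<le> 43"
proof -
  let ?D = "\<Union>e\<in>Lad. {1822 - snd e, 1823 - snd e}"
  have "CV \<subseteq> (fst \<circ> s) ` Wn \<union> ?D"
  proof
    fix x assume "x \<in> CV"
    then obtain m where x: "301 \<le> x" "x \<le> 450" and m: "m \<le> L" "covered (R m) x" by (auto simp: CV_def)
    have "\<not> covered (R 0) x" using no_XX R0 by (fastforce simp: covered_def)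
    then obtain k where k: "k < m" "\<not> covered (R k) x" "covered (R (Suc k)) x"
      by (rule first_true[of "\<lambda>k. covered (R k) x", OF _ m(2)])
    have kL: "k < L" using k m by simp
    obtain c d w where q: "s' k = (c,d)" "c < x" "x < d" "d \<le> 751" "s k = (x,w)" "751 < w" "edge (R k) c w" "edge (R k) d w"
      using cover_flip[OF fl[OF kL] k(2,3)] by metis
    have c1: "1 \<le> c" using no_zero[of "Suc k" c d] st(4)[OF kL] q(1) kL by simp
    have nT': "s' k \<notin> arcsT'" using no_XX q by (metis UnI2 not_less)
    show "x \<in> (fst \<circ> s) ` Wn \<union> ?D"
    proof (cases "s k \<in> arcsT")
      case False
      then have "k \<in> Wn" using kL nT' q by (auto simp: Wn_def WW_def)
      then show ?thesis using q by force
    next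
      case True
      then have xw: "x = 1822 - w \<or> x = 1823 - w" "1372 \<le> w" "w \<le> 1821" using q x by (auto simp: arcsT_def arcsTA_def)
      have "c \<noteq> 1822 - w \<and> c \<noteq> 1823 - w \<or> d \<noteq> 1822 - w \<and> d \<noteq> 1823 - w"
        using xw q(2,3) by arith
      then have "(c,w) \<in> Lad \<or> (d,w) \<in> Lad"
        using ladder_edge[OF _ q(7)] ladder_edge[OF _ q(8)] kL c1 q(2-4) xw(2) by (meson le_trans less_imp_le_nat)
      then show ?thesis using xw by (auto intro: rev_bexI)
    qed
  qed
  then have "card CV \<le> card ((fst \<circ> s) ` Wn \<union> ?D)" by (intro card_mono) auto
  also have "\<dots> \<le> card ((fst \<circ> s) ` Wn) + card ?D" by (rule card_Un_le)
  also have "card ?D \<le> (\<Sum>e\<in>Lad. card {1822 - snd e, 1823 - snd e})" by (rule card_UN_le) simp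
  also have "\<dots> \<le> (\<Sum>e\<in>Lad. 2)" by (rule sum_mono) (simp add: card_insert_if)
  also have "\<dots> \<le> 30" using Lad_le by simp
  also have "card ((fst \<circ> s) ` Wn) \<le> card Wn" by (rule card_image_le) simp
  finally show ?thesis using Wn_le by simp
qed

text \<open>An arc within the first block over 50 consecutive vertices out of 301 to 450 would cut off all of them,
but at most 43 are ever cut off.\<close>

lemma no_span:
  assumes "k \<le> L" "edge (R k) c d" "c < m" "m + 49 < d" "d \<le> 751" "301 \<le> m" "m \<le> 401"
  shows False
proof -
  have "{m..m+49} \<subseteq> CV" using covered_edge[OF assms(2)] assms by (auto simp: CV_def intro!: exI[of _ k])
  then have "card {m..m+49} \<le> card CV" by (intro card_mono) (auto simp: CV_def intro: finite_subset[of _ "{..450}"])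
  then show False using CV_le by simp
qed

definition "U = {u. 1053 \<le> u \<and> u \<le> 1352 \<and> (\<exists>k\<le>L. \<exists>t. 401 \<le> t \<and> t \<le> 751 \<and> (t,u) \<in> R k)}"

lemma fin_U [simp]: "finite U"
  by (rule finite_subset[of _ "{..1352}"]) (auto simp: U_def)

text \<open>Consider the last removal of an arc from \<open>u\<close> to a vertex beyond 350. If the inserted arc ends in the second
block, then its lower end \<open>a\<close> is adjacent to \<open>u\<close> as well and lies below 351. The side from \<open>a\<close> to the other
vertex \<open>t\<close> spans neither 301 to 350 nor 351 to 400, which places both \<open>a\<close> and \<open>t\<close> among the vertices
301 to 400. So two intermediate arcs at \<open>u\<close> have been inserted, and at most one of them directly
replaced an arc of the first triangulation.\<close>

lemma U_le: "card U \<le> 15"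
proof -
  let ?A = "(snd \<circ> s) ` Wn" and ?B = "(snd \<circ> s') ` (Is {301..450} \<union> SP)"
  have "U \<subseteq> ?A \<union> ?B"
  proof
    fix u assume "u \<in> U"
    then obtain k9 t9 where u: "1053 \<le> u" "u \<le> 1352" and k9: "k9 \<le> L" "401 \<le> t9" "t9 \<le> 751" "(t9,u) \<in> R k9"
      by (auto simp: U_def)
    \<comment> \<open>as 351 is less than the 401 in the definition of \<open>U\<close>, there are 50 vertices between 350 and the arcs that define \<open>U\<close>\<close>
    define P where "P k \<longleftrightarrow> (\<exists>t. 351 \<le> t \<and> t \<le> 751 \<and> (t,u) \<in> R k)" for k
    have "P k9" unfolding P_def using k9 by (intro exI[of _ t9]) auto
    moreover have "\<not> P L" unfolding P_def RL using u by (auto simp: arcsT'_def arcsXA_def caps_def)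
    ultimately obtain k where k: "k < L" "P k" "\<not> P (Suc k)" by (rule last_true[of P k9 L, OF _ _ k9(1)])
    obtain t where t: "351 \<le> t" "t \<le> 751" "(t,u) \<in> R k" using k(2) by (auto simp: P_def)
    have sk: "s k = (t,u)" 
    proof (rule ccontr)
      assume "s k \<noteq> (t,u)"
      then have "(t,u) \<in> R (Suc k)" unfolding st(9)[OF k(1)] using t(3) by auto
      then show False using k(3) t by (auto simp: P_def)
    qed
    have nT: "(i,u) \<notin> arcsT" if "i \<le> 751" for i using that u by (auto simp: arcsT_def arcsTA_def)
    have later: "i \<le> 350" if "edge (R (Suc k)) i u" "i \<le> 751" for i
    proof (rule ccontr)
      assume "\<not> i \<le> 350"
      then have "P (Suc k)" unfolding P_def using that u by (intro exI[of _ i]) (auto simp: edge_def)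
      then show False using k(3) by simp
    qed
    show "u \<in> ?A \<union> ?B"
    proof (cases "isXA (s' k)")
      case False
      have "s' k \<notin> arcsT'"
        using False xk[OF k(1)] sk st(6)[OF k(1)] t u by (cases "s' k") (auto simp: arcsT'_def arcsXA_def caps_def)
      then have "k \<in> Wn" using False k(1) sk nT[OF t(2)] by (auto simp: Wn_def WW_def)
      then show ?thesis using sk by force
    next
      case True
      obtain a b c d where q: "1 \<le> a" "a < b" "b < c" "c < d" "d \<le> 1821"
        "s k = (a,c) \<and> s' k = (b,d) \<or> s k = (b,d) \<and> s' k = (a,c)"
        "edge (R k) a b" "edge (R k) a d" "edge (R (Suc k)) b c" "edge (R (Suc k)) a d"
        by (rule quad[OF k(1)])
      have "\<not> (s k = (a,c) \<and> s' k = (b,d))"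
        using later[of b] q(2,9) sk True t by auto
      then have e: "s' k = (a,c)" "b = t" "d = u" using q(6) sk by auto
      have a350: "a \<le> 350" using later[of a] q(10) e q(2) t by auto
      have t400: "t \<le> 400" using no_span[of k a t 351] q(7) e a350 t k(1) by fastforce
      have a301: "301 \<le> a" using no_span[of k a t 301] q(7) e t k(1) by fastforce
      have "(a,u) \<in> R k" using q(8) e a350 u a301 by (auto simp: edge_def)
      obtain k1 where k1: "k1 < k" "s' k1 = (t,u)" using inserted[OF _ t(3) nT[OF t(2)]] k(1) by auto
      obtain k2 where k2: "k2 < k" "s' k2 = (a,u)" using inserted[OF _ \<open>(a,u) \<in> R k\<close> nT[of a]] k(1) a350 by auto
      have XA: "isXA (s' k1)" "isXA (s' k2)" using k1 k2 t a301 a350 u by auto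
      have nT': "s' k1 \<notin> arcsT'" "s' k2 \<notin> arcsT'" using k1 k2 t a301 u by (auto simp: arcsT'_def arcsXA_def caps_def)
      have kL: "k1 < L" "k2 < L" using k1 k2 k by auto
      have "k1 \<noteq> k2" using k1 k2 q(2) e by auto
      then have "s k1 \<notin> arcsTA \<or> s k2 \<notin> arcsTA"
        using TA_once[of k1 k2] TA_once[of k2 k1] XA kL k1 k2 by (metis linorder_neqE_nat snd_conv)
      then have "k1 \<in> Is {301..450} \<union> SP \<or> k2 \<in> Is {301..450} \<union> SP"
        using insert_XA[OF kL(1) XA(1)] insert_XA[OF kL(2) XA(2)] nT' XA kL k1(2) k2(2) t t400 a301 a350
        by (auto simp: Is_def WW_def SP_def)
      then show ?thesis using k1 k2 by force
    qed
  qed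
  then have "card U \<le> card (?A \<union> ?B)" by (intro card_mono) auto
  also have "\<dots> \<le> card ?A + card ?B" by (rule card_Un_le)
  also have "card ?A \<le> card Wn" by (rule card_image_le) simp
  also have "card ?B \<le> card (Is {301..450} \<union> SP)" by (rule card_image_le) simp
  also have "\<dots> \<le> card (Is {301..450}) + card SP" by (rule card_Un_le)
  finally show ?thesis using Wn_le SP_le by simp
qed

definition "TO = {k. k < L \<and> s k \<in> arcsTA \<and> isXA (s' k) \<and> 401 \<le> fst (s' k)}"

lemma fin_TO [simp]: "finite TO" by (simp add: TO_def)

text \<open>The upper end of the removed arc is adjacent to the apex, hence it belongs to \<open>U\<close>, and the zigzag has at
most two arcs with a given upper end.\<close>

lemma TO_le: "card TO \<le> 30"
proof -
  have "s ` TO \<subseteq> (\<Union>u\<in>U. {(2104-u,u),(2105-u,u)})"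
  proof
    fix e assume "e \<in> s ` TO"
    then obtain k where k: "k < L" "s k \<in> arcsTA" "isXA (s' k)" "401 \<le> fst (s' k)" "e = s k" by (auto simp: TO_def)
    obtain t a l u where q: "s k = (l,u)" "s' k = (t,a)" "l < a" "a < u" "1 \<le> t" "t \<le> 751" "752 \<le> l" "u \<le> 1352"
      "u + l = 2104 \<or> u + l = 2105" "l + 2 \<le> u" "edge (R k) t l" "edge (R k) t u"
      by (rule TA_quad[OF k(1-3)])
    have "(t,u) \<in> R k" using q by (auto simp: edge_def)
    then have "u \<in> U" unfolding U_def using q k by (intro CollectI conjI exI[of _ k] exI[of _ t]) auto
    then show "e \<in> (\<Union>u\<in>U. {(2104-u,u),(2105-u,u)})" using q k(5) by (intro UN_I[of u]) auto
  qed
  then have "card (s ` TO) \<le> card (\<Union>u\<in>U. {(2104-u,u),(2105-u,u)})" by (intro card_mono) auto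
  also have "\<dots> \<le> (\<Sum>u\<in>U. card {(2104-u,u),(2105-u,u)})" by (rule card_UN_le) simp
  also have "\<dots> \<le> (\<Sum>u\<in>U. 2)" by (rule sum_mono) (simp add: card_insert_if)
  also have "\<dots> \<le> 30" using U_le by simp
  finally have "card (s ` TO) \<le> 30" .
  moreover have "card (s ` TO) = card TO"
    by (rule card_image, rule inj_on_subset[OF inj_s]) (auto simp: TO_def arcsT_def)
  ultimately show ?thesis by simp
qed

lemma IO_le: "card (Is {401..751}) \<le> 42"
proof -
  have "card (TA {401..751}) \<le> card TO" by (rule card_mono) (auto simp: TA_def TO_def)
  then show ?thesis using ineqB TO_le by simp
qed

text \<open>The vertices of the second block to which freed vertices can be charged when an arc of the last
triangulation frees them.\<close>

definition "V = {w. \<exists>k<L. isXA (s' k) \<and> s' k \<notin> arcsT' \<and> 401 \<le> fst (s' k) \<and> snd (s' k) = w}"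

lemma V_le: "card V \<le> 74" and fin_V [simp]: "finite V"
proof -
  have sub: "V \<subseteq> (snd \<circ> s') ` (Is {401..751} \<union> TO \<union> SP)"
  proof
    fix w assume "w \<in> V"
    then obtain k where k: "k < L" "isXA (s' k)" "s' k \<notin> arcsT'" "401 \<le> fst (s' k)" "snd (s' k) = w"
      by (auto simp: V_def)
    have "k \<in> Is {401..751} \<union> TO \<union> SP"
      using insert_XA[OF k(1,2)] k by (auto simp: Is_def TO_def SP_def WW_def isXA_def)
    then show "w \<in> (snd \<circ> s') ` (Is {401..751} \<union> TO \<union> SP)" using k(5) by force
  qed
  show "finite V" by (rule finite_subset[OF sub]) auto
  have "card V \<le> card (Is {401..751} \<union> TO \<union> SP)" by (rule surj_card_le[OF _ sub]) auto
  also have "\<dots> \<le> card (Is {401..751}) + card TO + card SP" by (rule card_Un3)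
  finally show "card V \<le> 74" using IO_le TO_le SP_le by simp
qed

text \<open>Each of the 299 vertices 452 to 750 is an end of an intermediate ladder arc, or it is freed at the end by
an intermediate flip, or by the insertion of an arc of the last triangulation. In the last case the far
end \<open>w\<close> of the inserted arc has only two, consecutive, neighbours there, so that one of the two ends of the
removed arc is joined to \<open>w\<close> by an intermediate arc.\<close>

theorem contradiction: False
proof -
  obtain \<sigma> where \<sigma>: "\<sigma> < L" "(751,1371) \<in> R \<sigma>" by (rule hub_exists)
  let ?A = "fst ` Lad" and ?B = "(fst \<circ> s') ` (Wn \<union> Is {401..751})" and ?C = "\<Union>w\<in>V. {1502 - w, 1503 - w}"
  have "{452..750} \<subseteq> ?A \<union> ?B \<union> ?C"
  proof
    fix x :: nat assume "x \<in> {452..750}"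
    then have x: "452 \<le> x" "x \<le> 750" by auto
    show "x \<in> ?A \<union> ?B \<union> ?C"
    proof (cases "covered (R \<sigma>) x")
      case False then show ?thesis using uncovered_ladder[OF \<sigma> x] by simp
    next
      case True
      have "\<not> covered (R L) x" using no_XX RL by (fastforce simp: covered_def)
      then obtain k where k: "\<sigma> \<le> k" "k < L" "covered (R k) x" "\<not> covered (R (Suc k)) x"
        using last_true[of "\<lambda>k. covered (R k) x", OF True] \<sigma> by (metis less_imp_le_nat)
      obtain c d w where q: "s k = (c,d)" "c < x" "x < d" "d \<le> 751" "s' k = (x,w)" "751 < w" "edge (R k) c w" "edge (R k) d w"
        using cover_flip[OF flips_sym[OF fl[OF k(2)]] k(4,3)] by metis
      have nT: "s k \<notin> arcsT" using no_XX q by (metis UnI1 not_less)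
      have c1: "1 \<le> c" using no_zero[of k c d] st(1)[OF k(2)] q(1) k(2) by simp
      show ?thesis
      proof (cases "s' k \<in> arcsT'")
        case False
        have "k \<in> Wn \<union> Is {401..751}" using False nT k(2) q x by (auto simp: Wn_def Is_def WW_def)
        then show ?thesis using q(5) by force
      next
        case True
        then have xw: "x = 1502 - w \<or> x = 1503 - w" "752 \<le> w" "w \<le> 1051" using q(5,6) x by (auto simp: arcsT'_def arcsXA_def caps_def)
        have "401 \<le> c" 
          using no_span[of k c d 401] st(1)[OF k(2)] q(1-4) k(2) x by (force simp: edge_def)
        have "c \<noteq> 1502 - w \<and> c \<noteq> 1503 - w \<or> d \<noteq> 1502 - w \<and> d \<noteq> 1503 - w"
          using xw q(2,3) by arith
        then obtain y where y: "y = c \<or> y = d" "y \<noteq> 1502 - w" "y \<noteq> 1503 - w" by blast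
        have yb: "401 \<le> y" "y \<le> 751" using y(1) \<open>401 \<le> c\<close> q(2-4) by auto
        have "edge (R k) y w" using y(1) q(7,8) by blast
        then have yR: "(y,w) \<in> R k" using yb xw y by (auto simp: edge_def)
        have "(y,w) \<notin> arcsT" using yb xw by (auto simp: arcsT_def arcsTA_def)
        then obtain m where m: "m < k" "s' m = (y,w)" using inserted[OF _ yR] k(2) by auto
        have "(y,w) \<notin> arcsT'" using yb xw y by (auto simp: arcsT'_def arcsXA_def caps_def)
        then have "w \<in> V" using m k(2) yb xw by (auto simp: V_def intro!: exI[of _ m])
        then show ?thesis using xw by blast
      qed
    qed
  qed
  then have "card {452..750::nat} \<le> card (?A \<union> ?B \<union> ?C)" by (intro card_mono) auto
  also have "\<dots> \<le> card ?A + card ?B + card ?C" by (rule card_Un3)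
  also have "card ?A \<le> card Lad" by (rule card_image_le) simp
  also have "card ?B \<le> card (Wn \<union> Is {401..751})" by (rule card_image_le) simp
  also have "\<dots> \<le> card Wn + card (Is {401..751})" by (rule card_Un_le)
  also have "card ?C \<le> (\<Sum>w\<in>V. card {1502 - w, 1503 - w})" by (rule card_UN_le) simp
  also have "\<dots> \<le> (\<Sum>w\<in>V. 2)" by (rule sum_mono) (simp add: card_insert_if)
  finally show False using Lad_le Wn_le IO_le V_le by simp
qed

end

section \<open>A short walk through the hub\<close>

lemma arcsT_zigzag: "1 \<le> i \<Longrightarrow> i \<le> 451 \<Longrightarrow> 1371 \<le> j \<Longrightarrow> j \<le> 1821 \<Longrightarrow> i + j = 1822 \<or> i + j = 1823 \<Longrightarrow> (i,j) \<in> arcsT"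
  by (simp add: arcsT_def)

lemma arcsT_TA: "752 \<le> i \<Longrightarrow> i + 2 \<le> j \<Longrightarrow> j \<le> 1352 \<Longrightarrow> i + j = 2104 \<or> i + j = 2105 \<Longrightarrow> (i,j) \<in> arcsT"
  by (simp add: arcsT_def arcsTA_def)

lemma tri_arcsT: "tri arcsT"
  unfolding tri_def
proof (intro conjI ballI allI impI)
  fix e assume "e \<in> arcsT"
  then show "okarc e" by (cases e) (auto simp: arcsT_def arcsTA_def okarc_simp forb_def)
next
  fix e f assume "e \<in> arcsT" "f \<in> arcsT"
  then show "\<not> xing e f"
    by (cases e, cases f) (auto simp: arcsT_def arcsTA_def)
next
  fix e assume e: "okarc e \<and> (\<forall>f\<in>arcsT. \<not> xing e f)"
  obtain i j where ij: "e = (i,j)" by force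
  have N: "\<not> xing (i,j) (k,l)" if "(k,l) \<in> arcsT" for k l using e ij that by blast
  have b: "i + 2 \<le> j" "j \<le> 1821" "\<not> (i = 0 \<and> j = 1821)" "\<not> forb i j" using e ij by (auto simp: okarc_simp)
  have i0: "1 \<le> i" using N[of 1 1821] b by (auto simp: arcsT_def)
  consider "i \<le> 450" | "i = 451" | "452 \<le> i" "i \<le> 750" | "i = 751" | "i = 752" | "753 \<le> i" "i \<le> 1052" | "1053 \<le> i" "i \<le> 1352"
    | "i = 1353" | "i = 1354" | "1355 \<le> i" "i \<le> 1369" | "1370 \<le> i" using i0 by linarith
  then show "e \<in> arcsT" unfolding ij
  proof cases
    case 1
    have "(i+1, 1822-i) \<in> arcsT" by (rule arcsT_zigzag) (use 1 i0 in auto)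
    from N[OF this] have "1822 - i \<le> j" using 1 i0 b by auto
    moreover have "j \<le> 1823 - i"
    proof (cases "i = 1")
      case False
      have "(i-1, 1823-i) \<in> arcsT" by (rule arcsT_zigzag) (use False 1 i0 in linarith)+
      from N[OF this] have "\<not> 1823 - i < j" using 1 i0 unfolding xing_simp by linarith
      then show ?thesis by simp
    qed (use b in simp)
    ultimately show "(i,j) \<in> arcsT" using 1 i0 b by (auto simp: arcsT_def)
  next
    case 2
    have "1370 \<le> j" using N[of "i+1" "1370"] 2 b by (auto simp: arcsT_def)
    moreover have "j \<le> 1372" using N[of 450 1372] 2 b by (auto simp: arcsT_def)
    ultimately show "(i,j) \<in> arcsT" using 2 by (auto simp: arcsT_def)
  next
    case 3
    have "1370 \<le> j" using N[of "i+1" "1370"] 3 b by (auto simp: arcsT_def)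
    moreover have "j \<le> 1370"
    proof -
      have "451 \<le> i - 1" "i - 1 \<le> 751" using 3 by auto
      then have "(i-1, 1370) \<in> arcsT" by (simp add: arcsT_def)
      from N[OF this] show ?thesis using 3 by auto
    qed
    ultimately show "(i,j) \<in> arcsT" using 3 by (auto simp: arcsT_def)
  next
    case 4
    have "1353 \<le> j" using N[of 752 1353] 4 b by (auto simp: arcsT_def)
    moreover have "j \<noteq> 1354" using 4 b by (auto simp: forb_def)
    moreover have "j \<le> 1370" using N[of 750 1370] 4 b by (auto simp: arcsT_def)
    ultimately show "(i,j) \<in> arcsT" using 4 by (auto simp: arcsT_def)
  next
    case 5
    have "j \<le> 1353" using 5 b by (auto simp: forb_def)
    moreover have "1352 \<le> j" using N[of 753 1352] 5 b by (auto simp: arcsT_def arcsTA_def)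
    ultimately show "(i,j) \<in> arcsT" using 5 by (auto simp: arcsT_def arcsTA_def)
  next
    case 6
    have "j \<le> 1353" using 6 b by (auto simp: forb_def)
    have 1: "2104 \<le> i + j" 
    proof (rule ccontr)
      assume n: "\<not> 2104 \<le> i + j"
      have "(i+1, 2104-i) \<in> arcsT" by (rule arcsT_TA) (use 6 b n in linarith)+
      from N[OF this] show False using 6 b n unfolding xing_simp by linarith
    qed
    have "i + j \<le> 2105"
    proof (rule ccontr)
      assume n: "\<not> i + j \<le> 2105"
      have "(i-1, 2105-i) \<in> arcsT" by (rule arcsT_TA) (use 6 b n in linarith)+
      from N[OF this] show False using 6 b n unfolding xing_simp by linarith
    qed
    then show "(i,j) \<in> arcsT" using 1 6 b by (auto simp: arcsT_def arcsTA_def)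
  next
    case 7
    have j: "j \<le> 1353" using 7 b by (auto simp: forb_def)
    have "(2103-i, i+1) \<in> arcsT" by (rule arcsT_TA) (use 7 b j in linarith)+
    from N[OF this] have False using 7 b j unfolding xing_simp by linarith
    then show "(i,j) \<in> arcsT" ..
  next
    case 8
    have "j \<le> 1355" using N[of 751 1355] 8 b by (auto simp: arcsT_def)
    then show "(i,j) \<in> arcsT" using 8 b by (auto simp: arcsT_def)
  next
    case 9 then show "(i,j) \<in> arcsT" using N[of 751 1355] b by (auto simp: arcsT_def)
  next
    case 10 then show "(i,j) \<in> arcsT" using N[of 751 "i+1"] b by (auto simp: arcsT_def)
  next
    case 11
    have "(1821-i,i+1) \<in> arcsT" using 11 b by (auto simp: arcsT_def)
    then show "(i,j) \<in> arcsT" using N[of "1821-i" "i+1"] 11 b by auto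
  qed
qed

lemma XA_antimono:
  assumes "(i,j) \<in> arcsXA" "(k,l) \<in> arcsXA" "i < k" shows "l \<le> j"
proof -
  have "i \<le> 300 \<and> 1052 \<le> j \<and> 1352 \<le> i + j \<and> i + j \<le> 1353 \<or> 301 \<le> i \<and> i \<le> 450 \<and> j = 1052
    \<or> 451 \<le> i \<and> j \<le> 1052 \<and> 1502 \<le> i + j \<and> i + j \<le> 1503" if "(i,j) \<in> arcsXA" for i j
    using that by (auto simp: arcsXA_def)
  from this[OF assms(1)] this[OF assms(2)] show ?thesis using assms(3) by (elim disjE) linarith+
qed

text \<open>The zigzags from the first to the second block are decreasing, and the five kinds of arcs are separated by
the values of their ends.\<close>

lemma noncrossing_arcsT':
  assumes "(i,j) \<in> arcsT'" "(k,l) \<in> arcsT'" "i < k" "k < j" "j < l" shows False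
proof -
  have kinds: "(i,j) \<in> arcsXA \<and> 1 \<le> i \<and> i \<le> 751 \<and> 752 \<le> j \<and> j \<le> 1352 \<or> 1355 \<le> i \<and> i \<le> 1369 \<and> j = 1371 \<or> i = 1 \<and> j = 1821
    \<or> i = 1 \<and> j = 1353 \<or> i = 1353 \<and> j = 1821 \<or> i = 1354 \<and> 1371 \<le> j \<and> j \<le> 1821" if "(i,j) \<in> arcsT'" for i j
    using that by (auto simp: arcsT'_def caps_def arcsXA_def)
  show ?thesis using XA_antimono[of i j k l] kinds[OF assms(1)] kinds[OF assms(2)] assms(3-) by (elim disjE) linarith+
qed

lemma tri_arcsT': "tri arcsT'"
  unfolding tri_def
proof (intro conjI ballI allI impI)
  fix e assume "e \<in> arcsT'"
  then show "okarc e" by (cases e) (auto simp: arcsT'_def arcsXA_def caps_def okarc_simp forb_def)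
next
  fix e f assume "e \<in> arcsT'" "f \<in> arcsT'"
  then have m: "(fst e, snd e) \<in> arcsT'" "(fst f, snd f) \<in> arcsT'" by simp_all
  show "\<not> xing e f"
    unfolding xing_def using noncrossing_arcsT'[OF m] noncrossing_arcsT'[OF m(2,1)] by blast
next
  fix e assume e: "okarc e \<and> (\<forall>f\<in>arcsT'. \<not> xing e f)"
  obtain i j where ij: "e = (i,j)" by force
  have N: "\<not> xing (i,j) (k,l)" if "(k,l) \<in> arcsT'" for k l using e ij that by blast
  have b: "i + 2 \<le> j" "j \<le> 1821" "\<not> (i = 0 \<and> j = 1821)" "\<not> forb i j" using e ij by (auto simp: okarc_simp)
  have i0: "1 \<le> i" using N[of 1 1821] b by (auto simp: arcsT'_def)
  have NX: "\<not> xing (i,j) (k,l)" if "(k,l) \<in> arcsXA" for k l using N[of k l] that by (auto simp: arcsT'_def)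
  have M: "(i,j) \<in> arcsXA \<Longrightarrow> (i,j) \<in> arcsT'" by (auto simp: arcsT'_def)
  have j: "j \<le> 1353 \<or> i = 1 \<and> j = 1821 \<or> 1353 \<le> i" 
    using N[of 1 1353] N[of 1353 1821] b i0 by (auto simp: arcsT'_def)
  have j': "j \<le> 1352 \<or> i = 1 \<or> 1353 \<le> i" using NX[of 1 1352] b i0 j by (auto simp: arcsXA_def)
  have j752: "752 \<le> j"
  proof (rule ccontr)
    assume n: "\<not> 752 \<le> j"
    have "(i+1, if i+1 \<le> 300 then 1352 - (i+1) else if i + 1 \<le> 450 then 1052 else 1502 - (i+1)) \<in> arcsXA"
      using n i0 b by (auto simp: arcsXA_def)
    from NX[OF this] show False using n i0 b by (auto split: if_splits)
  qed
  have "(i,j) \<in> arcsT'" if "i = 1" "1353 \<le> j" using j b that by (auto simp: arcsT'_def)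
  moreover have "(i,j) \<in> arcsT'" if n: "\<not> (i = 1 \<and> 1353 \<le> j)"
  proof -
  have j': "j \<le> 1352" if "i < 1353" using j' n that by linarith
  consider "752 \<le> i" "i \<le> 1050" | "1051 \<le> i" "i < 1353" | "i \<le> 300"
    | "301 \<le> i" "i \<le> 450" | "451 \<le> i" "i \<le> 751" 
    | "i = 1353" | "i = 1354" | "1355 \<le> i" "i \<le> 1370" | "1371 \<le> i" by linarith
  then show ?thesis
  proof cases
    case 1
    have "(1502-(i+1), i+1) \<in> arcsXA" using 1 j752 j' by (auto simp: arcsXA_def)
    from NX[OF this] show "(i,j) \<in> arcsT'" using 1 j752 j' b by auto
  next
    case 2
    have "(1352-(i+1), i+1) \<in> arcsXA" using 2 j752 j' b by (auto simp: arcsXA_def)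
    from NX[OF this] show "(i,j) \<in> arcsT'" using 2 j752 j' b by auto
  next
    case 3
    have "1352 \<le> i + j"
    proof (rule ccontr)
      assume n: "\<not> 1352 \<le> i + j"
      have "(i+1, 1352-i) \<in> arcsXA" using 3 j752 j' i0 b n by (auto simp: arcsXA_def)
      from NX[OF this] show False using 3 j752 j' b n by auto
    qed
    moreover have "i + j \<le> 1353"
    proof (rule ccontr)
      assume n: "\<not> i + j \<le> 1353"
      then have "(i-1, 1353-i) \<in> arcsXA" using 3 j752 j' i0 b n by (auto simp: arcsXA_def)
      from NX[OF this] show False using 3 j752 j' i0 b n by auto
    qed
    ultimately show "(i,j) \<in> arcsT'" using 3 j752 j' i0 b by (intro M) (auto simp: arcsXA_def)
  next
    case 4
    have "(i+1,1052) \<in> arcsXA" "(i-1,1052) \<in> arcsXA" using 4 j752 j' by (auto simp: arcsXA_def)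
    from this[THEN NX] have "j = 1052" using 4 j752 j' b by auto
    then show "(i,j) \<in> arcsT'" using 4 j752 j' by (intro M) (auto simp: arcsXA_def)
  next
    case 5
    have "1502 \<le> i + j"
    proof (rule ccontr)
      assume n: "\<not> 1502 \<le> i + j"
      have "(i+1, 1502-i) \<in> arcsXA" using 5 j752 j' b n by (auto simp: arcsXA_def)
      from NX[OF this] show False using 5 j752 j' b n by auto
    qed
    moreover have "i + j \<le> 1503"
    proof (rule ccontr)
      assume n: "\<not> i + j \<le> 1503"
      then have "(i-1, 1503-i) \<in> arcsXA" using 5 j752 j' b n by (auto simp: arcsXA_def)
      from NX[OF this] show False using 5 j752 j' b n by auto
    qed
    ultimately show "(i,j) \<in> arcsT'" using 5 j752 j' b by (intro M) (auto simp: arcsXA_def)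
  next
    case 6
    have "1821 \<le> j" using N[of 1354 1821] 6 b by (auto simp: arcsT'_def)
    then show "(i,j) \<in> arcsT'" using 6 j752 b by (auto simp: arcsT'_def)
  next
    case 7
    have "1371 \<le> j"
    proof (rule ccontr)
      assume n: "\<not> 1371 \<le> j"
      then have "(j-1, 1371) \<in> arcsT'" using 7 b by (auto simp: arcsT'_def caps_def)
      from N[OF this] show False using 7 b n by auto
    qed
    then show "(i,j) \<in> arcsT'" using 7 j752 b by (auto simp: arcsT'_def)
  next
    case 8
    have "1371 \<le> j"
    proof (rule ccontr)
      assume n: "\<not> 1371 \<le> j"
      then have "(i+1, 1371) \<in> arcsT'" using 8 b by (auto simp: arcsT'_def caps_def)
      from N[OF this] show False using 8 b n by auto
    qed
    moreover have "j \<le> 1371" using N[of 1354 1371] 8 b by (auto simp: arcsT'_def)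
    ultimately show "(i,j) \<in> arcsT'" using 8 j752 b by (auto simp: arcsT'_def caps_def)
  next
    case 9
    then show "(i,j) \<in> arcsT'" using N[of 1354 "i+1"] b by (auto simp: arcsT'_def)
  qed
  qed
  ultimately show "e \<in> arcsT'" using ij by blast
qed

definition flipstep :: "arc set \<Rightarrow> arc set \<Rightarrow> bool" where
  "flipstep R R' \<longleftrightarrow> (\<exists>s s'. flips R R' s s')"

definition reach :: "nat \<Rightarrow> arc set \<Rightarrow> arc set \<Rightarrow> bool" where
  "reach n R R' \<longleftrightarrow> (\<exists>m\<le>n. (flipstep ^^ m) R R')"

lemma flipstep_sym: "flipstep R R' \<Longrightarrow> flipstep R' R"
  unfolding flipstep_def using flips_sym by blast

lemma relpow_flipstep_sym: "(flipstep ^^ m) R R' \<Longrightarrow> (flipstep ^^ m) R' R"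
proof (induction m arbitrary: R')
  case (Suc m)
  then obtain S where "(flipstep ^^ m) R S" "flipstep S R'" by auto
  then have "(flipstep ^^ m) S R" "flipstep R' S" using Suc flipstep_sym by auto
  then show ?case by (metis relpowp_Suc_I2)
qed simp

lemma reach_sym: "reach n R R' \<Longrightarrow> reach n R' R"
  unfolding reach_def using relpow_flipstep_sym by blast

lemma reach_refl: "reach n R R"
  unfolding reach_def by (intro exI[of _ 0]) simp

lemma reach_trans: "reach a R S \<Longrightarrow> reach b S Q \<Longrightarrow> reach (a+b) R Q"
  unfolding reach_def by (metis add_mono relpowp_add relcomppI)

lemma reach_mono: "reach a R S \<Longrightarrow> a \<le> b \<Longrightarrow> reach b R S"
  unfolding reach_def using le_trans by blast

lemma reach_flip: assumes "flips R S s s'" shows "reach 1 R S"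
proof -
  have "flipstep R S" using assms unfolding flipstep_def by blast
  then show ?thesis unfolding reach_def by (intro exI[of _ 1]) (simp add: eq_OO)
qed

lemma reach_tri: "reach n R S \<Longrightarrow> tri R \<Longrightarrow> tri S"
proof -
  have "(flipstep ^^ m) R S \<Longrightarrow> tri R \<Longrightarrow> tri S" for m
    by (induction m arbitrary: S) (auto simp: flipstep_def flips_def)
  then show "reach n R S \<Longrightarrow> tri R \<Longrightarrow> tri S" unfolding reach_def by blast
qed

lemma flips_card: assumes "flips R S s s'" shows "card S = card R"
proof -
  have "S = insert s' (R - {s})" "s \<in> R" "s' \<notin> R" "finite R" using assms tri_finite by (auto simp: flips_def)
  then show ?thesis using card_Suc_Diff1[of R s] by (metis DiffD1 card_insert_disjoint finite_Diff)
qed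

lemma reach_card: "reach n R S \<Longrightarrow> card S = card R"
proof -
  have "(flipstep ^^ m) R S \<Longrightarrow> card S = card R" for m
  proof (induction m arbitrary: S)
    case (Suc m)
    then show ?case by (metis flips_card flipstep_def relpowp_Suc_E)
  qed simp
  then show "reach n R S \<Longrightarrow> card S = card R" unfolding reach_def by blast
qed

lemma neighbours:
  assumes S: "finite S" "a \<in> S" "c \<in> S" and y: "a < y" "y < (c::nat)" "y \<notin> S"
  obtains u v where "u \<in> S" "v \<in> S" "u < y" "y < v" "\<And>z. z \<in> S \<Longrightarrow> \<not> (u < z \<and> z < v)" "\<And>z. z \<in> S \<Longrightarrow> z < y \<Longrightarrow> z \<le> u"
proof -
  let ?A = "{z\<in>S. z < y}" and ?B = "{z\<in>S. y < z}"
  have f: "finite ?A" "finite ?B" "?A \<noteq> {}" "?B \<noteq> {}" using S y by auto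
  have "Max ?A \<in> ?A" "Min ?B \<in> ?B" using Max_in Min_in f by blast+
  moreover have "z \<le> Max ?A" if "z \<in> S" "z < y" for z using that f(1) by simp
  moreover have "Min ?B \<le> z" if "z \<in> S" "y < z" for z using that f(2) by simp
  ultimately show ?thesis using that[of "Max ?A" "Min ?B"] y(3)
    by (metis (no_types, lifting) linorder_neqE_nat mem_Collect_eq not_less)
qed

definition separated :: "nat set \<Rightarrow> nat \<Rightarrow> nat \<Rightarrow> bool" where
  "separated S i j \<longleftrightarrow> i \<in> S \<and> j \<in> S \<and> (\<exists>z\<in>S. i < z \<and> z < j)"

text \<open>A part of the curve between two neighbours of the hub 0 can be opened to the hub, one flip for every vertex
in between. If no vertex in between sees the hub, then the arc \<open>ac\<close> is present and has a third vertex
\<open>b\<close> on the side away from the hub; flipping \<open>ac\<close> to (0, \<open>b\<close>) splits the part in two. If some vertex sees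
the hub, the part is split already. Arcs with an end outside \<open>S\<close> and arcs between consecutive points of \<open>S\<close> are preserved.\<close>

lemma open_section:
  assumes "finite S" "tri R" "S \<subseteq> {a..c}" "a \<in> S" "c \<in> S" "1 \<le> a" "a < c" "edge R 0 a" "edge R 0 c"
    "\<And>x y. x \<in> S \<Longrightarrow> y \<in> S \<Longrightarrow> x < y \<Longrightarrow> \<not> separated S x y \<Longrightarrow> edge R x y"
    "\<And>x y. x \<in> S \<Longrightarrow> y \<in> S \<Longrightarrow> \<not> forb x y"
  shows "\<exists>R'. reach (card S - 2) R R' \<and> (\<forall>x\<in>S. edge R' 0 x) \<and> (\<forall>i j. (i,j) \<in> R \<and> \<not> separated S i j \<longrightarrow> (i,j) \<in> R')"
  using assms
proof (induction "card S" arbitrary: S R a c rule: less_induct)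
  case less
  note IH = less(1) and fS = less(2) and S = less(4-6) and ac = less(7,8) and nof = less(12)
  \<comment> \<open>the inductive step for the case that a vertex \<open>z\<close> in between sees the hub\<close>
  have split: "\<exists>R'. reach (card S - 3) Q R' \<and> (\<forall>x\<in>S. edge R' 0 x) \<and> (\<forall>i j. (i,j) \<in> Q \<and> \<not> separated S i j \<longrightarrow> (i,j) \<in> R')"
    if Q: "tri Q" "edge Q 0 a" "edge Q 0 c" "edge Q 0 z" "z \<in> S" "a < z" "z < c"
      and con: "\<And>x y. x \<in> S \<Longrightarrow> y \<in> S \<Longrightarrow> x < y \<Longrightarrow> \<not> separated S x y \<Longrightarrow> edge Q x y" for Q z
  proof -
    let ?S1 = "S \<inter> {..z}" and ?S2 = "S \<inter> {z..}"
    have "c \<notin> ?S1" "a \<notin> ?S2" using Q(6,7) by simp_all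
    then have "?S1 \<subset> S" "?S2 \<subset> S" using S(2,3) by blast+
    then have sm: "card ?S1 < card S" "card ?S2 < card S" using fS by (simp_all add: psubset_card_mono)
    have "card ?S1 + card ?S2 = card (?S1 \<union> ?S2) + card (?S1 \<inter> ?S2)" by (rule card_Un_Int) (use fS in auto)
    moreover have "?S1 \<union> ?S2 = S" "?S1 \<inter> ?S2 = {z}" using Q(5) by auto
    ultimately have cs: "card ?S1 + card ?S2 = card S + 1" by simp
    have c2: "2 \<le> card ?S1" "2 \<le> card ?S2"
      using card_mono[of ?S1 "{a,z}"] card_mono[of ?S2 "{z,c}"] fS S Q(5-7) by auto
    have in1: "separated S x y \<longleftrightarrow> separated ?S1 x y" if "x \<in> ?S1" "y \<in> ?S1" for x y using that by (auto simp: separated_def)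
    have in2: "separated S x y \<longleftrightarrow> separated ?S2 x y" if "x \<in> ?S2" "y \<in> ?S2" for x y using that by (auto simp: separated_def)
    have sub: "separated ?S1 x y \<Longrightarrow> separated S x y" "separated ?S2 x y \<Longrightarrow> separated S x y" for x y by (auto simp: separated_def)
    have m1: "finite ?S1" "?S1 \<subseteq> {a..z}" "a \<in> ?S1" "z \<in> ?S1" using fS S Q(5-7) by auto
    have con1: "edge Q x y" if "x \<in> ?S1" "y \<in> ?S1" "x < y" "\<not> separated ?S1 x y" for x y
      using con[of x y] in1[OF that(1,2)] that by blast
    have nof1: "\<not> forb x y" if "x \<in> ?S1" "y \<in> ?S1" for x y using nof that by blast
    obtain R1 where R1: "reach (card ?S1 - 2) Q R1" "\<And>x. x \<in> ?S1 \<Longrightarrow> edge R1 0 x" "\<And>i j. (i,j) \<in> Q \<Longrightarrow> \<not> separated ?S1 i j \<Longrightarrow> (i,j) \<in> R1"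
      using IH[OF sm(1) m1(1) Q(1) m1(2-4) ac(1) Q(6) Q(2) Q(4) con1 nof1] by blast
    have e1: "edge R1 x y" if "edge Q x y" "\<not> separated ?S1 x y" for x y using that R1(3) by (auto simp: edge_def)
    have t1: "tri R1" using reach_tri R1(1) Q(1) by blast
    have n0: "\<not> separated ?S1 0 y" "\<not> separated ?S2 0 y" for y using S ac by (auto simp: separated_def)
    have con2: "edge R1 x y" if "x \<in> ?S2" "y \<in> ?S2" "x < y" "\<not> separated ?S2 x y" for x y
      using con[of x y] e1[of x y] in2[OF that(1,2)] sub(1) that by blast
    have "1 \<le> z" using ac Q(6) by simp
    have m2: "finite ?S2" "?S2 \<subseteq> {z..c}" "z \<in> ?S2" "c \<in> ?S2" using fS S Q(5-7) by auto
    have nof2: "\<not> forb x y" if "x \<in> ?S2" "y \<in> ?S2" for x y using nof that by blast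
    obtain R2 where R2: "reach (card ?S2 - 2) R1 R2" "\<And>x. x \<in> ?S2 \<Longrightarrow> edge R2 0 x" "\<And>i j. (i,j) \<in> R1 \<Longrightarrow> \<not> separated ?S2 i j \<Longrightarrow> (i,j) \<in> R2"
      using IH[OF sm(2) m2(1) t1 m2(2-4) \<open>1 \<le> z\<close> Q(7) e1[OF Q(4) n0(1)] e1[OF Q(3) n0(1)] con2 nof2] by blast
    have e2: "edge R2 0 x" if "x \<in> S" for x
    proof (cases "z \<le> x")
      case True then show ?thesis using R2(2) that by simp
    next
      case False
      then have "edge R1 0 x" using R1(2) that by simp
      then show ?thesis using R2(3) n0(2) by (auto simp: edge_def)
    qed
    have "reach ((card ?S1 - 2) + (card ?S2 - 2)) Q R2" by (rule reach_trans[OF R1(1) R2(1)])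
    moreover have "(card ?S1 - 2) + (card ?S2 - 2) = card S - 3" using cs c2 by linarith
    moreover have "(i,j) \<in> R2" if "(i,j) \<in> Q" "\<not> separated S i j" for i j using that R1(3) R2(3) sub by blast
    ultimately show ?thesis using e2 by auto
  qed
  show ?case
  proof (cases "separated S a c")
    case False
    have "z = a \<or> z = c" if "z \<in> S" for z
    proof -
      have "a \<le> z" "z \<le> c" using S(1) that by auto
      then show ?thesis using False S(2,3) that unfolding separated_def by (metis le_neq_implies_less)
    qed
    then have "S = {a,c}" using S(2,3) by blast
    then show ?thesis using less(9,10) reach_refl by blast
  next
    case True
    then obtain z0 where z0: "z0 \<in> S" "a < z0" "z0 < c" by (auto simp: separated_def)
    have c3: "3 \<le> card S" using card_mono[OF fS, of "{a,z0,c}"] S z0 by auto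
    show ?thesis
    proof (cases "\<exists>z\<in>S. a < z \<and> z < c \<and> edge R 0 z")
      case True
      then obtain z where z: "z \<in> S" "a < z" "z < c" "edge R 0 z" by blast
      obtain R' where "reach (card S - 3) R R'" "\<forall>x\<in>S. edge R' 0 x" "\<forall>i j. (i,j) \<in> R \<and> \<not> separated S i j \<longrightarrow> (i,j) \<in> R'"
        using split[OF less(3,9,10) z(4) z(1-3) less(11)] by blast
      moreover have "reach (card S - 2) R R'" by (rule reach_mono[OF calculation(1)]) simp
      ultimately show ?thesis by blast
    next
      case noz: False
      have c1821: "c \<le> 1821" using edge_bounds[OF less(3,10)] by simp
      have gap: False if e: "(x,y) \<in> R" "y \<notin> S" "b < y" "y < c" "b \<in> S" "x < b" for x y b
      proof -
        obtain u v where uv: "u \<in> S" "v \<in> S" "u < y" "y < v" "\<And>z. z \<in> S \<Longrightarrow> \<not> (u < z \<and> z < v)" "\<And>z. z \<in> S \<Longrightarrow> z < y \<Longrightarrow> z \<le> u"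
          using neighbours[OF fS \<open>b \<in> S\<close> S(3) \<open>b < y\<close> \<open>y < c\<close> \<open>y \<notin> S\<close>] by metis
        have "edge R u v" using less(11)[OF uv(1,2)] uv(3-5) by (auto simp: separated_def)
        moreover have "x < u" using uv(6)[OF \<open>b \<in> S\<close> \<open>b < y\<close>] \<open>x < b\<close> by simp
        ultimately show False using edge_non[OF less(3), of u v x y] e(1) uv(3,4) by auto
      qed
      have "edge R a c" unfolding edge_iff[OF less(3) ac(2) c1821]
      proof (intro allI impI notI)
        fix x y assume e: "(x,y) \<in> R" "xing (a,c) (x,y)"
        have n1: "\<not> xing (0,a) (x,y)" "\<not> xing (0,c) (x,y)" using edge_non[OF less(3) less(9) e(1)] edge_non[OF less(3) less(10) e(1)] by auto
        then have x: "x = 0" "a < y" "y < c" using e(2) ac by auto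
        show False
        proof (cases "y \<in> S")
          case True then show False using noz x e(1) by (auto simp: edge_def)
        next
          case False then show False using gap[OF e(1) False, of a] x S(2) ac by auto
        qed
      qed
      then have acR: "(a,c) \<in> R" using ac z0 by (auto simp: edge_def)
      let ?B = "{z\<in>S. a < z \<and> z < c \<and> edge R a z}"
      have Bfin: "finite ?B" using fS by simp
      have "?B \<noteq> {}"
      proof -
        let ?m = "Min {z\<in>S. a < z}"
        have ne: "finite {z\<in>S. a < z}" "{z\<in>S. a < z} \<noteq> {}" using fS z0 by auto
        have "?m \<in> {z\<in>S. a < z}" by (rule Min_in[OF ne])
        moreover have le: "?m \<le> z" if "z \<in> S" "a < z" for z using that ne by simp
        moreover have "?m < c" using le[OF z0(1,2)] z0(3) by simp
        moreover have "\<not> separated S a ?m" using le by (fastforce simp: separated_def)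
        ultimately show ?thesis using less(11)[OF S(2), of ?m] by blast
      qed
      define b where "b = Max ?B"
      have b: "b \<in> ?B" and bmax: "\<And>z. z \<in> ?B \<Longrightarrow> z \<le> b" unfolding b_def using Max_in[OF Bfin \<open>?B \<noteq> {}\<close>] Bfin by auto
      have bc: "edge R b c" unfolding edge_iff[OF less(3) _ c1821] 
      proof -
        have "\<not> xing (b,c) (x,y)" if e: "(x,y) \<in> R" for x y
        proof
          assume x: "xing (b,c) (x,y)"
          have n1: "\<not> xing (0,c) (x,y)" "\<not> xing (a,b) (x,y)" "\<not> xing (a,c) (x,y)"
            using edge_non[OF less(3) less(10) e] edge_non[OF less(3) _ e, of a b] b tri_non[OF less(3) acR e] by auto
          then have q: "x = a" "b < y" "y < c" using x b by auto
          show False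
          proof (cases "y \<in> S")
            case True
            then have "y \<in> ?B" using q b e by (auto simp: edge_def)
            then show False using bmax[of y] q by simp
          next
            case False then show False using gap[OF e False, of b] q b by auto
          qed
        qed
        then show ?thesis using edge_iff[OF less(3) _ c1821, of b] b by blast
      qed
      have ok: "okarc (0,b)" using b ac c1821 by (auto simp: okarc_simp forb_def)
      have fl: "(0,b) \<notin> R" "tri (insert (0,b) (R - {(a,c)}))"
        using tri_flip[OF less(3), of 0 a b c "(a,c)" "(0,b)"] ac b acR ok less(9,10) bc by auto
      let ?Q = "insert (0,b) (R - {(a,c)})"
      have fq: "flips R ?Q (a,c) (0,b)" using fl acR less(3) by (auto simp: flips_def)
      have eQ: "edge ?Q x y" if "edge R x y" "(x,y) \<noteq> (a,c)" for x y using that by (auto simp: edge_def)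
      have "edge ?Q 0 b" by (auto simp: edge_def)
      have conQ: "edge ?Q x y" if "x \<in> S" "y \<in> S" "x < y" "\<not> separated S x y" for x y
        using eQ[OF less(11)[OF that]] that(4) \<open>separated S a c\<close> by auto
      obtain R' where R': "reach (card S - 3) ?Q R'" "\<forall>x\<in>S. edge R' 0 x" "\<forall>i j. (i,j) \<in> ?Q \<and> \<not> separated S i j \<longrightarrow> (i,j) \<in> R'"
        using split[OF fl(2) eQ[OF less(9)] eQ[OF less(10)] \<open>edge ?Q 0 b\<close> _ _ _ conQ] b ac by auto
      have "reach (1 + (card S - 3)) R R'" by (rule reach_trans[OF reach_flip[OF fq] R'(1)])
      moreover have "1 + (card S - 3) = card S - 2" using c3 by simp
      ultimately show ?thesis using R'(2,3) \<open>separated S a c\<close> by (intro exI[of _ R']) auto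
    qed
  qed
qed

section \<open>Arriving at the common triangulation\<close>

text \<open>The triangulation in the middle of the short walk: all arcs at the hub except those behind the caps.\<close>

definition arcsF :: "arc set" where
  "arcsF = {(i,j). i = 0 \<and> (2 \<le> j \<and> j \<le> 1355 \<or> 1371 \<le> j \<and> j \<le> 1820)} \<union> caps"

lemma arcsF_maximal: assumes "tri R" "arcsF \<subseteq> R" shows "R = arcsF"
proof (rule antisym)
  show "R \<subseteq> arcsF"
  proof (rule subrelI)
    fix i j assume e: "(i,j) \<in> R"
    have N: "\<not> xing (i,j) (k,l)" if "(k,l) \<in> arcsF" for k l using tri_non[OF assms(1) e] assms(2) that by blast
    have b: "i + 2 \<le> j" "j \<le> 1821" "\<not> (i = 0 \<and> j = 1821)" using tri_ok[OF assms(1) e] by (auto simp: okarc_simp)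
    show "(i,j) \<in> arcsF"
    proof (cases "i = 0")
      case True
      then show ?thesis using N[of 1355 1371] b by (auto simp: arcsF_def caps_def)
    next
      case False
      have "(0,i+1) \<notin> arcsF" using N[of 0 "i+1"] b False by auto
      then have 1: "1355 \<le> i" "i \<le> 1369" using b False unfolding arcsF_def by (auto; linarith)+
      have 2: "j \<le> 1371" using N[of 0 1371] b 1 by (auto simp: arcsF_def)
      have "j = 1371"
      proof (rule ccontr)
        assume "j \<noteq> 1371"
        then have "(i+1,1371) \<in> arcsF" using 1 2 b by (auto simp: arcsF_def caps_def)
        from N[OF this] show False using 1 2 b \<open>j \<noteq> 1371\<close> by auto
      qed
      then show ?thesis using 1 by (auto simp: arcsF_def caps_def)
    qed
  qed
qed (rule assms(2))

lemma card_arcsF: "card arcsF = 1819"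
proof -
  have c: "caps = (\<lambda>i. (i,1371)) ` {1355..1369}" by (auto simp: caps_def)
  have f: "{(i,j). i = 0 \<and> (2 \<le> j \<and> j \<le> 1355 \<or> 1371 \<le> j \<and> j \<le> 1820)} = Pair (0::nat) ` ({2..1355} \<union> {1371..1820::nat})"
    by auto
  have "card caps = 15" unfolding c by (subst card_image) (auto simp: inj_on_def)
  moreover have "card (Pair (0::nat) ` ({2..1355} \<union> {1371..1820::nat})) = card ({2..1355} \<union> {1371..1820::nat})"
    by (rule card_image) (auto simp: inj_on_def)
  moreover have "card ({2..1355} \<union> {1371..1820::nat}) = card {2..1355::nat} + card {1371..1820::nat}"
    by (rule card_Un_disjoint) auto
  moreover have "card (Pair (0::nat) ` ({2..1355} \<union> {1371..1820::nat}) \<union> caps) = card (Pair (0::nat) ` ({2..1355} \<union> {1371..1820::nat})) + card caps"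
    by (rule card_Un_disjoint) (auto simp: c)
  ultimately show ?thesis unfolding arcsF_def f by simp
qed

text \<open>The case of \<open>open_section\<close> where the points are two runs of consecutive vertices joined by an edge.\<close>

lemma open_blocks:
  assumes R: "tri R" and o: "1 \<le> l" "l \<le> m" "m < n" "n \<le> r" and E: "edge R 0 l" "edge R 0 r" "edge R m n"
    and nof: "\<And>x y. l \<le> x \<Longrightarrow> x \<le> r \<Longrightarrow> l \<le> y \<Longrightarrow> y \<le> r \<Longrightarrow> x \<le> m \<or> n \<le> x \<Longrightarrow> y \<le> m \<or> n \<le> y \<Longrightarrow> \<not> forb x y"
  obtains R' where "reach (m - l + (r - n)) R R'" "tri R'" "\<And>x. l \<le> x \<Longrightarrow> x \<le> r \<Longrightarrow> x \<le> m \<or> n \<le> x \<Longrightarrow> edge R' 0 x"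
    "\<And>i j. (i,j) \<in> R \<Longrightarrow> i < l \<or> r < i \<or> m < i \<and> i < n \<or> j < l \<or> r < j \<or> m < j \<and> j < n \<or> i = m \<and> j = n \<Longrightarrow> (i,j) \<in> R'"
proof -
  let ?S = "{l..m} \<union> {n..r}"
  have "card ?S = card {l..m} + card {n..r}" by (rule card_Un_disjoint) (use o in auto)
  then have c: "card ?S - 2 = m - l + (r - n)" using o by simp
  have r: "r \<le> 1821" using edge_bounds[OF R E(2)] by simp
  have con: "edge R x y" if "x \<in> ?S" "y \<in> ?S" "x < y" "\<not> separated ?S x y" for x y
  proof -
    have no: "\<not> (x < z \<and> z < y)" if "z \<in> ?S" for z using that \<open>x \<in> ?S\<close> \<open>y \<in> ?S\<close> \<open>\<not> separated ?S x y\<close> by (auto simp: separated_def)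
    show ?thesis
    proof (cases "Suc x \<in> ?S")
      case True
      then have "y = Suc x" using no[OF True] that(3) by auto
      then show ?thesis using that(2) r o by (auto simp: edge_def)
    next
      case False
      then have "x = m \<and> Suc m < n" using that(1-3) o by auto
      moreover have "n \<in> ?S" using o by auto
      ultimately have "y = n" using no[of n] that(2,3) by auto
      then show ?thesis using E(3) \<open>x = m \<and> Suc m < n\<close> by simp
    qed
  qed
  have "\<exists>R'. reach (card ?S - 2) R R' \<and> (\<forall>x\<in>?S. edge R' 0 x) \<and> (\<forall>i j. (i,j) \<in> R \<and> \<not> separated ?S i j \<longrightarrow> (i,j) \<in> R')"
    by (rule open_section[of ?S R l r]) (use R o E con nof in auto)
  then obtain R' where R': "reach (card ?S - 2) R R'" "\<And>x. x \<in> ?S \<Longrightarrow> edge R' 0 x" "\<And>i j. (i,j) \<in> R \<Longrightarrow> \<not> separated ?S i j \<Longrightarrow> (i,j) \<in> R'"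
    by blast
  show ?thesis
  proof (rule that[of R'])
    show "reach (m - l + (r - n)) R R'" using R'(1) c by simp
    show "tri R'" using reach_tri[OF R'(1) R] .
    show "edge R' 0 x" if "l \<le> x" "x \<le> r" "x \<le> m \<or> n \<le> x" for x using R'(2) that by auto
    show "(i,j) \<in> R'" if "(i,j) \<in> R" "i < l \<or> r < i \<or> m < i \<and> i < n \<or> j < l \<or> r < j \<or> m < j \<and> j < n \<or> i = m \<and> j = n" for i j
      by (rule R'(3)[OF that(1)]) (use that(2) o in \<open>auto simp: separated_def\<close>)
  qed
qed

lemma flip_at:
  assumes R: "tri R" and o: "a < b" "b < c" "c < d" 
    and q: "s = (a,c) \<and> s' = (b,d) \<or> s = (b,d) \<and> s' = (a,c)" and s: "s \<in> R" and ok: "okarc s'"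
    and E: "edge R a b" "edge R b c" "edge R c d" "edge R a d"
  obtains R' where "reach 1 R R'" "tri R'" "s' \<in> R'" "\<And>e. e \<in> R \<Longrightarrow> e \<noteq> s \<Longrightarrow> e \<in> R'"
proof (rule that[of "insert s' (R - {s})"])
  note t = tri_flip[OF assms]
  show "reach 1 R (insert s' (R - {s}))" by (rule reach_flip[of _ _ s s']) (use t R s in \<open>simp add: flips_def\<close>)
  show "tri (insert s' (R - {s}))" by (rule t(2))
qed auto

lemma edge_memI: "(i,j) \<in> R \<Longrightarrow> edge R i j" by (simp add: edge_def)
lemma edge_memD: "edge R 0 x \<Longrightarrow> 2 \<le> x \<Longrightarrow> x \<le> 1820 \<Longrightarrow> (0,x) \<in> R" by (auto simp: edge_def)

text \<open>The order matters: the vertices before 752 are opened first, then 15 flips turn the fan at 751 into the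
caps, two more flips lead to the reflex corner, and the remaining vertices are opened.\<close>

lemma T_to_F: "reach 1822 arcsT arcsF"
proof -
  obtain R1 where R1: "reach 1201 arcsT R1" "tri R1" "\<And>x. 1 \<le> x \<Longrightarrow> x \<le> 1821 \<Longrightarrow> x \<le> 751 \<or> 1370 \<le> x \<Longrightarrow> edge R1 0 x"
    "\<And>i j. (i,j) \<in> arcsT \<Longrightarrow> i < 1 \<or> 1821 < i \<or> 751 < i \<and> i < 1370 \<or> j < 1 \<or> 1821 < j \<or> 751 < j \<and> j < 1370 \<or> i = 751 \<and> j = 1370 \<Longrightarrow> (i,j) \<in> R1"
    by (rule open_blocks[OF tri_arcsT, of 1 751 1370 1821]) (auto simp: edge_def arcsT_def forb_def)
  have J: "(751,j) \<in> R1" if "1355 \<le> j" "j \<le> 1370" for j using R1(4)[of 751 j] that by (cases "j = 1370") (auto simp: arcsT_def)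
  have Sp: "(751,1353) \<in> R1" "(1353,1355) \<in> R1" using R1(4)[of 751 1353] R1(4)[of 1353 1355] by (auto simp: arcsT_def)
  have F1: "(0,x) \<in> R1" if "2 \<le> x" "x \<le> 1820" "x \<le> 751 \<or> 1370 \<le> x" for x using R1(3)[of x] that by (intro edge_memD) auto
  obtain R2 where R2: "reach 1 R1 R2" "tri R2" "(751,1371) \<in> R2" "\<And>e. e \<in> R1 \<Longrightarrow> e \<noteq> (0,1370) \<Longrightarrow> e \<in> R2"
    by (rule flip_at[OF R1(2), of 0 751 1370 1371 "(0,1370)" "(751,1371)"]) (auto simp: okarc_simp forb_def F1 J edge_def)
  have step: "\<exists>R3. reach m R2 R3 \<and> tri R3 \<and> (\<forall>x. 2 \<le> x \<and> x \<le> 1820 \<and> (x \<le> 751 \<or> 1371 \<le> x) \<longrightarrow> (0,x) \<in> R3)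
      \<and> {(751,1353),(1353,1355),(751,1371)} \<subseteq> R3 \<and> (\<forall>j. 1355 \<le> j \<and> j \<le> 1370 - m \<longrightarrow> (751,j) \<in> R3) \<and> (\<forall>j. 1370 - m \<le> j \<and> j < 1370 \<longrightarrow> (j,1371) \<in> R3)"
    if "m \<le> 15" for m
    using that
  proof (induction m)
    case 0
    then show ?case using R2 F1 J Sp by (intro exI[of _ R2]) (auto simp: reach_refl)
  next
    case (Suc m)
    then obtain R3 where R3: "reach m R2 R3" "tri R3" "\<forall>x. 2 \<le> x \<and> x \<le> 1820 \<and> (x \<le> 751 \<or> 1371 \<le> x) \<longrightarrow> (0,x) \<in> R3"
      "{(751,1353),(1353,1355),(751,1371)} \<subseteq> R3" "\<forall>j. 1355 \<le> j \<and> j \<le> 1370 - m \<longrightarrow> (751,j) \<in> R3" "\<forall>j. 1370 - m \<le> j \<and> j < 1370 \<longrightarrow> (j,1371) \<in> R3"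
      by auto
    define j where "j = 1370 - m"
    have j: "1356 \<le> j" "j \<le> 1370" "1370 - Suc m = j - 1" using Suc.prems by (auto simp: j_def)
    have E: "edge R3 751 (j-1)" "edge R3 (j-1) j" "edge R3 j 1371" "edge R3 751 1371"
      using R3(4-6) j unfolding j_def[symmetric] by (auto simp: edge_def)
    obtain R4 where R4: "reach 1 R3 R4" "tri R4" "(j-1,1371) \<in> R4" "\<And>e. e \<in> R3 \<Longrightarrow> e \<noteq> (751,j) \<Longrightarrow> e \<in> R4"
      by (rule flip_at[OF R3(2), of 751 "j-1" j 1371 "(751,j)" "(j-1,1371)"])
        (use j E R3(5) in \<open>auto simp: okarc_simp forb_def j_def[symmetric]\<close>)
    have "reach (Suc m) R2 R4" using reach_trans[OF R3(1) R4(1)] by simp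
    moreover have "(0,x) \<in> R4" if "2 \<le> x" "x \<le> 1820" "x \<le> 751 \<or> 1371 \<le> x" for x using R3(3) R4(4) that by auto
    moreover have "{(751,1353),(1353,1355),(751,1371)} \<subseteq> R4" using R3(4) R4(4) j by auto
    moreover have "(751,i) \<in> R4" if "1355 \<le> i" "i \<le> j - 1" for i using R3(5) R4(4) that j by (auto simp: j_def[symmetric])
    moreover have "(i,1371) \<in> R4" if "j - 1 \<le> i" "i < 1370" for i
      using R3(6) R4(3) R4(4)[of "(i,1371)"] that j by (cases "i = j - 1") (auto simp: j_def[symmetric])
    ultimately show ?case unfolding j(3) using R4(2) by (intro exI[of _ R4]) auto
  qed
  obtain R3 where R3: "reach 15 R2 R3" "tri R3" "\<And>x. 2 \<le> x \<Longrightarrow> x \<le> 1820 \<Longrightarrow> x \<le> 751 \<or> 1371 \<le> x \<Longrightarrow> (0,x) \<in> R3"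
      "(751,1353) \<in> R3" "(1353,1355) \<in> R3" "(751,1371) \<in> R3" "(751,1355) \<in> R3" "\<And>j. 1355 \<le> j \<Longrightarrow> j < 1370 \<Longrightarrow> (j,1371) \<in> R3"
    using step[of 15] by auto
  obtain R4 where R4: "reach 1 R3 R4" "tri R4" "(1353,1371) \<in> R4" "\<And>e. e \<in> R3 \<Longrightarrow> e \<noteq> (751,1355) \<Longrightarrow> e \<in> R4"
    by (rule flip_at[OF R3(2), of 751 1353 1355 1371 "(751,1355)" "(1353,1371)"]) (auto simp: okarc_simp forb_def R3 intro!: edge_memI)
  obtain R5 where R5: "reach 1 R4 R5" "tri R5" "(0,1353) \<in> R5" "\<And>e. e \<in> R4 \<Longrightarrow> e \<noteq> (751,1371) \<Longrightarrow> e \<in> R5"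
    by (rule flip_at[OF R4(2), of 0 751 1353 1371 "(751,1371)" "(0,1353)"]) (auto simp: okarc_simp forb_def R3 R4 intro!: edge_memI)
  have F5: "(0,x) \<in> R5" if "2 \<le> x" "x \<le> 1820" "x \<le> 751 \<or> 1371 \<le> x \<or> x = 1353" for x using R3(3) R4(4) R5(3,4) that by auto
  have C5: "(j,1371) \<in> R5" if "1355 \<le> j" "j < 1370" for j using R3(8) R4(4) R5(4) that by auto
  obtain R6 where R6: "reach 2 R5 R6" "tri R6" "\<And>x. 1353 \<le> x \<Longrightarrow> x \<le> 1371 \<Longrightarrow> x \<le> 1355 \<or> 1371 \<le> x \<Longrightarrow> edge R6 0 x"
    "\<And>i j. (i,j) \<in> R5 \<Longrightarrow> i < 1353 \<or> 1371 < i \<or> 1355 < i \<and> i < 1371 \<or> j < 1353 \<or> 1371 < j \<or> 1355 < j \<and> j < 1371 \<or> i = 1355 \<and> j = 1371 \<Longrightarrow> (i,j) \<in> R6"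
    by (rule open_blocks[OF R5(2), of 1353 1355 1371 1371]) (auto simp: forb_def edge_def F5 C5)
  have F6: "(0,x) \<in> R6" if "2 \<le> x" "x \<le> 1820" "x \<le> 751 \<or> 1371 \<le> x \<or> 1353 \<le> x \<and> x \<le> 1355" for x
    using F5[of x] R6(4)[of 0 x] R6(3)[of x] that by (auto intro: edge_memD)
  have C6: "(j,1371) \<in> R6" if "1355 \<le> j" "j < 1370" for j using C5[OF that] R6(4)[of j 1371] that by (cases "j = 1355") auto
  obtain R7 where R7: "reach 601 R6 R7" "tri R7" "\<And>x. 751 \<le> x \<Longrightarrow> x \<le> 1353 \<Longrightarrow> x \<le> 1352 \<or> 1353 \<le> x \<Longrightarrow> edge R7 0 x"
    "\<And>i j. (i,j) \<in> R6 \<Longrightarrow> i < 751 \<or> 1353 < i \<or> 1352 < i \<and> i < 1353 \<or> j < 751 \<or> 1353 < j \<or> 1352 < j \<and> j < 1353 \<or> i = 1352 \<and> j = 1353 \<Longrightarrow> (i,j) \<in> R7"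
    by (rule open_blocks[OF R6(2), of 751 1352 1353 1353]) (auto simp: forb_def edge_def F6)
  have "arcsF \<subseteq> R7"
  proof (rule subrelI)
    fix i j assume "(i,j) \<in> arcsF"
    then consider "i = 0" "2 \<le> j" "j \<le> 1355 \<or> 1371 \<le> j" "j \<le> 1820" | "1355 \<le> i" "i \<le> 1369" "j = 1371" by (auto simp: arcsF_def caps_def)
    then show "(i,j) \<in> R7"
    proof cases
      case 1
      show ?thesis
      proof (cases "751 \<le> j \<and> j \<le> 1353")
        case True
        then have "edge R7 0 j" using R7(3)[of j] by linarith
        then show ?thesis using edge_memD[of R7 j] 1 by simp
      next
        case False
        then show ?thesis using R7(4)[of 0 j] F6[of j] 1 by auto
      qed
    next
      case 2 then show ?thesis using C6[of i] R7(4)[of i 1371] by auto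
    qed
  qed
  then have "R7 = arcsF" using arcsF_maximal R7(2) by blast
  moreover have "reach (1201 + 1 + 15 + 1 + 1 + 2 + 601) arcsT R7"
    by (rule reach_trans[OF reach_trans[OF reach_trans[OF reach_trans[OF reach_trans[OF reach_trans[OF R1(1) R2(1)] R3(1)] R4(1)] R5(1)] R6(1)] R7(1)])
  ultimately show ?thesis by simp
qed

lemma T'_to_F: "reach 1804 arcsT' arcsF"
proof -
  obtain R1 where R1: "reach 1 arcsT' R1" "tri R1" "(0,1353) \<in> R1" "\<And>e. e \<in> arcsT' \<Longrightarrow> e \<noteq> (1,1821) \<Longrightarrow> e \<in> R1"
    by (rule flip_at[OF tri_arcsT', of 0 1 1353 1821 "(1,1821)" "(0,1353)"]) (auto simp: okarc_simp forb_def edge_def arcsT'_def)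
  have C1: "(j,1371) \<in> R1" if "1355 \<le> j" "j < 1370" for j using R1(4)[of "(j,1371)"] that by (auto simp: arcsT'_def caps_def)
  obtain R2 where R2: "reach 1351 R1 R2" "tri R2" "\<And>x. 1 \<le> x \<Longrightarrow> x \<le> 1353 \<Longrightarrow> x \<le> 1352 \<or> 1353 \<le> x \<Longrightarrow> edge R2 0 x"
    "\<And>i j. (i,j) \<in> R1 \<Longrightarrow> i < 1 \<or> 1353 < i \<or> 1352 < i \<and> i < 1353 \<or> j < 1 \<or> 1353 < j \<or> 1352 < j \<and> j < 1353 \<or> i = 1352 \<and> j = 1353 \<Longrightarrow> (i,j) \<in> R2"
    by (rule open_blocks[OF R1(2), of 1 1352 1353 1353]) (auto simp: forb_def edge_def R1(3))
  have C2: "(j,1371) \<in> R2" if "1355 \<le> j" "j < 1370" for j using C1[OF that] R2(4)[of j 1371] that by auto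
  have "(0,1353) \<in> R2" using R2(3)[of 1353] by (intro edge_memD) auto
  obtain R3 where R3: "reach 452 R2 R3" "tri R3" "\<And>x. 1353 \<le> x \<Longrightarrow> x \<le> 1821 \<Longrightarrow> x \<le> 1355 \<or> 1371 \<le> x \<Longrightarrow> edge R3 0 x"
    "\<And>i j. (i,j) \<in> R2 \<Longrightarrow> i < 1353 \<or> 1821 < i \<or> 1355 < i \<and> i < 1371 \<or> j < 1353 \<or> 1821 < j \<or> 1355 < j \<and> j < 1371 \<or> i = 1355 \<and> j = 1371 \<Longrightarrow> (i,j) \<in> R3"
    by (rule open_blocks[OF R2(2), of 1353 1355 1371 1821]) (auto simp: forb_def edge_def \<open>(0,1353) \<in> R2\<close> C2)
  have "arcsF \<subseteq> R3"
  proof (rule subrelI)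
    fix i j assume "(i,j) \<in> arcsF"
    then consider "i = 0" "2 \<le> j" "j \<le> 1355 \<or> 1371 \<le> j" "j \<le> 1820" | "1355 \<le> i" "i \<le> 1369" "j = 1371" by (auto simp: arcsF_def caps_def)
    then show "(i,j) \<in> R3"
    proof cases
      case 1
      show ?thesis
      proof (cases "1353 \<le> j")
        case True
        then have "edge R3 0 j" using R3(3)[of j] 1 by linarith
        then show ?thesis using edge_memD[of R3 j] 1 by simp
      next
        case False
        then have "edge R2 0 j" using R2(3)[of j] 1 by linarith
        then have "(0,j) \<in> R2" using edge_memD[of R2 j] 1 by simp
        then show ?thesis using R3(4)[of 0 j] False 1 by auto
      qed
    next
      case 2 then show ?thesis using C2[of i] R3(4)[of i 1371] by (cases "i = 1355") auto
    qed
  qed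
  then have "R3 = arcsF" using arcsF_maximal R3(2) by blast
  moreover have "reach (1 + 1351 + 452) arcsT' R3"
    by (rule reach_trans[OF reach_trans[OF R1(1) R2(1)] R3(1)])
  ultimately show ?thesis by simp
qed

lemma short_walk_exists: "reach 3626 arcsT arcsT'"
  using reach_trans[OF T_to_F reach_sym[OF T'_to_F]] by simp

text \<open>Flips preserve the number of arcs, and this number is apparent for the triangulation in the middle.\<close>

lemma card_arcsT: "card arcsT = 1819" and card_arcsT': "card arcsT' = 1819"
  using reach_card[OF T_to_F] reach_card[OF T'_to_F] card_arcsF by simp_all

section \<open>Polygon arcs as segments\<close>

text \<open>Twice the signed area of the triangle \<open>abc\<close>, positive if it is traversed counterclockwise.\<close>

definition det3 :: "point \<Rightarrow> point \<Rightarrow> point \<Rightarrow> real" where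
  "det3 a b c = (b$1 - a$1) * (c$2 - a$2) - (b$2 - a$2) * (c$1 - a$1)"

lemma det3_rotate: "det3 b c a = det3 a b c" "det3 c a b = det3 a b c"
  by (simp_all add: det3_def algebra_simps)

lemma det3_swap: "det3 a c b = - det3 a b c"
  by (simp add: det3_def algebra_simps)

lemma det3_same [simp]: "det3 a b a = 0" "det3 a b b = 0" "det3 a a b = 0"
  by (simp_all add: det3_def)

lemma det3_affine: "det3 a b ((1 - t) *\<^sub>R c + t *\<^sub>R d) = (1 - t) * det3 a b c + t * det3 a b d"
  by (simp add: det3_def algebra_simps)

lemma det3_line:
  assumes "a \<noteq> b" "det3 a b z = 0" obtains t where "z = (1 - t) *\<^sub>R a + t *\<^sub>R b"
proof -
  define n where "n = (b$1 - a$1)^2 + (b$2 - a$2)^2"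
  have "n \<noteq> 0" using assms(1) by (auto simp: n_def vec_eq_iff forall_2 sum_power2_eq_zero_iff)
  define t where "t = ((b$1 - a$1) * (z$1 - a$1) + (b$2 - a$2) * (z$2 - a$2)) / n"
  have d: "(b$1 - a$1) * (z$2 - a$2) = (b$2 - a$2) * (z$1 - a$1)" using assms(2) by (simp add: det3_def)
  have tn: "t * n = (b$1 - a$1) * (z$1 - a$1) + (b$2 - a$2) * (z$2 - a$2)" using \<open>n \<noteq> 0\<close> by (simp add: t_def)
  have "n * (z$1 - a$1) = (t * n) * (b$1 - a$1)"
    unfolding tn using d by (simp add: n_def power2_eq_square) algebra
  then have 1: "z$1 - a$1 = t * (b$1 - a$1)" using \<open>n \<noteq> 0\<close> by simp
  have "n * (z$2 - a$2) = (t * n) * (b$2 - a$2)"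
    unfolding tn using d by (simp add: n_def power2_eq_square) algebra
  then have 2: "z$2 - a$2 = t * (b$2 - a$2)" using \<open>n \<noteq> 0\<close> by simp
  have "z = (1 - t) *\<^sub>R a + t *\<^sub>R b" using 1 2 by (simp add: vec_eq_iff forall_2 algebra_simps)
  then show ?thesis by (rule that)
qed

lemma crossing_commute: "crossing s t \<longleftrightarrow> crossing t s"
  by (auto simp: crossing_def)

lemma crossing_segments:
  "a \<noteq> b \<Longrightarrow> c \<noteq> d \<Longrightarrow> crossing (closed_segment a b) (closed_segment c d) \<longleftrightarrow> open_segment a b \<inter> open_segment c d \<noteq> {}"
  by (simp add: crossing_def rel_interior_closed_segment)

lemma same_side_not_crossing:
  fixes a b c d :: point
  assumes "a \<noteq> b" "c \<noteq> d" and "0 \<le> det3 a b c * det3 a b d" and "det3 a b c \<noteq> 0 \<or> det3 a b d \<noteq> 0"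
  shows "\<not> crossing (closed_segment a b) (closed_segment c d)"
proof -
  have "x \<notin> open_segment c d" if x: "x \<in> open_segment a b" for x
  proof
    assume "x \<in> open_segment c d"
    then obtain t where t: "0 < t" "t < 1" "x = (1 - t) *\<^sub>R c + t *\<^sub>R d" by (auto simp: in_segment)
    obtain u where u: "x = (1 - u) *\<^sub>R a + u *\<^sub>R b" using x by (auto simp: in_segment)
    have "0 = (1 - t) * det3 a b c + t * det3 a b d"
      using det3_affine[of a b t c d] det3_affine[of a b u a b] t(3) u by simp
    then have e: "(1 - t) * det3 a b c = - (t * det3 a b d)" by simp
    then have "t * ((1 - t) * (det3 a b c)^2) = - (t * t * (det3 a b c * det3 a b d))" by algebra
    moreover have "0 \<le> t * t * (det3 a b c * det3 a b d)" using mult_nonneg_nonneg[OF _ assms(3), of "t * t"] by simp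
    ultimately have "t * ((1 - t) * (det3 a b c)^2) \<le> 0" by linarith
    then have c0: "det3 a b c = 0" using t by (smt (verit) mult_pos_pos zero_less_power2)
    then have "det3 a b d = 0" using e t by simp
    then show False using c0 assms(4) by simp
  qed
  then show ?thesis using assms(1,2) by (auto simp: crossing_segments)
qed

lemma opposite_sides_crossing:
  fixes a b c d :: point
  assumes "det3 a b c * det3 a b d < 0" "det3 c d a * det3 c d b < 0"
  shows "crossing (closed_segment a b) (closed_segment c d)"
proof -
  have ne: "a \<noteq> b" "c \<noteq> d" using assms by (auto simp: det3_def)
  have n1: "det3 a b c - det3 a b d \<noteq> 0" "det3 c d a - det3 c d b \<noteq> 0" 
    using assms by (auto simp: not_square_less_zero)
  define t where "t = det3 a b c / (det3 a b c - det3 a b d)"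
  define u where "u = det3 c d a / (det3 c d a - det3 c d b)"
  have pos: "0 < x / (x - y) \<and> x / (x - y) < 1" if "x * y < 0" for x y :: real
    using that by (auto simp: mult_less_0_iff divide_simps)
  have "0 < t" "t < 1" "0 < u" "u < 1" using pos[OF assms(1)] pos[OF assms(2)] by (auto simp: t_def u_def)
  moreover have "(1 - t) *\<^sub>R c + t *\<^sub>R d = (1 - u) *\<^sub>R a + u *\<^sub>R b"
  proof -
    have e: "det3 c d a - det3 c d b = - (det3 a b c - det3 a b d)" by (simp add: det3_def algebra_simps)
    have t': "t * (det3 a b c - det3 a b d) = det3 a b c" using n1 by (simp add: t_def)
    have u': "u * (det3 a b c - det3 a b d) = - det3 c d a" using n1 unfolding u_def e by (simp add: field_simps)
    have "(det3 a b c - det3 a b d) * (c$i + t * (d$i - c$i)) = (det3 a b c - det3 a b d) * (a$i + u * (b$i - a$i))" if "i = 1 \<or> i = 2" for i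
    proof -
      have "(det3 a b c - det3 a b d) * c$i + det3 a b c * (d$i - c$i) = (det3 a b c - det3 a b d) * a$i - det3 c d a * (b$i - a$i)"
        using that by (auto simp: det3_def algebra_simps)
      then show ?thesis using t' u' by algebra
    qed
    then have "c$i + t * (d$i - c$i) = a$i + u * (b$i - a$i)" if "i = 1 \<or> i = 2" for i using that n1(1) by simp
    then show ?thesis by (simp add: vec_eq_iff forall_2 algebra_simps)
  qed
  ultimately have "(1 - t) *\<^sub>R c + t *\<^sub>R d \<in> open_segment a b \<inter> open_segment c d"
    using ne by (auto simp: in_segment)
  then show ?thesis using ne by (auto simp: crossing_segments)
qed

text \<open>The oriented edges of the convex hull of the chosen vertices. They bypass the reflex corner 1353.\<close>

definition hullpairs :: "arc set" where
  "hullpairs = {(a,b). b = Suc a \<and> b \<le> 1821 \<and> a \<noteq> 1352 \<and> a \<noteq> 1353} \<union> {(1821,0), (1352,1354)}"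

text \<open>The edges of the closed curve.\<close>

definition sides :: "arc set" where
  "sides = insert (0,1821) {(a,b). b = Suc a \<and> b \<le> 1821}"

lemma fin_hullpairs: "finite hullpairs"
  by (rule finite_subset[of _ "{..1821} \<times> {..1821}"]) (auto simp: hullpairs_def)

text \<open>The orientations of all triples of the chosen points: they are in convex position except that the puncture
is a reflex corner. All other vertices are beyond some edge of the convex hull of the chosen ones.\<close>

locale placed =
  fixes P X :: "point set" and p :: point and q :: "nat \<Rightarrow> point"
  assumes conv: "convex P" and XP: "X \<subseteq> P" "p \<in> P" and finX: "finite X"
    and qY: "\<And>i. i \<le> 1821 \<Longrightarrow> q i \<in> X \<union> {p}" and inj: "inj_on q {..1821}"
    and chi: "\<And>i j k. i < j \<Longrightarrow> j < k \<Longrightarrow> k \<le> 1821 \<Longrightarrow> \<not> (j = 1353 \<and> forb i k) \<Longrightarrow> 0 < det3 (q i) (q j) (q k)"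
    and chi_neg: "\<And>i k. forb i k \<Longrightarrow> k \<le> 1821 \<Longrightarrow> det3 (q i) (q 1353) (q k) < 0"
    and clear: "\<And>i j. i < j \<Longrightarrow> j \<le> 1821 \<Longrightarrow> open_segment (q i) (q j) \<inter> (X \<union> {p}) = {}"
    and outside: "\<And>y. y \<in> X \<union> {p} \<Longrightarrow> y \<notin> q ` {..1821} \<Longrightarrow> \<exists>(a,b)\<in>hullpairs. det3 (q a) (q b) y < 0"
begin

definition seg :: "arc \<Rightarrow> segment" where "seg e = closed_segment (q (fst e)) (q (snd e))"

lemma q_eq: "i \<le> 1821 \<Longrightarrow> j \<le> 1821 \<Longrightarrow> q i = q j \<longleftrightarrow> i = j"
  using inj by (auto simp: inj_on_def)

lemma seg_inj: "i < j \<Longrightarrow> j \<le> 1821 \<Longrightarrow> k < l \<Longrightarrow> l \<le> 1821 \<Longrightarrow> seg (i,j) = seg (k,l) \<Longrightarrow> (i,j) = (k,l)"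
  by (auto simp: seg_def closed_segment_eq doubleton_eq_iff q_eq)

lemma chi_neq: "i < j \<Longrightarrow> j < k \<Longrightarrow> k \<le> 1821 \<Longrightarrow> det3 (q i) (q j) (q k) \<noteq> 0"
  using chi[of i j k] chi_neg[of i k] by fastforce

lemma crossing_imp_order:
  assumes o: "i < j" "j \<le> 1821" "k < l" "l \<le> 1821" "i \<le> k" "(i,j) \<noteq> (k,l)" and nf: "\<not> forb i j" "\<not> forb k l"
  shows "crossing (seg (i,j)) (seg (k,l)) \<longleftrightarrow> i < k \<and> k < j \<and> j < l"
proof -
  have ne: "q i \<noteq> q j" "q k \<noteq> q l" using o by (auto simp: q_eq)
  note S = same_side_not_crossing[OF ne, folded seg_def[of "(i,j)", simplified] seg_def[of "(k,l)", simplified]]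
  note S' = same_side_not_crossing[OF ne(2,1), folded seg_def[of "(i,j)", simplified] seg_def[of "(k,l)", simplified]]
  have "i = k \<and> j < l \<or> i = k \<and> l < j \<or> j = k \<or> i < k \<and> j = l \<or> j < k \<or> i < k \<and> l < j \<or> i < k \<and> k < j \<and> j < l"
    using o(5,6) by (cases j l rule: linorder_cases; cases j k rule: linorder_cases) auto
  then consider "i = k" "j < l" | "i = k" "l < j" | "j = k" | "i < k" "j = l" | "j < k" | "i < k" "l < j" | "i < k" "k < j" "j < l"
    by blast
  then show ?thesis
  proof cases
    case 1 then show ?thesis using S chi_neq[of i j l] o by auto
  next
    case 2
    then have "det3 (q i) (q j) (q l) \<noteq> 0" using chi_neq[of i l j] o det3_swap[of "q i" "q j" "q l"] by auto
    then show ?thesis using S 2 by auto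
  next
    case 3 then show ?thesis using S chi_neq[of i j l] o by auto
  next
    case 4
    then have "det3 (q i) (q j) (q k) \<noteq> 0" using chi_neq[of i k j] o det3_swap[of "q i" "q j" "q k"] by auto
    then show ?thesis using S 4 by auto
  next
    case 5
    show ?thesis
    proof (cases "j = 1353")
      case True
      then have "0 < det3 (q i) (q k) (q l)" "0 < det3 (q j) (q k) (q l)" using 5 o by (auto intro!: chi)
      then have "\<not> crossing (seg (k,l)) (seg (i,j))" using S' by (simp add: det3_rotate)
      then show ?thesis using 5 by (simp add: crossing_commute)
    next
      case False
      then have "0 < det3 (q i) (q j) (q k)" "0 < det3 (q i) (q j) (q l)" using 5 o by (auto intro!: chi)
      then show ?thesis using S 5 by simp
    qed
  next
    case 6
    have "0 < det3 (q i) (q k) (q j)" "0 < det3 (q i) (q l) (q j)" using 6 o nf by (auto intro!: chi)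
    then show ?thesis using S 6 by (auto simp: det3_swap[of _ "q j"])
  next
    case 7
    have "0 < det3 (q i) (q k) (q j)" using 7 o nf by (auto intro!: chi)
    moreover have "0 < det3 (q i) (q j) (q l)" using 7 o nf by (intro chi) (auto simp: forb_def)
    moreover have "0 < det3 (q i) (q k) (q l)" using 7 o nf by (intro chi) (auto simp: forb_def)
    moreover have "0 < det3 (q k) (q j) (q l)" using 7 o nf by (auto intro!: chi)
    ultimately have "crossing (seg (i,j)) (seg (k,l))" unfolding seg_def fst_conv snd_conv
      by (intro opposite_sides_crossing)
        (simp_all add: det3_swap[of _ "q j" "q k"] det3_swap[of _ "q l" "q j"] det3_rotate(1)[of "q k" "q l" "q i"] mult_less_0_iff)
    then show ?thesis using 7 by simp
  qed
qed

lemma crossing_iff: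
  assumes "i < j" "j \<le> 1821" "k < l" "l \<le> 1821" "\<not> forb i j" "\<not> forb k l" "(i,j) \<noteq> (k,l)"
  shows "crossing (seg (i,j)) (seg (k,l)) \<longleftrightarrow> xing (i,j) (k,l)"
proof (cases "i \<le> k")
  case True then show ?thesis using crossing_imp_order[of i j k l] assms by auto
next
  case False then show ?thesis using crossing_imp_order[of k l i j] assms crossing_commute[of "seg (i,j)"] by auto
qed

text \<open>A diagonal that leaves the curve crosses an edge at the reflex corner, except for the diagonal that joins
the two neighbours of this corner.\<close>

lemma forb_crosses_side:
  assumes f: "forb i j" "j \<le> 1821" and n: "(i,j) \<noteq> (1352,1354)"
  shows "crossing (seg (i,j)) (seg (1352,1353)) \<or> crossing (seg (i,j)) (seg (1353,1354))"
proof -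
  have b: "1 \<le> i" "i < 1353" "1353 < j" "j = 1354 \<or> 751 < i" using f(1) by (auto simp: forb_def)
  note neg = chi_neg[OF f]
  show ?thesis
  proof (cases "i = 1352")
    case False
    have "det3 (q 1352) (q 1353) (q j) < 0" using b f(2) by (intro chi_neg) (auto simp: forb_def)
    moreover have "0 < det3 (q i) (q 1352) (q 1353)" using b False by (intro chi) auto
    moreover have "0 < det3 (q i) (q 1352) (q j)" using b f False by (intro chi) auto
    ultimately have "crossing (seg (i,j)) (seg (1352,1353))" unfolding seg_def fst_conv snd_conv using neg
      by (intro opposite_sides_crossing)
        (simp_all add: det3_swap[of _ "q j"] det3_rotate(1)[of "q 1352" "q 1353" "q i"] mult_less_0_iff)
    then show ?thesis ..
  next
    case True
    then have j: "1354 < j" using n b by auto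
    have "det3 (q i) (q 1353) (q 1354) < 0" using b f(2) by (intro chi_neg) (auto simp: forb_def)
    moreover have "0 < det3 (q 1353) (q 1354) (q j)" using j f by (intro chi) auto
    moreover have "0 < det3 (q i) (q 1354) (q j)" using b j f by (intro chi) auto
    ultimately have "crossing (seg (i,j)) (seg (1353,1354))" unfolding seg_def fst_conv snd_conv using neg
      by (intro opposite_sides_crossing)
        (simp_all add: det3_swap[of _ "q j"] det3_rotate(1)[of "q 1353" "q 1354" "q i"] mult_less_0_iff)
    then show ?thesis ..
  qed
qed

lemma hull_pos:
  assumes "(a,b) \<in> hullpairs" "x \<le> 1821" shows "0 \<le> det3 (q a) (q b) (q x)" and "x \<noteq> a \<Longrightarrow> x \<noteq> b \<Longrightarrow> 0 < det3 (q a) (q b) (q x)"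
proof -
  show pos: "0 < det3 (q a) (q b) (q x)" if x: "x \<noteq> a" "x \<noteq> b"
  proof -
    consider "b = Suc a" "b \<le> 1821" "a \<noteq> 1352" "a \<noteq> 1353" | "a = 1821" "b = 0" | "a = 1352" "b = 1354"
      using assms by (auto simp: hullpairs_def)
    then show ?thesis
    proof cases
      case 1
      show ?thesis
      proof (cases "x < a")
        case True
        then have "0 < det3 (q x) (q a) (q b)" using 1 by (intro chi) auto
        then show ?thesis by (simp add: det3_rotate)
      next
        case False then show ?thesis using 1 x assms by (intro chi) auto
      qed
    next
      case 2
      then have "0 < det3 (q b) (q x) (q a)" using x assms by (intro chi) (auto simp: forb_def)
      then show ?thesis by (simp add: det3_rotate)
    next
      case 3
      consider "x < 1352" | "x = 1353" | "1354 < x" using x 3 by linarith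
      then show ?thesis
      proof cases
        case 1
        then have "0 < det3 (q x) (q a) (q b)" using 3 by (intro chi) auto
        then show ?thesis by (simp add: det3_rotate)
      next
        case 2
        then have "det3 (q a) (q x) (q b) < 0" using 3 chi_neg[of 1352 1354] by (simp add: forb_def)
        then show ?thesis by (simp add: det3_swap[of _ "q b"])
      next
        assume "1354 < x" then show ?thesis using \<open>a = 1352\<close> \<open>b = 1354\<close> assms by (intro chi) auto
      qed
    qed
  qed
  show "0 \<le> det3 (q a) (q b) (q x)" using pos by (cases "x = a \<or> x = b") (auto simp: less_imp_le)
qed

text \<open>All the chosen points are on one side of the diagonal that joins the two neighbours of the reflex corner.\<close>

lemma notch_not_crossing:
  assumes "okarc (k,l)" shows "\<not> crossing (seg (1352,1354)) (seg (k,l))"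
proof -
  have kl: "k < l" "l \<le> 1821" "(k,l) \<noteq> (1352,1354)" using assms by (auto simp: okarc_simp forb_def)
  have h: "(1352,1354) \<in> hullpairs" by (simp add: hullpairs_def)
  have "k \<noteq> 1352 \<and> k \<noteq> 1354 \<or> l \<noteq> 1352 \<and> l \<noteq> 1354" using kl by auto
  then have "det3 (q 1352) (q 1354) (q k) \<noteq> 0 \<or> det3 (q 1352) (q 1354) (q l) \<noteq> 0"
    using hull_pos(2)[OF h, of k] hull_pos(2)[OF h, of l] kl by force
  then show ?thesis unfolding seg_def fst_conv snd_conv
    using hull_pos(1)[OF h, of k] hull_pos(1)[OF h, of l] kl by (intro same_side_not_crossing) (auto simp: q_eq)
qed

text \<open>The region bounded by the closed curve: the convex hull without the open notch at the reflex corner.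
The inequalities make it evident that the region is closed.\<close>

definition W :: "point set" where
  "W = {z. (\<forall>(a,b)\<in>hullpairs. 0 \<le> det3 (q a) (q b) z) \<and> (0 \<le> det3 (q 1352) (q 1353) z \<or> 0 \<le> det3 (q 1353) (q 1354) z)}"

lemma cont_det3: "continuous_on UNIV (det3 a b)"
  unfolding det3_def by (intro continuous_intros)

lemma closed_W: "closed W"
proof -
  have c: "closed {z. 0 \<le> det3 a b z}" for a b by (intro closed_Collect_le cont_det3 continuous_on_const)
  have "W = (\<Inter>e\<in>hullpairs. {z. 0 \<le> det3 (q (fst e)) (q (snd e)) z}) \<inter> ({z. 0 \<le> det3 (q 1352) (q 1353) z} \<union> {z. 0 \<le> det3 (q 1353) (q 1354) z})"
    by (simp add: W_def split_beta set_eq_iff)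
  then show ?thesis using c by (simp add: closed_INT closed_Int closed_Un)
qed

definition Wo :: "point set" where
  "Wo = {z. (\<forall>(a,b)\<in>hullpairs. 0 < det3 (q a) (q b) z) \<and> (0 < det3 (q 1352) (q 1353) z \<or> 0 < det3 (q 1353) (q 1354) z)}"

lemma Wo_interior: "Wo \<subseteq> interior W"
proof (rule interior_maximal)
  have c: "open {z. 0 < det3 a b z}" for a b by (intro open_Collect_less cont_det3 continuous_on_const)
  have "Wo = (\<Inter>e\<in>hullpairs. {z. 0 < det3 (q (fst e)) (q (snd e)) z}) \<inter> ({z. 0 < det3 (q 1352) (q 1353) z} \<union> {z. 0 < det3 (q 1353) (q 1354) z})"
    by (simp add: Wo_def split_beta set_eq_iff)
  then show "open Wo" using c fin_hullpairs by (simp add: open_INT open_Int open_Un)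
  show "Wo \<subseteq> W" by (force simp: Wo_def W_def)
qed

lemma on_hull_side:
  assumes ab: "(a,b) \<in> hullpairs" and z: "z \<in> W" and 0: "det3 (q a) (q b) z = 0"
  obtains t where "0 \<le> t" "t \<le> 1" "z = (1 - t) *\<^sub>R q a + t *\<^sub>R q b"
proof -
  have le: "a \<le> 1821" "b \<le> 1821" "a \<noteq> b" using ab by (auto simp: hullpairs_def)
  obtain t where t: "z = (1 - t) *\<^sub>R q a + t *\<^sub>R q b" using det3_line[OF _ 0] le q_eq by metis
  have "\<exists>a'. (a',a) \<in> hullpairs \<and> b \<noteq> a'"
  proof -
    consider "a = 0" | "a = 1354" | "a \<noteq> 0" "a \<noteq> 1354" by blast
    then show ?thesis
    proof cases
      case 1 then show ?thesis using ab by (intro exI[of _ 1821]) (auto simp: hullpairs_def)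
    next
      case 2 then show ?thesis using ab by (intro exI[of _ 1352]) (auto simp: hullpairs_def)
    next
      case 3 then show ?thesis using ab by (intro exI[of _ "a - 1"]) (auto simp: hullpairs_def)
    qed
  qed
  then obtain a' where a': "(a',a) \<in> hullpairs" "b \<noteq> a'" by blast
  have "\<exists>b'. (b,b') \<in> hullpairs \<and> a \<noteq> b'"
  proof -
    consider "b = 1352" | "b = 1821" | "b \<noteq> 1352" "b \<noteq> 1821" by blast
    then show ?thesis
    proof cases
      case 1 then show ?thesis using ab by (intro exI[of _ 1354]) (auto simp: hullpairs_def)
    next
      case 2 then show ?thesis using ab by (intro exI[of _ 0]) (auto simp: hullpairs_def)
    next
      case 3 then show ?thesis using ab by (intro exI[of _ "Suc b"]) (auto simp: hullpairs_def)
    qed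
  qed
  then obtain b' where b': "(b,b') \<in> hullpairs" "a \<noteq> b'" by blast
  have "0 \<le> det3 (q a') (q a) z" "0 \<le> det3 (q b) (q b') z" using z a' b' by (auto simp: W_def)
  then have 1: "0 \<le> t * det3 (q a') (q a) (q b)" "0 \<le> (1 - t) * det3 (q b) (q b') (q a)"
    unfolding t det3_affine by simp_all
  have "0 < det3 (q a') (q a) (q b)" "0 < det3 (q b) (q b') (q a)"
    using hull_pos(2)[OF a'(1)] hull_pos(2)[OF b'(1)] a' b' le by auto
  then have "0 \<le> t" "0 \<le> 1 - t" using 1 by (simp_all add: zero_le_mult_iff)
  then show ?thesis using that t by simp
qed

lemma frontier_W:
  assumes z: "z \<in> frontier W" shows "\<exists>e\<in>sides. z \<in> seg e"
proof -
  have zW: "z \<in> W" and zo: "z \<notin> Wo" using z closed_W Wo_interior by (auto simp: frontier_def)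
  have neg: "det3 (q 1352) (q 1353) (q 1354) < 0" by (intro chi_neg) (auto simp: forb_def)
  have h1: "0 \<le> det3 (q a) (q b) z" if "(a,b) \<in> hullpairs" for a b using zW that by (auto simp: W_def)
  have h2: "0 \<le> det3 (q 1352) (q 1353) z \<or> 0 \<le> det3 (q 1353) (q 1354) z" using zW by (auto simp: W_def)
  have sideI: "\<exists>e\<in>sides. z \<in> seg e" if "(a,b) \<in> sides \<or> (b,a) \<in> sides" "0 \<le> t" "t \<le> 1" "z = (1 - t) *\<^sub>R q a + t *\<^sub>R q b" for a b t
  proof -
    have "z \<in> closed_segment (q a) (q b)" using that by (auto simp: in_segment)
    then show ?thesis using that(1) by (metis closed_segment_commute fst_conv seg_def snd_conv)
  qed
  consider (hull) a b where "(a,b) \<in> hullpairs" "det3 (q a) (q b) z = 0"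
    | (cone) "det3 (q 1352) (q 1353) z \<le> 0" "det3 (q 1353) (q 1354) z \<le> 0"
    using zo h1 unfolding Wo_def by (force simp: not_less)
  then show ?thesis
  proof cases
    case hull
    obtain t where t: "0 \<le> t" "t \<le> 1" "z = (1 - t) *\<^sub>R q a + t *\<^sub>R q b" by (rule on_hull_side[OF hull(1) zW hull(2)])
    show ?thesis
    proof (cases "(a,b) = (1352,1354)")
      case False
      then have "(a,b) \<in> sides \<or> (b,a) \<in> sides" using hull(1) by (auto simp: hullpairs_def sides_def)
      then show ?thesis using sideI t by blast
    next
      case True
      have "0 \<le> t * det3 (q 1352) (q 1353) (q 1354) \<or> 0 \<le> (1 - t) * det3 (q 1352) (q 1353) (q 1354)"
        using h2 True unfolding t(3) det3_affine by (simp add: det3_rotate)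
      then have "t = 0 \<or> t = 1" using neg t(1,2) by (auto simp: zero_le_mult_iff)
      then have "z = q 1352 \<or> z = q 1354" using t(3) True by auto
      then show ?thesis using sideI[of 1352 1353 0] sideI[of 1353 1354 1] by (auto simp: sides_def)
    qed
  next
    case cone
    consider "det3 (q 1352) (q 1353) z = 0" | "det3 (q 1353) (q 1354) z = 0" using cone h2 by linarith
    then show ?thesis
    proof cases
      case 1
      obtain t where t: "z = (1 - t) *\<^sub>R q 1352 + t *\<^sub>R q 1353" using det3_line[OF _ 1] q_eq[of 1352 1353] by auto
      have "0 \<le> det3 (q 1351) (q 1352) z" by (rule h1) (simp add: hullpairs_def)
      then have "0 \<le> t * det3 (q 1351) (q 1352) (q 1353)" unfolding t det3_affine by simp
      moreover have "0 < det3 (q 1351) (q 1352) (q 1353)" by (rule chi) auto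
      ultimately have "0 \<le> t" by (simp add: zero_le_mult_iff)
      moreover have "(1 - t) * det3 (q 1352) (q 1353) (q 1354) \<le> 0"
        using cone(2) unfolding t det3_affine by (simp add: det3_rotate)
      then have "t \<le> 1" using neg by (simp add: mult_le_0_iff)
      ultimately show ?thesis using sideI[of 1352 1353 t] t by (simp add: sides_def)
    next
      case 2
      obtain t where t: "z = (1 - t) *\<^sub>R q 1353 + t *\<^sub>R q 1354" using det3_line[OF _ 2] q_eq[of 1353 1354] by auto
      have "0 \<le> det3 (q 1354) (q 1355) z" by (rule h1) (simp add: hullpairs_def)
      then have "0 \<le> (1 - t) * det3 (q 1353) (q 1354) (q 1355)" unfolding t det3_affine by (simp add: det3_rotate)
      moreover have "0 < det3 (q 1353) (q 1354) (q 1355)" by (rule chi) auto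
      ultimately have "t \<le> 1" by (simp add: zero_le_mult_iff)
      moreover have "t * det3 (q 1352) (q 1353) (q 1354) \<le> 0"
        using cone(1) unfolding t det3_affine by simp
      then have "0 \<le> t" using neg by (simp add: mult_le_0_iff)
      ultimately show ?thesis using sideI[of 1353 1354 t] t by (simp add: sides_def)
    qed
  qed
qed

text \<open>The orientation of \<open>klz\<close> is affine in \<open>z\<close>, so that it can be computed from barycentric coordinates in the
triangle \<open>cxy\<close>.\<close>

lemma barycentric:
  "det3 c x y * det3 k l z = det3 x y z * det3 k l c + det3 c z y * det3 k l x + det3 c x z * det3 k l y"
  by (simp add: det3_def algebra_simps)

lemma ok_in_W:
  assumes ok: "okarc (k,l)" and z: "z \<in> seg (k,l)" shows "z \<in> W"
proof -
  have kl: "k + 2 \<le> l" "l \<le> 1821" "\<not> forb k l" using ok by (auto simp: okarc_simp)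
  obtain t where t: "0 \<le> t" "t \<le> 1" "z = (1 - t) *\<^sub>R q k + t *\<^sub>R q l" using z by (auto simp: seg_def in_segment)
  have lin: "0 \<le> det3 a b z" if "0 \<le> det3 a b (q k)" "0 \<le> det3 a b (q l)" for a b
    unfolding t(3) det3_affine using that t by simp
  have h: "0 \<le> det3 (q a) (q b) z" if "(a,b) \<in> hullpairs" for a b
    using lin hull_pos(1)[OF that] kl by auto
  have L: "0 \<le> det3 (q 1352) (q 1353) (q x)" if "x \<le> 1353" for x
  proof (cases "x < 1352")
    case True
    then have "0 < det3 (q x) (q 1352) (q 1353)" by (intro chi) auto
    then show ?thesis by (simp add: det3_rotate)
  next
    case False
    then have "x = 1352 \<or> x = 1353" using that by linarith
    then show ?thesis by auto
  qed
  have U: "0 \<le> det3 (q 1353) (q 1354) (q x)" if "1353 \<le> x" "x \<le> 1821" for x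
    using chi[of 1353 1354 x] that by (cases "x = 1353 \<or> x = 1354") auto
  have Z: "0 \<le> det3 (q 1353) (q 1354) (q 0)"
    using chi[of 0 1353 1354] by (simp add: det3_rotate forb_def)
  have "0 \<le> det3 (q 1352) (q 1353) z \<or> 0 \<le> det3 (q 1353) (q 1354) z"
  proof -
    consider "l \<le> 1353" | "1353 \<le> k" | "k = 0" "1353 < l" | "1 \<le> k" "k < 1353" "1353 < l" by linarith
    then show ?thesis
    proof cases
      case 1 then show ?thesis using lin L[of k] L[of l] kl by auto
    next
      case 2 then show ?thesis using lin U[of k] U[of l] kl by auto
    next
      case 3 then show ?thesis using lin Z U[of l] kl by auto
    next
      case 4
      then have kb: "k \<le> 751" "1355 \<le> l" using kl by (auto simp: forb_def)
      show ?thesis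
      proof (rule ccontr)
        assume n: "\<not> ?thesis"
        have 0: "det3 (q k) (q l) z = 0" unfolding t(3) det3_affine by simp
        have "0 < det3 (q k) (q 1353) (q l)" "0 < det3 (q k) (q 1352) (q l)" "0 < det3 (q k) (q 1354) (q l)"
          using kb kl by (auto intro!: chi)
        then have m: "det3 (q k) (q l) (q 1353) < 0" "det3 (q k) (q l) (q 1352) < 0" "det3 (q k) (q l) (q 1354) < 0"
          by (simp_all add: det3_swap[of _ "q l"])
        have A: "0 \<le> det3 (q 1352) (q 1354) z" by (rule h) (simp add: hullpairs_def)
        have B: "0 < det3 (q 1353) z (q 1354)" using n det3_swap[of "q 1353" z "q 1354"] by simp
        have C: "0 < det3 (q 1353) (q 1352) z" using n by (simp add: det3_def algebra_simps)
        have "det3 (q 1352) (q 1354) z * det3 (q k) (q l) (q 1353) \<le> 0" using A m(1) by (intro mult_nonneg_nonpos) auto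
        moreover have "det3 (q 1353) z (q 1354) * det3 (q k) (q l) (q 1352) < 0" using B m(2) by (rule mult_pos_neg)
        moreover have "det3 (q 1353) (q 1352) z * det3 (q k) (q l) (q 1354) < 0" using C m(3) by (rule mult_pos_neg)
        ultimately show False using barycentric[of "q 1353" "q 1352" "q 1354" "q k" "q l" z] 0 by simp
      qed
    qed
  qed
  then show ?thesis using h by (auto simp: W_def)
qed

lemma outside_W: "y \<in> X \<union> {p} \<Longrightarrow> y \<notin> q ` {..1821} \<Longrightarrow> y \<notin> W"
  using outside[of y] by (force simp: W_def)

lemma seg_arc: assumes "i < j" "j \<le> 1821" shows "triangulation_arc P (X \<union> {p}) (seg (i,j))"
proof -
  have "q i \<noteq> q j" "q i \<in> X \<union> {p}" "q j \<in> X \<union> {p}" using q_eq qY assms by auto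
  moreover have qP: "q x \<in> P" if "x \<le> 1821" for x using qY[OF that] XP by blast
  have "q i \<in> P" "q j \<in> P" using qP assms by auto
  then have "seg (i,j) \<subseteq> P" unfolding seg_def using conv by (simp add: closed_segment_subset)
  ultimately show ?thesis using \<open>seg (i,j) \<subseteq> P\<close> unfolding triangulation_arc_def using clear[OF assms]
    by (auto simp: seg_def rel_interior_closed_segment)
qed

text \<open>If such a segment starts at a vertex outside the curve and crosses an arc inside it, then on its way it
meets the boundary of the region, and this is not at a vertex. If both ends are on the curve, then the
segment is an edge of it or leaves it.\<close>

lemma outer_not_crossing:
  assumes s: "triangulation_arc P (X \<union> {p}) s" and E: "\<And>e. e \<in> sides \<Longrightarrow> s \<noteq> seg e \<Longrightarrow> \<not> crossing s (seg e)"
    and n: "s \<notin> seg ` {e. okarc e}" and ok: "okarc e"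
  shows "\<not> crossing s (seg e)"
proof
  assume cr: "crossing s (seg e)"
  obtain k l where e: "e = (k,l)" by force
  have kl: "k < l" "l \<le> 1821" "\<not> forb k l" "k + 2 \<le> l" "\<not> (k = 0 \<and> l = 1821)" using ok e by (auto simp: okarc_simp)
  obtain a b where ab: "a \<in> X \<union> {p}" "b \<in> X \<union> {p}" "a \<noteq> b" "s = closed_segment a b"
    and cl: "rel_interior s \<inter> (X \<union> {p}) = {}"
    using s by (auto simp: triangulation_arc_def)
  have out: False if y: "y \<notin> q ` {..1821}" "s = closed_segment y w" "y \<noteq> w" "y \<in> X \<union> {p}" for y w
  proof -
    have "q k \<noteq> q l" using kl q_eq by auto
    then obtain z where z: "z \<in> open_segment y w" "z \<in> open_segment (q k) (q l)"
      using cr y e by (auto simp: seg_def crossing_segments)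
    have "z \<in> W" using ok_in_W[of k l z] ok e z(2) by (auto simp: seg_def open_segment_def)
    moreover have "y \<notin> W" using outside_W y by blast
    ultimately have "closed_segment y z \<inter> frontier W \<noteq> {}"
      by (intro connected_Int_frontier) auto
    then obtain x where x: "x \<in> closed_segment y z" "x \<in> frontier W" by blast
    have "x \<in> W" using x(2) closed_W by (auto simp: frontier_def)
    then have "x \<noteq> y" using \<open>y \<notin> W\<close> by blast
    obtain u where u: "0 \<le> u" "u \<le> 1" "x = (1 - u) *\<^sub>R y + u *\<^sub>R z" using x(1) by (auto simp: in_segment)
    obtain v where v: "0 < v" "v < 1" "z = (1 - v) *\<^sub>R y + v *\<^sub>R w" using z(1) by (auto simp: in_segment)
    have "u \<noteq> 0" using u(3) \<open>x \<noteq> y\<close> by auto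
    then have "0 < u * v" "u * v < 1" using u v by (auto simp: mult_le_one intro: le_less_trans[OF mult_left_le_one_le])
    moreover have "x = (1 - u * v) *\<^sub>R y + (u * v) *\<^sub>R w" unfolding u(3) v(3) by (simp add: algebra_simps)
    ultimately have xo: "x \<in> open_segment y w" using y(3) by (auto simp: in_segment)
    obtain i j where f: "(i,j) \<in> sides" "x \<in> seg (i,j)" using frontier_W[OF x(2)] by auto
    have ij: "i < j" "j \<le> 1821" using f(1) by (auto simp: sides_def)
    have "x \<notin> X \<union> {p}" using cl xo y(2,3) by (auto simp: rel_interior_closed_segment)
    then have "x \<in> open_segment (q i) (q j)" using f(2) qY[of i] qY[of j] ij by (auto simp: seg_def open_segment_def)
    then have "crossing s (seg (i,j))" using xo y(2,3) ij q_eq[of i j] by (auto simp: seg_def crossing_segments)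
    moreover have "s \<noteq> seg (i,j)" using y(1,2) ij by (auto simp: seg_def closed_segment_eq doubleton_eq_iff)
    ultimately show False using E f(1) by blast
  qed
  have "a \<in> q ` {..1821}" using out[of a b] ab by blast
  moreover have "b \<in> q ` {..1821}" using out[of b a] ab by (auto simp: closed_segment_commute)
  ultimately obtain i0 j0 where "a = q i0" "b = q j0" "i0 \<le> 1821" "j0 \<le> 1821" by auto
  then obtain i j where ij: "s = seg (i,j)" "i < j" "j \<le> 1821"
    using ab(3,4) by (metis closed_segment_commute fst_conv linorder_neqE_nat seg_def snd_conv)
  have no: "\<not> okarc (i,j)" using n ij(1) by blast
  show False
  proof (cases "forb i j")
    case True
    show False
    proof (cases "(i,j) = (1352,1354)")
      case True then show False using notch_not_crossing[of k l] cr ij e ok by auto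
    next
      case False
      have m: "(1352,1353) \<in> sides" "(1353,1354) \<in> sides" by (auto simp: sides_def)
      have "s \<noteq> seg (1352,1353)" "s \<noteq> seg (1353,1354)"
        using seg_inj[OF ij(2,3), of 1352 1353] seg_inj[OF ij(2,3), of 1353 1354] ij(1) True by (auto simp: forb_def)
      then show False using forb_crosses_side[OF True ij(3) False] E[OF m(1)] E[OF m(2)] ij(1) by blast
    qed
  next
    case False
    then have bd: "j = Suc i \<or> i = 0 \<and> j = 1821" using no ij by (auto simp: okarc_simp)
    have "\<not> xing (i,j) (k,l)" using bd kl by auto
    moreover have "(i,j) \<noteq> (k,l)" using bd kl by auto
    ultimately show False using crossing_iff[of i j k l] cr ij e kl False by auto
  qed
qed

end

section \<open>Geodesics in the flip-graph\<close>

context placed begin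

abbreviation "Y \<equiv> X \<union> {p}"

definition outer_arcs :: "segment set" where
  "outer_arcs = {s. triangulation_arc P Y s \<and> (\<forall>e\<in>sides. s \<noteq> seg e \<longrightarrow> \<not> crossing s (seg e)) \<and> s \<notin> seg ` {e. okarc e}}"

lemma outer_ok: "s \<in> outer_arcs \<Longrightarrow> okarc e \<Longrightarrow> \<not> crossing s (seg e)"
  by (rule outer_not_crossing) (auto simp: outer_arcs_def)

lemma finite_arcs: "finite {s. triangulation_arc P Y s}"
proof (rule finite_subset)
  show "{s. triangulation_arc P Y s} \<subseteq> (\<lambda>(a,b). closed_segment a b) ` (Y \<times> Y)"
    by (auto simp: triangulation_arc_def)
qed (use finX in simp)

text \<open>The outer segments cross no arc of the curve, so that they can be chosen once and for all.\<close>

definition maximal_outer :: "segment set \<Rightarrow> bool" where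
  "maximal_outer S \<longleftrightarrow> S \<subseteq> outer_arcs \<and> noncrossing S
     \<and> (\<forall>s\<in>outer_arcs. (\<forall>t\<in>S. s \<noteq> t \<longrightarrow> \<not> crossing s t) \<longrightarrow> s \<in> S)"

lemma noncrossing_insert:
  "noncrossing S \<Longrightarrow> (\<And>t. t \<in> S \<Longrightarrow> s \<noteq> t \<Longrightarrow> \<not> crossing s t) \<Longrightarrow> noncrossing (insert s S)"
  unfolding noncrossing_def pairwise_insert using crossing_commute by metis

lemma maximal_outer_exists: "\<exists>S. maximal_outer S"
proof -
  let ?F = "{S. S \<subseteq> outer_arcs \<and> noncrossing S}"
  have "finite outer_arcs" by (rule finite_subset[OF _ finite_arcs]) (auto simp: outer_arcs_def)
  then have "finite ?F" by simp
  moreover have "{} \<in> ?F" by (simp add: noncrossing_def)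
  ultimately obtain S where S: "S \<in> ?F" "\<forall>T\<in>?F. S \<subseteq> T \<longrightarrow> S = T" using finite_has_maximal[of ?F] by blast
  have "s \<in> S" if "s \<in> outer_arcs" "\<forall>t\<in>S. s \<noteq> t \<longrightarrow> \<not> crossing s t" for s
  proof -
    have "insert s S \<in> ?F" using noncrossing_insert[of S s] S(1) that by simp
    from bspec[OF S(2) this] have "S = insert s S" by (simp add: subset_insertI)
    then show ?thesis by (metis insertI1)
  qed
  then show ?thesis using S(1) unfolding maximal_outer_def by blast
qed

definition Out :: "segment set" where "Out = (SOME S. maximal_outer S)"

lemma Out: "maximal_outer Out"
  unfolding Out_def using someI_ex[OF maximal_outer_exists] .

lemma Out_sub: "s \<in> Out \<Longrightarrow> s \<in> outer_arcs" and Out_non: "noncrossing Out"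
  and Out_max: "s \<in> outer_arcs \<Longrightarrow> (\<And>t. t \<in> Out \<Longrightarrow> s \<noteq> t \<Longrightarrow> \<not> crossing s t) \<Longrightarrow> s \<in> Out"
  using Out unfolding maximal_outer_def by auto

lemma okarc_less: "okarc (i,j) \<Longrightarrow> i < j \<and> j \<le> 1821 \<and> \<not> forb i j"
  by (auto simp: okarc_simp)

lemma seg_ok_inj: "okarc e \<Longrightarrow> okarc f \<Longrightarrow> seg e = seg f \<Longrightarrow> e = f"
  using seg_inj okarc_less by (metis surj_pair)

lemma crossing_ok: "okarc e \<Longrightarrow> okarc f \<Longrightarrow> e \<noteq> f \<Longrightarrow> crossing (seg e) (seg f) \<longleftrightarrow> xing e f"
  using crossing_iff okarc_less by (metis surj_pair)

lemma okarc_arc: "okarc e \<Longrightarrow> triangulation_arc P Y (seg e)"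
  using seg_arc okarc_less by (metis surj_pair)

lemma side_less: "(i,j) \<in> sides \<Longrightarrow> i < j \<and> j \<le> 1821 \<and> \<not> forb i j \<and> (j = Suc i \<or> i = 0 \<and> j = 1821)"
  by (auto simp: sides_def forb_def)

lemma side_not_crossing: assumes "(i,j) \<in> sides" "k < l" "l \<le> 1821" "\<not> forb k l" "(i,j) \<noteq> (k,l)"
  shows "\<not> crossing (seg (k,l)) (seg (i,j))"
  using crossing_iff[of k l i j] side_less[OF assms(1)] assms by auto

lemma sides_Out: assumes "e \<in> sides" shows "seg e \<in> Out"
proof (rule Out_max)
  obtain i j where e: "e = (i,j)" by force
  note s = side_less[OF assms[unfolded e]]
  show o: "seg e \<in> outer_arcs" unfolding outer_arcs_def
  proof (intro CollectI conjI ballI impI)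
    show "triangulation_arc P Y (seg e)" using seg_arc s e by simp
    show "\<not> crossing (seg e) (seg f)" if "f \<in> sides" "seg e \<noteq> seg f" for f
      using side_not_crossing[of "fst f" "snd f" i j] that s e by auto
    show "seg e \<notin> seg ` {e. okarc e}"
    proof
      assume "seg e \<in> seg ` {e. okarc e}"
      then obtain k l where "okarc (k,l)" "seg (i,j) = seg (k,l)" using e by auto
      moreover have "i < j" "j \<le> 1821" using s by auto
      ultimately have "(i,j) = (k,l)" using seg_inj[of i j k l] okarc_less[of k l] by blast
      then have "okarc (i,j)" using \<open>okarc (k,l)\<close> by simp
      then show False using s by (auto simp: okarc_simp)
    qed
  qed
  fix t assume "t \<in> Out" "seg e \<noteq> t"
  then show "\<not> crossing (seg e) t" using Out_sub[of t] assms crossing_commute by (auto simp: outer_arcs_def)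
qed

definition Full :: "arc set \<Rightarrow> segment set" where "Full R = Out \<union> seg ` R"

lemma Out_not_ok: "s \<in> Out \<Longrightarrow> okarc e \<Longrightarrow> s \<noteq> seg e"
  using Out_sub by (auto simp: outer_arcs_def)

lemma Full_ok: assumes "tri R" shows "{e. okarc e \<and> seg e \<in> Full R} = R"
proof (intro equalityI subsetI)
  fix e assume "e \<in> {e. okarc e \<and> seg e \<in> Full R}"
  then have e: "okarc e" "seg e \<in> Out \<or> (\<exists>f\<in>R. seg e = seg f)" unfolding Full_def by blast+
  then show "e \<in> R" using Out_not_ok[of "seg e" e] seg_ok_inj[of e] tri_ok[OF assms] by blast
next
  fix e assume "e \<in> R"
  then show "e \<in> {e. okarc e \<and> seg e \<in> Full R}" using tri_ok[OF assms] unfolding Full_def by blast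
qed

lemma outside_Full:
  assumes s: "triangulation_arc P Y s" and n: "\<And>t. t \<in> Out \<Longrightarrow> s \<noteq> t \<Longrightarrow> \<not> crossing s t" and ns: "s \<notin> seg ` {e. okarc e}"
  shows "s \<in> Out"
  by (rule Out_max) (use assms sides_Out in \<open>auto simp: outer_arcs_def\<close>)

lemma Full_noncrossing: assumes "tri R" shows "noncrossing_arcs P Y (Full R)"
proof -
  have "\<not> crossing s t" if m: "s \<in> Full R" "t \<in> Full R" "s \<noteq> t" for s t
  proof -
    have ok: "okarc e" if "e \<in> R" for e using tri_ok[OF assms that] .
    consider "s \<in> Out" "t \<in> Out" | e where "s \<in> Out" "t = seg e" "e \<in> R" | e where "t \<in> Out" "s = seg e" "e \<in> R"
      | e f where "s = seg e" "e \<in> R" "t = seg f" "f \<in> R" using m(1,2) unfolding Full_def by blast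
    then show ?thesis
    proof cases
      case 1 then show ?thesis using Out_non m(3) by (auto simp: noncrossing_def pairwise_def)
    next
      case 2 then show ?thesis using outer_ok[OF Out_sub] ok by auto
    next
      case 3 then show ?thesis using outer_ok[OF Out_sub] ok crossing_commute by auto
    next
      case 4 then show ?thesis using crossing_ok[of e f] ok tri_non[OF assms, of e f] m(3) by auto
    qed
  qed
  moreover have "triangulation_arc P Y s" if "s \<in> Full R" for s
    using that okarc_arc tri_ok[OF assms] Out_sub by (auto simp: Full_def outer_arcs_def)
  ultimately show ?thesis by (auto simp: noncrossing_arcs_def noncrossing_def pairwise_def)
qed

lemma Full_triangulation: assumes "tri R" shows "triangulation P Y (Full R)"
  unfolding triangulation_def
proof (intro conjI allI impI)
  show "noncrossing_arcs P Y (Full R)" by (rule Full_noncrossing[OF assms])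
  fix T assume T: "noncrossing_arcs P Y T \<and> Full R \<subseteq> T"
  have "s \<in> Full R" if s: "s \<in> T" for s
  proof -
    have arc: "triangulation_arc P Y s" using T s by (auto simp: noncrossing_arcs_def)
    have n: "\<not> crossing s t" if "t \<in> Full R" "s \<noteq> t" for t
      using T s that by (auto simp: noncrossing_arcs_def noncrossing_def pairwise_def)
    show ?thesis
    proof (cases "s \<in> seg ` {e. okarc e}")
      case True
      then obtain e where e: "okarc e" "s = seg e" by auto
      have "e \<in> R"
      proof (rule ccontr)
        assume "e \<notin> R"
        then obtain f where f: "f \<in> R" "xing e f" using tri_max[OF assms e(1)] by blast
        then show False using n[of "seg f"] crossing_ok[of e f] e tri_ok[OF assms f(1)] seg_ok_inj[of e f] \<open>e \<notin> R\<close>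
          by (auto simp: Full_def)
      qed
      then show ?thesis using e by (auto simp: Full_def)
    next
      case False
      then show ?thesis using outside_Full[OF arc] n by (auto simp: Full_def)
    qed
  qed
  then show "T = Full R" using T by blast
qed

lemma triangulation_Full:
  assumes T: "triangulation P Y T" and O: "Out \<subseteq> T"
  shows "T = Full {e. okarc e \<and> seg e \<in> T}" and "tri {e. okarc e \<and> seg e \<in> T}"
proof -
  let ?R = "{e. okarc e \<and> seg e \<in> T}"
  have arc: "triangulation_arc P Y s" if "s \<in> T" for s using T that by (auto simp: triangulation_def noncrossing_arcs_def)
  have n: "\<not> crossing s t" if "s \<in> T" "t \<in> T" "s \<noteq> t" for s t
    using T that by (auto simp: triangulation_def noncrossing_arcs_def noncrossing_def pairwise_def)
  show eq: "T = Full ?R"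
  proof (intro equalityI subsetI)
    fix s assume s: "s \<in> T"
    show "s \<in> Full ?R"
    proof (cases "s \<in> seg ` {e. okarc e}")
      case True then show ?thesis using s by (auto simp: Full_def)
    next
      case False then show ?thesis using outside_Full[OF arc[OF s]] n[OF s] O by (auto simp: Full_def)
    qed
  qed (use O in \<open>auto simp: Full_def\<close>)
  show "tri ?R" unfolding tri_def
  proof (intro conjI ballI allI impI)
    fix e f assume "e \<in> ?R" "f \<in> ?R"
    moreover have "\<not> xing e e" by (auto simp: xing_def)
    ultimately show "\<not> xing e f" using n[of "seg e" "seg f"] crossing_ok[of e f] seg_ok_inj[of e f] by (cases "e = f") auto
  next
    fix e assume e: "okarc e \<and> (\<forall>f\<in>?R. \<not> xing e f)"
    have "noncrossing_arcs P Y (insert (seg e) T)"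
    proof -
      have "\<not> crossing (seg e) t" if "t \<in> T" "seg e \<noteq> t" for t
      proof -
        have "t \<in> Full ?R" by (rule subst[OF eq, of "\<lambda>x. t \<in> x"]) (rule that(1))
        then have "t \<in> Out \<or> (\<exists>f\<in>?R. t = seg f)" unfolding Full_def by blast
        then show ?thesis
        proof (elim disjE bexE)
          assume "t \<in> Out" then show ?thesis using outer_ok[OF Out_sub, of t e] e crossing_commute by auto
        next
          fix f assume "f \<in> ?R" "t = seg f" then show ?thesis using crossing_ok[of e f] e that(2) by auto
        qed
      qed
      then have "noncrossing (insert (seg e) T)" using T by (intro noncrossing_insert) (auto simp: triangulation_def noncrossing_arcs_def)
      then show ?thesis using arc okarc_arc e by (auto simp: noncrossing_arcs_def)
    qed
    then have "insert (seg e) T = T" using T unfolding triangulation_def by blast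
    then show "e \<in> ?R" using e by auto
  qed auto
qed

lemma flips_Full: assumes "flips R R' s s'" shows "flip (Full R) (Full R')"
proof -
  have f: "tri R" "tri R'" "s \<in> R" "s' \<notin> R" "R' = insert s' (R - {s})" using assms by (auto simp: flips_def)
  have "s' \<in> R'" using f(5) by blast
  then have ok: "okarc e" if "e \<in> R \<or> e = s'" for e using that tri_ok[OF f(1)] tri_ok[OF f(2)] by blast
  have n: "seg s' \<notin> Full R" using Full_ok[OF f(1)] ok f(4) by blast
  have a: "seg s \<notin> Out" using Out_not_ok ok f(3) by blast
  have b: "seg ` (R - {s}) = seg ` R - {seg s}" using seg_ok_inj ok f(3) by blast
  have "Full R' = insert (seg s') (Full R - {seg s})"
    unfolding Full_def f(5) image_insert b using a by blast
  moreover have "seg s \<in> Full R" using f(3) by (simp add: Full_def)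
  ultimately show ?thesis using n unfolding flip_def by blast
qed

lemma flip_Full:
  assumes R: "tri R" "tri R'" and fl: "flip (Full R) (Full R')"
  shows "\<exists>s s'. flips R R' s s'"
proof -
  obtain t t' where t: "t \<in> Full R" "t' \<notin> Full R" "Full R' = insert t' (Full R - {t})" using fl unfolding flip_def by blast
  have "t \<notin> Full R'" "t' \<in> Full R'" using t by auto
  then have "t \<notin> Out" "t' \<notin> Out" using t by (auto simp: Full_def)
  then obtain s s' where s: "s \<in> R" "t = seg s" "s' \<in> R'" "t' = seg s'" using t(1) \<open>t' \<in> Full R'\<close> by (auto simp: Full_def)
  have ok: "okarc s" "okarc s'" using s tri_ok R by blast+
  have "s' \<notin> R" using t(2) s(4) by (auto simp: Full_def)
  moreover have "R' = insert s' (R - {s})"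
  proof -
    have "e \<in> R' \<longleftrightarrow> e = s' \<or> e \<in> R \<and> e \<noteq> s" if e: "okarc e" for e
    proof -
      have "e \<in> R' \<longleftrightarrow> seg e \<in> Full R'" using Full_ok[OF R(2)] e by blast
      also have "\<dots> \<longleftrightarrow> seg e = seg s' \<or> seg e \<in> Full R \<and> seg e \<noteq> seg s" using t(3) s by auto
      also have "\<dots> \<longleftrightarrow> e = s' \<or> e \<in> R \<and> e \<noteq> s" using Full_ok[OF R(1)] e ok seg_ok_inj by blast
      finally show ?thesis .
    qed
    then show ?thesis using tri_ok[OF R(1)] tri_ok[OF R(2)] ok by blast
  qed
  ultimately show ?thesis using R s(1) unfolding flips_def by blast
qed

end

definition path_of :: "(nat \<Rightarrow> 'a) \<Rightarrow> nat \<Rightarrow> ('a \<times> 'a) list" where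
  "path_of V n = map (\<lambda>k. (V k, V (Suc k))) [0..<n]"

lemma length_path_of [simp]: "length (path_of V n) = n"
  by (simp add: path_of_def)

lemma path_of_Suc: "path_of V (Suc n) = (V 0, V (Suc 0)) # path_of (\<lambda>k. V (Suc k)) n"
  unfolding path_of_def by (simp add: upt_conv_Cons map_Suc_upt[symmetric] del: upt_Suc)

lemma cas_path_of:
  assumes "tail G = fst" "head G = snd" shows "pre_digraph.cas G (V 0) (path_of V n) (V n)"
proof (induction n arbitrary: V)
  case 0 then show ?case by (simp add: path_of_def pre_digraph.cas.simps)
next
  case (Suc n)
  from Suc[of "\<lambda>k. V (Suc k)"] show ?case by (simp add: path_of_Suc pre_digraph.cas.simps assms)
qed

lemma awalk_path_of:
  assumes "tail G = fst" "head G = snd" "V 0 \<in> verts G" "\<And>k. k < n \<Longrightarrow> (V k, V (Suc k)) \<in> arcs G"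
  shows "pre_digraph.awalk G (V 0) (path_of V n) (V n)"
  unfolding pre_digraph.awalk_def using cas_path_of[OF assms(1,2)] assms(3,4) by (auto simp: path_of_def)

lemma awalk_relpow:
  assumes "tail G = fst" "head G = snd" and w: "pre_digraph.awalk G u p v"
  shows "(u,v) \<in> arcs G ^^ length p"
proof -
  have "set p \<subseteq> arcs G \<Longrightarrow> pre_digraph.cas G u p v \<Longrightarrow> (u,v) \<in> arcs G ^^ length p"
  proof (induction p arbitrary: u)
    case (Cons e es)
    then have e: "e \<in> arcs G" "fst e = u" "(snd e, v) \<in> arcs G ^^ length es"
      using assms(1,2) by (auto simp: pre_digraph.cas.simps)
    then have "(u, snd e) \<in> arcs G" by (metis prod.collapse)
    then show ?case using e(3) by (simp add: relpow_Suc_I2 del: relpow.simps)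
  qed (simp add: pre_digraph.cas.simps)
  then show ?thesis using w unfolding pre_digraph.awalk_def by blast
qed

context placed begin

text \<open>A shortest path between the two completed triangulations would be a monotone walk.\<close>

theorem not_strongly_convex:
  "\<exists>\<epsilon>. line_segment \<epsilon> \<and> \<not> strongly_convex_in (flip_graph_containing \<epsilon> P Y) (flip_graph P Y)"
proof (rule ccontr)
  assume "\<not> ?thesis"
  then have sc: "strongly_convex_in (flip_graph_containing \<epsilon> P Y) (flip_graph P Y)" if "line_segment \<epsilon>" for \<epsilon>
    using that by blast
  let ?G = "flip_graph P Y"
  have G: "tail ?G = fst" "head ?G = snd" "verts ?G = {T. triangulation P Y T}"
    "arcs ?G = {(T, T'). triangulation P Y T \<and> triangulation P Y T' \<and> flip T T'}"
    by (simp_all add: flip_graph_def)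
  define A where "A = arcs ?G"
  have stepA: "(Full R, Full R') \<in> A" if "flipstep R R'" for R R'
  proof -
    obtain s s' where f: "flips R R' s s'" using \<open>flipstep R R'\<close> unfolding flipstep_def by blast
    then have "tri R" "tri R'" unfolding flips_def by blast+
    then show ?thesis unfolding A_def G(4) using flips_Full[OF f] Full_triangulation by blast
  qed
  have powA: "(flipstep ^^ m) R R' \<Longrightarrow> (Full R, Full R') \<in> A ^^ m" for m R R'
  proof (induction m arbitrary: R')
    case (Suc m)
    then obtain S where "(flipstep ^^ m) R S" "flipstep S R'" by auto
    then show ?case using Suc.IH stepA by auto
  qed simp
  obtain m where m: "m \<le> 3626" "(Full arcsT, Full arcsT') \<in> A ^^ m"
    using short_walk_exists powA unfolding reach_def by blast
  define L where "L = (LEAST n. (Full arcsT, Full arcsT') \<in> A ^^ n)"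
  have L: "(Full arcsT, Full arcsT') \<in> A ^^ L" unfolding L_def using m(2) by (rule LeastI)
  have least: "L \<le> n" if "(Full arcsT, Full arcsT') \<in> A ^^ n" for n unfolding L_def using that by (rule Least_le)
  have L3626: "L \<le> 3626" using least[OF m(2)] m(1) by simp
  obtain V where V: "V 0 = Full arcsT" "V L = Full arcsT'" "\<And>k. k < L \<Longrightarrow> (V k, V (Suc k)) \<in> A"
    using L unfolding relpow_fun_conv by blast
  have V_tri: "triangulation P Y (V k)" if "k \<le> L" for k
  proof (cases k)
    case 0 then show ?thesis using V(1) Full_triangulation[OF tri_arcsT] by simp
  next
    case (Suc n)
    then have "(V n, V (Suc n)) \<in> A" using V(3) that by simp
    then show ?thesis unfolding A_def G(4) Suc by blast
  qed
  have pow: "(V i, V j) \<in> A ^^ (j - i)" if "i \<le> j" "j \<le> L" for i j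
    unfolding relpow_fun_conv by (rule exI[of _ "\<lambda>k. V (i + k)"]) (use that V(3) in auto)
  \<comment> \<open>the walk from \<open>V i\<close> to \<open>V j\<close> is a geodesic too, so that strong convexity applies to it\<close>
  have keep: "\<epsilon> \<in> V k" if "i \<le> k" "k \<le> j" "j \<le> L" "\<epsilon> \<in> V i" "\<epsilon> \<in> V j" "line_segment \<epsilon>" for \<epsilon> i j k
  proof -
    let ?p = "path_of (\<lambda>k. V (i + k)) (j - i)"
    let ?H = "flip_graph_containing \<epsilon> P Y"
    have ij: "i \<le> j" "j \<le> L" using that(1-3) by auto
    have "pre_digraph.awalk ?G ((\<lambda>k. V (i + k)) 0) ?p ((\<lambda>k. V (i + k)) (j - i))"
    proof (rule awalk_path_of[OF G(1,2)])
      show "V (i + 0) \<in> verts ?G" using V_tri[of i] ij unfolding G(3) by simp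
      show "(V (i + n), V (i + Suc n)) \<in> arcs ?G" if "n < j - i" for n
        using V(3)[of "i + n"] that ij unfolding A_def by simp
    qed
    then have w: "pre_digraph.awalk ?G (V i) ?p (V j)" using ij by simp
    have "geodesic ?G (V i) ?p (V j)" unfolding geodesic_def
    proof (intro conjI allI impI w)
      fix r assume "pre_digraph.awalk ?G (V i) r (V j)"
      then have "(V i, V j) \<in> A ^^ length r" unfolding A_def by (rule awalk_relpow[OF G(1,2)])
      then have "(V 0, V L) \<in> A ^^ (i + length r + (L - j))"
      proof -
        have "(V 0, V i) \<in> A ^^ i" "(V j, V L) \<in> A ^^ (L - j)" using pow[of 0 i] pow[of j L] ij by simp_all
        then have "(V 0, V L) \<in> (A ^^ i O A ^^ length r) O A ^^ (L - j)"
          using \<open>(V i, V j) \<in> A ^^ length r\<close> by blast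
        then show ?thesis by (simp only: relpow_add)
      qed
      then have "L \<le> i + length r + (L - j)" using least V(1,2) by simp
      then show "length ?p \<le> length r" using that(1-3) by simp
    qed
    moreover have "verts ?H = {T. triangulation P Y T \<and> \<epsilon> \<in> T}" by (simp add: flip_graph_containing_def)
    ultimately have "pre_digraph.awalk ?H (V i) ?p (V j)"
      using sc[OF that(6)] V_tri[of i] V_tri[of j] that unfolding strongly_convex_in_def by auto
    then have sub: "set ?p \<subseteq> arcs ?H" unfolding pre_digraph.awalk_def by blast
    have memH: "\<epsilon> \<in> fst e" if "e \<in> arcs ?H" for e
      using that unfolding flip_graph_containing_def induce_subgraph_def flip_graph_def by simp
    have mem: "\<epsilon> \<in> V (i + n)" if "n < j - i" for n
    proof -
      have "(V (i + n), V (i + Suc n)) \<in> set ?p" using that unfolding path_of_def by (simp add: rev_image_eqI)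
      then have "(V (i + n), V (i + Suc n)) \<in> arcs ?H" using sub by blast
      from memH[OF this] show ?thesis by simp
    qed
    show ?thesis
    proof (cases "k = j")
      case True then show ?thesis using that(5) by simp
    next
      case False
      then have "k - i < j - i" "i + (k - i) = k" using that(1,2) by auto
      then show ?thesis using mem[of "k - i"] by simp
    qed
  qed
  have arc_line: "line_segment s" if "triangulation_arc P Y s" for s
    using that unfolding triangulation_arc_def line_segment_def by blast
  have seg_line: "line_segment (seg e)" if "okarc e" for e
    by (rule arc_line[OF okarc_arc[OF that]])
  have Out_V: "Out \<subseteq> V k" if "k \<le> L" for k
  proof
    fix s assume s: "s \<in> Out"
    then have "triangulation_arc P Y s" using Out_sub unfolding outer_arcs_def by blast
    then have l: "line_segment s" by (rule arc_line)
    have ends: "s \<in> V 0" "s \<in> V L" using s unfolding V(1,2) Full_def by blast+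
    show "s \<in> V k" by (rule keep[OF _ that _ ends l]) simp_all
  qed
  define R where "R k = {e. okarc e \<and> seg e \<in> V k}" for k
  have VR: "V k = Full (R k)" "tri (R k)" if "k \<le> L" for k
    unfolding R_def by (rule triangulation_Full[OF V_tri[OF that] Out_V[OF that]])+
  have "\<exists>s s'. flips (R k) (R (Suc k)) s s'" if "k < L" for k
  proof -
    have k: "k \<le> L" "Suc k \<le> L" using that by auto
    have "flip (V k) (V (Suc k))" using V(3)[OF that] unfolding A_def G(4) by blast
    then have "flip (Full (R k)) (Full (R (Suc k)))" using VR(1)[OF k(1)] VR(1)[OF k(2)] by simp
    then show ?thesis by (rule flip_Full[OF VR(2)[OF k(1)] VR(2)[OF k(2)]])
  qed
  then obtain s s' where fl: "\<And>k. k < L \<Longrightarrow> flips (R k) (R (Suc k)) (s k) (s' k)" by metis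
  have R0: "R 0 = arcsT" unfolding R_def V(1) by (rule Full_ok[OF tri_arcsT])
  have RL: "R L = arcsT'" unfolding R_def V(2) by (rule Full_ok[OF tri_arcsT'])
  have keepR: "e \<in> R k" if "i \<le> k" "k \<le> j" "j \<le> L" "e \<in> R i" "e \<in> R j" for e i j k
  proof -
    have e: "okarc e" "seg e \<in> V i" "seg e \<in> V j" using that(4,5) unfolding R_def by blast+
    have "seg e \<in> V k" by (rule keep[OF that(1-3) e(2,3) seg_line[OF e(1)]])
    then show ?thesis using e(1) unfolding R_def by blast
  qed
  have epsR: "(1,1821) \<in> arcsT" "(1,1821) \<in> arcsT'" by (auto simp: arcsT_def arcsT'_def)
  have "short_walk R s s' L"
  proof (rule short_walk.intro)
    show "L \<le> 3626" by (rule L3626)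
    show "flips (R k) (R (Suc k)) (s k) (s' k)" if "k < L" for k using fl[OF that] .
    show "R 0 = arcsT" by (rule R0)
    show "R L = arcsT'" by (rule RL)
    show "(1,1821) \<in> R k" if "k \<le> L" for k
      by (rule keepR[of 0 k L]) (use that R0 RL epsR in simp_all)
    show "tri arcsT" by (rule tri_arcsT)
    show "card arcsT = 1819" by (rule card_arcsT)
    show "card arcsT' = 1819" by (rule card_arcsT')
    show "e \<in> R k" if "e \<in> arcsT" "k \<le> m" "m \<le> L" "e \<in> R m" for k m e
      by (rule keepR[of 0 k m]) (use that R0 in simp_all)
    show "e \<in> R m" if "e \<in> arcsT'" "k \<le> m" "m \<le> L" "e \<in> R k" for k m e
      by (rule keepR[of k m L]) (use that RL in simp_all)
  qed
  then show False by (rule short_walk.contradiction)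
qed

end

section \<open>Vertices of a convex polygon are extreme\<close>

text \<open>A supporting line at a point of the open segment contains the whole segment.\<close>

lemma frontier_line:
  fixes P :: "point set"
  assumes P: "convex P" "compact P" "interior P \<noteq> {}" and v: "v \<in> frontier P" and ab: "a \<in> P" "b \<in> P" "v \<in> open_segment a b"
  obtains u where "u \<noteq> 0" "\<And>x. x \<in> P \<Longrightarrow> u \<bullet> (x - v) \<le> 0" "u \<bullet> (a - v) = 0" "u \<bullet> (b - v) = 0"
proof -
  have "v \<notin> rel_interior P" using v P(3) by (simp add: frontier_def interior_rel_interior rel_interior_nonempty_interior)
  moreover have "v \<in> closure P" using v by (simp add: frontier_def)
  ultimately obtain w where w: "w \<noteq> 0" "\<And>x. x \<in> closure P \<Longrightarrow> w \<bullet> v \<le> w \<bullet> x"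
    using supporting_hyperplane_rel_boundary[of "closure P" v] P(1) convex_closure convex_rel_interior_closure[OF P(1)] 
    by (metis closure_closure)
  have le: "(- w) \<bullet> (x - v) \<le> 0" if "x \<in> P" for x
    using w(2)[of x] that closure_subset by (auto simp: inner_diff_right)
  obtain t where t: "0 < t" "t < 1" "v = (1 - t) *\<^sub>R a + t *\<^sub>R b" using ab(3) by (auto simp: in_segment)
  have "0 = (1 - t) *\<^sub>R (a - v) + t *\<^sub>R (b - v)" using t(3) by (simp add: algebra_simps)
  then have "0 = (- w) \<bullet> ((1 - t) *\<^sub>R (a - v) + t *\<^sub>R (b - v))" by simp
  then have z: "(1 - t) * ((- w) \<bullet> (a - v)) + t * ((- w) \<bullet> (b - v)) = 0" by (simp only: inner_add_right inner_scaleR_right)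
  have n: "(1 - t) * ((- w) \<bullet> (a - v)) \<le> 0" "t * ((- w) \<bullet> (b - v)) \<le> 0" using le[OF ab(1)] le[OF ab(2)] t by (simp_all only: mult_le_0_iff) auto
  then have "(1 - t) * ((- w) \<bullet> (a - v)) = 0" "t * ((- w) \<bullet> (b - v)) = 0" using z by linarith+
  then have "(- w) \<bullet> (a - v) = 0" "(- w) \<bullet> (b - v) = 0" using t by auto
  then show ?thesis by (intro that[of "- w", OF _ le]) (use w(1) in simp_all)
qed

lemma parallel:
  fixes u x a b :: point
  assumes "u \<noteq> 0" "u \<bullet> x = 0" "u \<bullet> (b - a) = 0" "a \<noteq> b" shows "\<exists>r. x = r *\<^sub>R (b - a)"
proof -
  have c: "u$1 * x$1 + u$2 * x$2 = 0" using assms(2) by (simp add: inner_vec_def sum_2)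
  have d: "u$1 * (b$1 - a$1) + u$2 * (b$2 - a$2) = 0" using assms(3) by (simp add: inner_vec_def sum_2)
  have "u$1 * ((b$1 - a$1) * x$2 - (b$2 - a$2) * x$1) = 0" "u$2 * ((b$1 - a$1) * x$2 - (b$2 - a$2) * x$1) = 0" using c d by algebra+
  moreover have "u$1 \<noteq> 0 \<or> u$2 \<noteq> 0" using assms(1) by (auto simp: vec_eq_iff forall_2)
  ultimately have "det3 a b (a + x) = 0" by (auto simp: det3_def)
  then obtain r where "a + x = (1 - r) *\<^sub>R a + r *\<^sub>R b" by (rule det3_line[OF assms(4)])
  then have "x = r *\<^sub>R (b - a)" by (simp add: algebra_simps)
  then show ?thesis by blast
qed

text \<open>If \<open>v\<close> is between two points \<open>a\<close>, \<open>b\<close> of the polygon, then the boundary near \<open>v\<close> is a piece of the line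
\<open>ab\<close>. The edge that ends at \<open>v\<close> lies on this line, and some edge continues on the other side of \<open>v\<close>. It
overlaps the first one, or it ends at \<open>v\<close> and makes a straight angle with it.\<close>

lemma vertex_not_between:
  fixes P :: "point set"
  assumes P: "convex P" "compact P" "interior P \<noteq> {}" and E: "polygon_edges P E" and v: "v \<in> segment_endpoints E"
    and ab: "a \<in> P" "b \<in> P" shows "v \<notin> open_segment a b"
proof
  assume vab: "v \<in> open_segment a b"
  have fr: "\<Union>E = frontier P" and finE: "finite E" and lsE: "\<And>e. e \<in> E \<Longrightarrow> line_segment e" and nc: "noncrossing E"
    and ang: "\<And>v a b. closed_segment v a \<in> E \<Longrightarrow> closed_segment v b \<in> E \<Longrightarrow> a \<noteq> b \<Longrightarrow> angle_at v a b \<noteq> pi"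
    using E by (auto simp: polygon_edges_def)
  obtain w where w: "v \<noteq> w" "closed_segment v w \<in> E" using v by (auto simp: segment_endpoints_def)
  have "v \<in> frontier P" using fr w(2) by auto
  obtain u where u: "u \<noteq> 0" "\<And>x. x \<in> P \<Longrightarrow> u \<bullet> (x - v) \<le> 0" "u \<bullet> (a - v) = 0" "u \<bullet> (b - v) = 0"
    by (rule frontier_line[OF P \<open>v \<in> frontier P\<close> ab vab]) blast
  have frP: "frontier P \<subseteq> P" using P(2) compact_imp_closed frontier_subset_closed by blast
  have wP: "w \<in> P" using frP fr w(2) by (metis UnionI ends_in_segment(2) subsetD)
  have abne: "a \<noteq> b" using vab by auto
  obtain t where t: "0 < t" "t < 1" "v = (1 - t) *\<^sub>R a + t *\<^sub>R b" using vab by (auto simp: in_segment)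
  have avb: "a - v = t *\<^sub>R (a - b)" "b - v = (1 - t) *\<^sub>R (b - a)" using t(3) by (auto simp: algebra_simps)
  have lineP: "x \<in> frontier P" if "x \<in> P" "u \<bullet> (x - v) = 0" for x
  proof (rule ccontr)
    assume "x \<notin> frontier P"
    then have "x \<in> interior P" using that(1) closure_subset[of P] by (auto simp: frontier_def)
    then obtain e where e: "0 < e" "cball x e \<subseteq> P" by (meson mem_interior_cball)
    have "x + (e / norm u) *\<^sub>R u \<in> cball x e" using e u(1) by (simp add: dist_norm)
    then have "u \<bullet> (x + (e / norm u) *\<^sub>R u - v) \<le> 0" using e u(2) by blast
    moreover have "u \<bullet> (x + (e / norm u) *\<^sub>R u - v) = u \<bullet> (x - v) + (e / norm u) * (u \<bullet> u)"
      by (simp add: inner_add_right inner_diff_right)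
    moreover have "0 < (e / norm u) * (u \<bullet> u)" using e u(1) by simp
    ultimately show False using that(2) by linarith
  qed
  \<comment> \<open>the frontier at the midpoint of the edge at v forces this edge to be parallel to ab\<close>
  define z where "z = (1/2) *\<^sub>R v + (1/2) *\<^sub>R w"
  have zo: "z \<in> open_segment v w" using w(1) by (auto simp: z_def in_segment intro!: exI[of _ "1/2"])
  then have "z \<in> frontier P" using fr w(2) by (auto simp: open_segment_def)
  then obtain u2 where u2: "u2 \<noteq> 0" "\<And>x. x \<in> P \<Longrightarrow> u2 \<bullet> (x - z) \<le> 0" "u2 \<bullet> (v - z) = 0" "u2 \<bullet> (w - z) = 0"
    using frontier_line[OF P _ _ wP zo] frP \<open>v \<in> frontier P\<close> by blast
  have "(1 - t) * (u2 \<bullet> (a - z)) + t * (u2 \<bullet> (b - z)) = u2 \<bullet> (v - z)" unfolding t(3) by (simp add: inner_diff_right inner_add_right algebra_simps)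
  moreover have "(1 - t) * (u2 \<bullet> (a - z)) \<le> 0" "t * (u2 \<bullet> (b - z)) \<le> 0"
    using u2(2)[OF ab(1)] u2(2)[OF ab(2)] t(1,2) by (auto intro!: mult_nonneg_nonpos)
  ultimately have "(1 - t) * (u2 \<bullet> (a - z)) = 0" "t * (u2 \<bullet> (b - z)) = 0" using u2(3) by linarith+
  then have "u2 \<bullet> (a - z) = 0" "u2 \<bullet> (b - z) = 0" using t(1,2) by auto
  then have "u2 \<bullet> (b - a) = 0" "u2 \<bullet> (w - v) = 0" using u2(3,4) by (simp_all add: inner_diff_right)
  then obtain r where r: "w - v = r *\<^sub>R (b - a)" using parallel[OF u2(1) _ _ abne] by blast
  have r0: "r \<noteq> 0" using r w(1) by auto
  \<comment> \<open>the frontier continues on the other side of v\<close>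
  \<comment> \<open>points on the line through \<open>a\<close> and \<open>b\<close> opposite to the edge at \<open>v\<close>\<close>
  define g where "g s = v - (s * r) *\<^sub>R (b - a)" for s
  have "\<exists>d>0. \<forall>s. 0 \<le> s \<and> s \<le> d \<longrightarrow> g s \<in> P"
  proof -
    define d where "d = min t (1 - t) / \<bar>r\<bar>"
    have dpos: "0 < d" using t r0 by (simp add: d_def)
    have "g s \<in> P" if s: "0 \<le> s" "s \<le> d" for s
    proof -
      have "\<bar>s * r\<bar> \<le> min t (1 - t)" using s r0 by (simp add: d_def abs_mult field_simps)
      then have sr: "0 \<le> t - s * r" "t - s * r \<le> 1" by (auto simp: abs_le_iff)
      have "g s = (1 - (t - s * r)) *\<^sub>R a + (t - s * r) *\<^sub>R b" unfolding g_def t(3) by (simp add: algebra_simps)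
      then show ?thesis using convexD_alt[OF P(1) ab sr] by simp
    qed
    then show ?thesis using dpos by blast
  qed
  then obtain d where d: "0 < d" "\<And>s. 0 \<le> s \<Longrightarrow> s \<le> d \<Longrightarrow> g s \<in> P" by blast
  have gf: "g s \<in> \<Union>E" if "0 \<le> s" "s \<le> d" for s
  proof -
    have "u \<bullet> (b - a) = 0" using u(3,4) by (simp add: inner_diff_right)
    then have "u \<bullet> (g s - v) = 0" by (simp add: g_def)
    then show ?thesis using lineP d(2) that fr by auto
  qed
  \<comment> \<open>one edge contains infinitely many of these points, hence a whole piece next to v\<close>
  have "\<exists>e\<in>E. \<forall>n. \<exists>m\<ge>n. g (d / (real m + 1)) \<in> e"
  proof (rule ccontr)
    assume "\<not> ?thesis"
    then have "\<forall>e\<in>E. \<exists>n. \<forall>m\<ge>n. g (d / (real m + 1)) \<notin> e" by blast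
    then obtain N where N: "\<And>e m. e \<in> E \<Longrightarrow> N e \<le> m \<Longrightarrow> g (d / (real m + 1)) \<notin> e" by metis
    define m where "m = Max (insert 0 (N ` E))"
    have "N e \<le> m" if "e \<in> E" for e unfolding m_def using finE that by (intro Max_ge) auto
    moreover have "g (d / (real m + 1)) \<in> \<Union>E" using d(1) by (intro gf) (auto simp: field_simps)
    ultimately show False using N by blast
  qed
  then obtain e where e: "e \<in> E" "\<And>n. \<exists>m\<ge>n. g (d / (real m + 1)) \<in> e" by blast
  obtain c1 c2 where c: "c1 \<noteq> c2" "e = closed_segment c1 c2" using lsE[OF e(1)] by (auto simp: line_segment_def)
  have ve: "v \<in> e"
  proof (rule ccontr)
    assume "v \<notin> e"
    then have "open (- e)" "v \<in> - e" using c by auto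
    then obtain \<delta> where \<delta>: "0 < \<delta>" "ball v \<delta> \<subseteq> - e" by (meson openE)
    obtain n :: nat where n: "d * \<bar>r\<bar> * norm (b - a) / \<delta> < real n" using reals_Archimedean2 by blast
    obtain m where m: "n \<le> m" "g (d / (real m + 1)) \<in> e" using e(2) by blast
    have "dist v (g (d / (real m + 1))) = d * \<bar>r\<bar> * norm (b - a) / (real m + 1)" using d(1) by (simp add: g_def dist_norm abs_mult)
    also have "\<dots> < \<delta>"
    proof -
      have "d * \<bar>r\<bar> * norm (b - a) < \<delta> * real n" using n \<delta>(1) by (simp add: field_simps)
      also have "\<dots> \<le> \<delta> * (real m + 1)" using m(1) \<delta>(1) by simp
      finally show ?thesis by (simp add: field_simps)
    qed
    finally have "g (d / (real m + 1)) \<in> ball v \<delta>" by simp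
    then show False using \<delta>(2) m(2) by blast
  qed
  obtain m where "g (d / (real m + 1)) \<in> e" using e(2)[of 0] by blast
  then obtain s where s: "0 < s" "g s \<in> e" using d(1) by (metis add_nonneg_pos divide_pos_pos of_nat_0_le_iff zero_less_one)
  have opp: "g s - v = (- s) *\<^sub>R (w - v)" unfolding r g_def by simp
  have sub: "closed_segment v (g s) \<subseteq> e" using ve s(2) c by (simp add: closed_segment_subset)
  have ne: "e \<noteq> closed_segment v w"
  proof
    assume "e = closed_segment v w"
    then obtain y where y: "0 \<le> y" "g s = (1 - y) *\<^sub>R v + y *\<^sub>R w" using s(2) by (auto simp: in_segment)
    then have "g s - v = y *\<^sub>R (w - v)" by (simp add: algebra_simps)
    then have "(y + s) *\<^sub>R (w - v) = 0" using opp by (simp add: algebra_simps)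
    then show False using w(1) y(1) s(1) by simp
  qed
  show False
  proof (cases "v = c1 \<or> v = c2")
    case True
    then obtain w2 where w2: "e = closed_segment v w2" "v \<noteq> w2" using c by (metis closed_segment_commute)
    have "w2 \<noteq> w" using ne w2 by auto
    obtain y where y: "0 \<le> y" "g s = (1 - y) *\<^sub>R v + y *\<^sub>R w2" using s(2) w2(1) by (auto simp: in_segment)
    then have "g s - v = y *\<^sub>R (w2 - v)" by (simp add: algebra_simps)
    then have yy: "y *\<^sub>R (w2 - v) = (- s) *\<^sub>R (w - v)" using opp by simp
    then have "y \<noteq> 0" using s(1) w(1) by auto
    then have y0: "0 < y" using y(1) by simp
    have "(1 / y) *\<^sub>R (y *\<^sub>R (w2 - v)) = (1 / y) *\<^sub>R ((- s) *\<^sub>R (w - v))" using yy by simp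
    then have w2v: "w2 - v = - ((s / y) *\<^sub>R (w - v))" using y0 by simp
    have "angle_at v w w2 = arccos (-1)"
    proof -
      have sy: "0 < s / y" using s(1) y0 by simp
      have "(w - v) \<bullet> (w2 - v) = - ((s / y) * (norm (w - v))^2)" unfolding w2v by (simp add: power2_norm_eq_inner)
      moreover have "norm (w2 - v) = (s / y) * norm (w - v)" unfolding w2v using s(1) y0 by simp
      moreover have "norm (w - v) \<noteq> 0" using w(1) by simp
      ultimately have "((w - v) \<bullet> (w2 - v)) / (norm (w - v) * norm (w2 - v)) = -1" using s(1) y0 by (simp add: power2_eq_square)
      then show ?thesis by (simp add: angle_at_def)
    qed
    then show False using ang[of v w w2] w(2) e(1) w2(1) \<open>w2 \<noteq> w\<close> by simp
  next
    case False
    then have vo: "v \<in> open_segment c1 c2" using ve c by (simp add: open_segment_def)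
    obtain y where y: "0 < y" "y < 1" "v = (1 - y) *\<^sub>R c1 + y *\<^sub>R c2" using vo by (auto simp: in_segment)
    obtain y' where y': "g s = (1 - y') *\<^sub>R c1 + y' *\<^sub>R c2" using s(2) c by (auto simp: in_segment)
    have "g s - v = ((1 - y') *\<^sub>R c1 + y' *\<^sub>R c2) - ((1 - y) *\<^sub>R c1 + y *\<^sub>R c2)" by (simp only: y(3)[symmetric] y'[symmetric])
    then have "g s - v = (y' - y) *\<^sub>R (c2 - c1)" by (simp add: algebra_simps)
    then have "(y' - y) *\<^sub>R (c2 - c1) = (- s) *\<^sub>R (w - v)" using opp by simp
    then have "(-1 / s) *\<^sub>R ((y' - y) *\<^sub>R (c2 - c1)) = (-1 / s) *\<^sub>R ((- s) *\<^sub>R (w - v))" by simp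
    then have "w - v = ((-1 / s) * (y' - y)) *\<^sub>R (c2 - c1)" using s(1) by simp
    then obtain k where k: "w - v = k *\<^sub>R (c2 - c1)" by blast
    have "k \<noteq> 0" using k w(1) by auto
    define h where "h = min 1 (min y (1 - y) / \<bar>k\<bar>) / 2"
    have h: "0 < h" "h < 1" "h * \<bar>k\<bar> < min y (1 - y)"
    proof -
      have M: "0 < min y (1 - y) / \<bar>k\<bar>" using y \<open>k \<noteq> 0\<close> by simp
      show "0 < h" "h < 1" using M by (auto simp: h_def)
      have "min 1 K / 2 < K" if "0 < K" for K :: real using that by (auto simp: min_def)
      then have "h < min y (1 - y) / \<bar>k\<bar>" using M unfolding h_def by blast
      then show "h * \<bar>k\<bar> < min y (1 - y)" using \<open>k \<noteq> 0\<close> by (simp add: field_simps)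
    qed
    define z' where "z' = v + h *\<^sub>R (w - v)"
    have "z' = (1 - h) *\<^sub>R v + h *\<^sub>R w" by (simp add: z'_def algebra_simps)
    then have z1: "z' \<in> open_segment v w" using h w(1) by (auto simp: in_segment)
    have "\<bar>h * k\<bar> < min y (1 - y)" using h by (simp add: abs_mult)
    then have "0 < y + h * k" "y + h * k < 1" by (auto simp: abs_less_iff)
    moreover have "z' = (1 - (y + h * k)) *\<^sub>R c1 + (y + h * k) *\<^sub>R c2" unfolding z'_def k using y(3) by (simp add: algebra_simps)
    ultimately have z2: "z' \<in> open_segment c1 c2" using c(1) by (auto simp: in_segment)
    have "crossing e (closed_segment v w)" using z1 z2 c w(1) by (auto simp: crossing_segments)
    then show False using nc e(1) w(2) ne by (auto simp: noncrossing_def pairwise_def)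
  qed
qed

section \<open>Angles seen from the puncture\<close>

lemma polar:
  fixes e v :: point
  assumes "e \<noteq> 0" "v \<noteq> 0"
  shows "\<exists>r \<theta>. 0 < r \<and> 0 \<le> \<theta> \<and> \<theta> < 2 * pi
    \<and> v$1 = r * (cos \<theta> * e$1 - sin \<theta> * e$2) \<and> v$2 = r * (sin \<theta> * e$1 + cos \<theta> * e$2)"
proof -
  define N where "N = (e$1)^2 + (e$2)^2"
  have N: "0 < N" using assms(1) by (auto simp: N_def vec_eq_iff forall_2 sum_power2_gt_zero_iff)
  define A where "A = v$1 * e$1 + v$2 * e$2"
  define B where "B = v$2 * e$1 - v$1 * e$2"
  define Q where "Q = sqrt (A^2 + B^2)"
  have "A^2 + B^2 = N * ((v$1)^2 + (v$2)^2)" by (simp add: A_def B_def N_def power2_eq_square algebra_simps)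
  moreover have "0 < (v$1)^2 + (v$2)^2" using assms(2) by (auto simp: vec_eq_iff forall_2 sum_power2_gt_zero_iff)
  ultimately have AB: "0 < A^2 + B^2" using N by simp
  have Q: "0 < Q" "Q^2 = A^2 + B^2" using AB by (simp_all add: Q_def)
  have "(A / Q)^2 + (B / Q)^2 = 1" proof -
    have "(A / Q)^2 + (B / Q)^2 = (A^2 + B^2) / Q^2" by (simp add: power_divide add_divide_distrib)
    also have "\<dots> = 1" unfolding Q(2)[symmetric] using Q(1) by simp
    finally show ?thesis .
  qed
  then obtain \<theta> where th: "0 \<le> \<theta>" "\<theta> < 2 * pi" "A / Q = cos \<theta>" "B / Q = sin \<theta>" by (rule sincos_total_2pi) auto
  have AQ: "A = Q * cos \<theta>" "B = Q * sin \<theta>" using th(3,4) Q(1) by (auto simp: field_simps)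
  have "N * v$1 = Q * (cos \<theta> * e$1 - sin \<theta> * e$2)" "N * v$2 = Q * (sin \<theta> * e$1 + cos \<theta> * e$2)"
  proof -
    have "N * v$1 = A * e$1 - B * e$2" "N * v$2 = B * e$1 + A * e$2" by (simp_all add: A_def B_def N_def power2_eq_square algebra_simps)
    then show "N * v$1 = Q * (cos \<theta> * e$1 - sin \<theta> * e$2)" "N * v$2 = Q * (sin \<theta> * e$1 + cos \<theta> * e$2)"
      unfolding AQ by (simp_all add: algebra_simps)
  qed
  then have "v$1 = (Q / N) * (cos \<theta> * e$1 - sin \<theta> * e$2)" "v$2 = (Q / N) * (sin \<theta> * e$1 + cos \<theta> * e$2)"
    using N by (auto simp: field_simps)
  then show ?thesis using Q(1) N th(1,2) by (intro exI[of _ "Q / N"] exI[of _ \<theta>]) simp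
qed

lemma sin_pos_iff:
  assumes "0 \<le> \<theta>" "\<theta> < 2 * pi" "0 \<le> \<phi>" "\<phi> \<le> pi"
  shows "0 < sin (\<theta> - \<phi>) \<longleftrightarrow> \<phi> < \<theta> \<and> \<theta> < \<phi> + pi"
proof -
  consider "\<theta> \<le> \<phi>" | "\<phi> < \<theta>" "\<theta> < \<phi> + pi" | "\<phi> + pi \<le> \<theta>" by linarith
  then show ?thesis
  proof cases
    case 1
    then have "0 \<le> sin (\<phi> - \<theta>)" using assms by (intro sin_ge_zero) auto
    then show ?thesis using 1 sin_minus[of "\<phi> - \<theta>"] by simp
  next
    case 2 then show ?thesis using sin_gt_zero[of "\<theta> - \<phi>"] by simp
  next
    case 3
    then have "0 \<le> sin (\<theta> - \<phi> - pi)" using assms by (intro sin_ge_zero) auto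
    then show ?thesis using 3 by (simp add: sin_diff)
  qed
qed

lemma increasing_enumeration:
  fixes \<theta> :: "'a \<Rightarrow> real"
  assumes "finite S" "inj_on \<theta> S"
  obtains g where "g ` {..<card S} = S" "\<And>i j. i < j \<Longrightarrow> j < card S \<Longrightarrow> \<theta> (g i) < \<theta> (g j)"
proof -
  let ?l = "sorted_list_of_set (\<theta> ` S)"
  have len: "length ?l = card S" using assms by (simp add: card_image)
  have set: "set ?l = \<theta> ` S" using assms by simp
  define g where "g i = inv_into S \<theta> (?l ! i)" for i
  have gl: "\<theta> (g i) = ?l ! i" if "i < card S" for i
    unfolding g_def using f_inv_into_f[of "?l ! i" \<theta> S] nth_mem[of i ?l] set len that by metis
  have "g ` {..<card S} = inv_into S \<theta> ` set ?l" unfolding set_conv_nth len g_def by auto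
  also have "\<dots> = S" unfolding set using assms(2) by (simp add: inv_into_image_cancel)
  finally have "g ` {..<card S} = S" .
  moreover have "\<theta> (g i) < \<theta> (g j)" if "i < j" "j < card S" for i j
    using gl[of i] gl[of j] that strict_sorted_list_of_set[of "\<theta> ` S"] len by (simp add: sorted_wrt_nth_less)
  ultimately show ?thesis by (rule that)
qed

locale vertices =
  fixes P X :: "point set" and p :: point
  assumes conv: "convex P" and XP: "X \<subseteq> P" "p \<in> P" and pX: "p \<notin> X" and finX: "finite X"
    and ext: "\<And>v a b. v \<in> X \<Longrightarrow> a \<in> P \<Longrightarrow> b \<in> P \<Longrightarrow> v \<notin> open_segment a b"
begin

text \<open>Otherwise \<open>w\<close> would be in the triangle \<open>pxy\<close> and hence between two points of the polygon.\<close>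

lemma corner_det:
  assumes "x \<in> X" "y \<in> X" "w \<in> X" and "0 < det3 p y x" "0 < det3 p y w" "0 < det3 p w x"
  shows "0 < det3 x y w"
proof (rule ccontr)
  assume n: "\<not> 0 < det3 x y w"
  define d where "d = det3 p y x"
  define s where "s = det3 p w x / d"
  define t where "t = det3 p y w / d"
  have st: "0 < s" "0 < t" "0 < d" using assms by (simp_all add: s_def t_def d_def)
  have sd: "s * d = det3 p w x" "t * d = det3 p y w" using st(3) by (simp_all add: s_def t_def)
  have "det3 x y w = det3 p y w + det3 p w x - det3 p y x" by (simp add: det3_def algebra_simps)
  then have "s * d + t * d \<le> d" using n sd d_def by simp
  then have "(s + t) * d \<le> 1 * d" by (simp add: algebra_simps)
  then have le: "s + t \<le> 1" using st(3) by simp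
  have eq: "w = (1 - (s + t)) *\<^sub>R p + s *\<^sub>R y + t *\<^sub>R x"
  proof -
    have "d * w$i = d * ((1 - (s + t)) * p$i + s * y$i + t * x$i)" if "i = 1 \<or> i = 2" for i
    proof -
      have "d * w$i = (d - (det3 p w x + det3 p y w)) * p$i + det3 p w x * y$i + det3 p y w * x$i"
        using that unfolding d_def by (auto simp: det3_def algebra_simps)
      then show ?thesis using sd by algebra
    qed
    then have "w$i = (1 - (s + t)) * p$i + s * y$i + t * x$i" if "i = 1 \<or> i = 2" for i using that st(3) by simp
    then show ?thesis by (simp add: vec_eq_iff forall_2)
  qed
  define q where "q = (s / (s + t)) *\<^sub>R y + (t / (s + t)) *\<^sub>R x"
  have yx: "y \<noteq> x" using assms(4) by auto
  have pw: "p \<noteq> w" using assms(5) by auto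
  have frac: "t / (s + t) < 1" "0 < t / (s + t)" "s / (s + t) = 1 - t / (s + t)" using st by (auto simp: field_simps)
  have qo: "q \<in> open_segment y x" using frac yx unfolding q_def by (auto simp: in_segment)
  then have qP: "q \<in> P" using XP conv assms(1,2) by (meson closed_segment_subset open_closed_segment subsetD)
  have wq: "w = (1 - (s + t)) *\<^sub>R p + (s + t) *\<^sub>R q" proof -
    have "s + t \<noteq> 0" using st by simp
    then have "(s + t) *\<^sub>R q = s *\<^sub>R y + t *\<^sub>R x" by (simp add: q_def scaleR_add_right)
    then show ?thesis using eq by (simp add: add.assoc)
  qed
  show False
  proof (cases "s + t = 1")
    case True then show False using wq qo ext[OF assms(3)] assms(1,2) XP by auto
  next
    case False
    have "p \<noteq> q" using wq pw by (auto simp: algebra_simps)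
    then have "w \<in> open_segment p q" using wq st le False by (auto simp: in_segment intro!: exI[of _ "s + t"])
    then show False using ext[OF assms(3) XP(2) qP] by blast
  qed
qed

text \<open>Angles are measured from the ray through \<open>z\<close>. No two vertices have the same angle because none of them
is between \<open>p\<close> and another one.\<close>

lemma angles:
  assumes z: "z \<in> X"
  obtains \<theta> m where "\<And>x. x \<in> X \<Longrightarrow> 0 \<le> \<theta> x \<and> \<theta> x < 2 * pi" "\<theta> z = 0"
    "\<And>x y. x \<in> X \<Longrightarrow> y \<in> X \<Longrightarrow> 0 < m x y \<and> det3 p x y = m x y * sin (\<theta> y - \<theta> x)"
    "inj_on \<theta> X" "\<And>\<phi>. \<exists>H\<in>open_half_planes_through p. \<forall>x\<in>X. x \<in> H \<longleftrightarrow> 0 < sin (\<theta> x - \<phi>)"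
proof -
  define e where "e = z - p"
  have e0: "e \<noteq> 0" using z pX by (auto simp: e_def)
  have "\<exists>r \<theta>. x \<in> X \<longrightarrow> 0 < r \<and> 0 \<le> \<theta> \<and> \<theta> < 2 * pi
    \<and> (x - p)$1 = r * (cos \<theta> * e$1 - sin \<theta> * e$2) \<and> (x - p)$2 = r * (sin \<theta> * e$1 + cos \<theta> * e$2)" for x
    using polar[OF e0, of "x - p"] pX by (cases "x \<in> X") auto
  then obtain r \<theta> where R: "\<And>x. x \<in> X \<Longrightarrow> 0 < r x \<and> 0 \<le> \<theta> x \<and> \<theta> x < 2 * pi
    \<and> (x - p)$1 = r x * (cos (\<theta> x) * e$1 - sin (\<theta> x) * e$2) \<and> (x - p)$2 = r x * (sin (\<theta> x) * e$1 + cos (\<theta> x) * e$2)" by metis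
  define N where "N = (e$1)^2 + (e$2)^2"
  have N: "0 < N" using e0 by (auto simp: N_def vec_eq_iff forall_2 sum_power2_gt_zero_iff)
  define m where "m x y = r x * r y * N" for x y
  have 1: "0 \<le> \<theta> x \<and> \<theta> x < 2 * pi" if "x \<in> X" for x using R[OF that] by blast
  have 3: "0 < m x y \<and> det3 p x y = m x y * sin (\<theta> y - \<theta> x)" if "x \<in> X" "y \<in> X" for x y
  proof -
    have e1: "(x - p)$1 = r x * (cos (\<theta> x) * e$1 - sin (\<theta> x) * e$2)" "(x - p)$2 = r x * (sin (\<theta> x) * e$1 + cos (\<theta> x) * e$2)"
      using R[OF that(1)] by auto
    have e2: "(y - p)$1 = r y * (cos (\<theta> y) * e$1 - sin (\<theta> y) * e$2)" "(y - p)$2 = r y * (sin (\<theta> y) * e$1 + cos (\<theta> y) * e$2)"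
      using R[OF that(2)] by auto
    have "det3 p x y = (x - p)$1 * (y - p)$2 - (x - p)$2 * (y - p)$1" by (simp add: det3_def)
    also have "\<dots> = m x y * sin (\<theta> y - \<theta> x)"
      unfolding e1 e2 m_def N_def by (simp add: sin_diff power2_eq_square algebra_simps)
    finally show ?thesis using R[OF that(1)] R[OF that(2)] N by (simp add: m_def)
  qed
  have 2: "\<theta> z = 0"
  proof -
    have a: "e$1 = r z * (cos (\<theta> z) * e$1 - sin (\<theta> z) * e$2)" "e$2 = r z * (sin (\<theta> z) * e$1 + cos (\<theta> z) * e$2)"
      using R[OF z] by (simp_all add: e_def)
    have "0 = N * (r z * sin (\<theta> z))" "N = N * (r z * cos (\<theta> z))" using a unfolding N_def power2_eq_square by algebra+
    then have b: "sin (\<theta> z) = 0" "r z * cos (\<theta> z) = 1" using N R[OF z] by auto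
    then have c: "0 < cos (\<theta> z)" using R[OF z] by (metis zero_less_mult_pos zero_less_one)
    have "\<theta> z \<noteq> pi" using c by auto
    moreover have "\<not> (0 < \<theta> z \<and> \<theta> z < pi)" using sin_gt_zero[of "\<theta> z"] b by auto
    moreover have "\<not> (pi < \<theta> z)" using sin_lt_zero[of "\<theta> z"] b R[OF z] by auto
    ultimately show ?thesis using R[OF z] by linarith
  qed
  have 4: "inj_on \<theta> X"
  proof (rule inj_onI, rule ccontr)
    have "False" if xy: "x \<in> X" "y \<in> X" "\<theta> x = \<theta> y" "r x < r y" for x y
    proof -
      define t where "t = r x / r y"
      have t: "0 < t" "t < 1" "t * r y = r x" using R[OF xy(1)] R[OF xy(2)] xy(4) by (auto simp: t_def)
      have "(x - p)$1 = t * (y - p)$1" "(x - p)$2 = t * (y - p)$2"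
        using R[OF xy(1)] R[OF xy(2)] xy(3) t(3) by (metis mult.assoc)+
      then have "x = (1 - t) *\<^sub>R p + t *\<^sub>R y" by (simp add: vec_eq_iff forall_2 algebra_simps)
      moreover have "p \<noteq> y" using xy(2) pX by auto
      ultimately have "x \<in> open_segment p y" using t by (auto simp: in_segment)
      then show False using ext[OF xy(1) XP(2)] XP xy(2) by blast
    qed
    moreover fix x y assume xy: "x \<in> X" "y \<in> X" "\<theta> x = \<theta> y" "x \<noteq> y"
    moreover have "r x \<noteq> r y"
    proof
      assume "r x = r y"
      then have "(x - p)$1 = (y - p)$1" "(x - p)$2 = (y - p)$2" using R[OF xy(1)] R[OF xy(2)] xy(3) by auto
      then show False using xy(4) by (simp add: vec_eq_iff forall_2)
    qed
    ultimately show False by (metis linorder_neqE_linordered_idom)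
  qed
  have 5: "\<exists>H\<in>open_half_planes_through p. \<forall>x\<in>X. x \<in> H \<longleftrightarrow> 0 < sin (\<theta> x - \<phi>)" for \<phi>
  proof -
    define u :: point where "u = vector [- (sin \<phi> * e$1 + cos \<phi> * e$2), cos \<phi> * e$1 - sin \<phi> * e$2]"
    have u: "u$1 = - (sin \<phi> * e$1 + cos \<phi> * e$2)" "u$2 = cos \<phi> * e$1 - sin \<phi> * e$2" by (simp_all add: u_def)
    have "(u$1)^2 + (u$2)^2 = N * ((sin \<phi>)^2 + (cos \<phi>)^2)" unfolding u N_def by algebra
    then have "u \<noteq> 0" using N by auto
    have "u \<bullet> (x - p) = r x * N * sin (\<theta> x - \<phi>)" if "x \<in> X" for x
    proof -
      have "u \<bullet> (x - p) = u$1 * (x - p)$1 + u$2 * (x - p)$2" by (simp add: inner_vec_def sum_2)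
      also have "\<dots> = u$1 * (r x * (cos (\<theta> x) * e$1 - sin (\<theta> x) * e$2)) + u$2 * (r x * (sin (\<theta> x) * e$1 + cos (\<theta> x) * e$2))"
        using R[OF that] by metis
      also have "\<dots> = r x * N * sin (\<theta> x - \<phi>)" unfolding u N_def by (simp add: sin_diff power2_eq_square algebra_simps)
      finally show ?thesis .
    qed
    moreover have "0 < r x * N" if "x \<in> X" for x using R[OF that] N by simp
    ultimately have "0 < u \<bullet> (x - p) \<longleftrightarrow> 0 < sin (\<theta> x - \<phi>)" if "x \<in> X" for x
      using that by (metis mult_pos_pos zero_less_mult_pos)
    moreover have "{y. u \<bullet> (y - p) > 0} \<in> open_half_planes_through p" using \<open>u \<noteq> 0\<close> unfolding open_half_planes_through_def by blast
    ultimately show ?thesis by (intro bexI[of _ "{y. u \<bullet> (y - p) > 0}"]) auto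
  qed
  show ?thesis by (rule that[of \<theta> m, OF 1 2 3 4 5])
qed

end

section \<open>Choosing the vertices\<close>

locale angular = vertices +
  fixes z :: point and \<theta> :: "point \<Rightarrow> real" and m :: "point \<Rightarrow> point \<Rightarrow> real"
  assumes zX: "z \<in> X" and \<theta>z: "\<theta> z = 0" and range: "\<And>x. x \<in> X \<Longrightarrow> 0 \<le> \<theta> x \<and> \<theta> x < 2 * pi"
    and det: "\<And>x y. x \<in> X \<Longrightarrow> y \<in> X \<Longrightarrow> 0 < m x y \<and> det3 p x y = m x y * sin (\<theta> y - \<theta> x)"
    and inj\<theta>: "inj_on \<theta> X"
    and half: "\<And>\<phi>. \<exists>H\<in>open_half_planes_through p. \<forall>x\<in>X. x \<in> H \<longleftrightarrow> 0 < sin (\<theta> x - \<phi>)"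
begin

lemma det_pos: "x \<in> X \<Longrightarrow> y \<in> X \<Longrightarrow> 0 < sin (\<theta> y - \<theta> x) \<Longrightarrow> 0 < det3 p x y"
  using det[of x y] by simp

text \<open>The triangle is the sum of three triangles with apex \<open>p\<close>. If one of them is negatively oriented, then
the other two angles at \<open>p\<close> are less than \<open>pi\<close> and \<open>corner_det\<close> applies.\<close>

lemma convex_position:
  assumes X: "x \<in> X" "y \<in> X" "w \<in> X" and o: "\<theta> x < \<theta> y" "\<theta> y < \<theta> w"
  shows "0 < det3 x y w"
proof -
  have r: "0 \<le> \<theta> x" "\<theta> w < 2 * pi" using range X by auto
  have wrap: "sin (\<theta> x - \<theta> w) = sin (2 * pi - (\<theta> w - \<theta> x))" by (simp add: sin_diff)
  have wpos: "0 < det3 p w x" if "2 * pi - (\<theta> w - \<theta> x) < pi"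
    by (rule det_pos[OF X(3,1)], unfold wrap, rule sin_gt_zero) (use that r o in auto)
  have bpos: "0 < det3 p b a" if "a \<in> X" "b \<in> X" "pi < \<theta> b - \<theta> a" for a b
  proof (rule det_pos[OF that(2,1)])
    have "sin (\<theta> b - \<theta> a) < 0" using that range[OF that(1)] range[OF that(2)] by (intro sin_lt_zero) auto
    then show "0 < sin (\<theta> a - \<theta> b)" using sin_minus[of "\<theta> b - \<theta> a"] by simp
  qed
  consider "\<theta> y - \<theta> x \<le> pi" "\<theta> w - \<theta> y \<le> pi" "2 * pi - (\<theta> w - \<theta> x) \<le> pi"
    | "pi < \<theta> y - \<theta> x" | "pi < \<theta> w - \<theta> y" | "pi < 2 * pi - (\<theta> w - \<theta> x)" by linarith
  then show ?thesis
  proof cases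
    case 1
    have s1: "0 \<le> sin (\<theta> y - \<theta> x)" by (rule sin_ge_zero) (use 1 o r in auto)
    have s2: "0 \<le> sin (\<theta> w - \<theta> y)" by (rule sin_ge_zero) (use 1 o r in auto)
    have s3: "0 \<le> sin (\<theta> x - \<theta> w)" unfolding wrap by (rule sin_ge_zero) (use 1 o r in auto)
    note s = s1 s2 s3
    have "0 < sin (\<theta> y - \<theta> x) \<or> 0 < sin (\<theta> w - \<theta> y)"
      using 1 o r by (cases "\<theta> y - \<theta> x = pi") (auto intro!: sin_gt_zero)
    moreover have "0 \<le> det3 p x y" "0 \<le> det3 p y w" "0 \<le> det3 p w x"
      using det[OF X(1,2)] det[OF X(2,3)] det[OF X(3,1)] s by simp_all
    moreover have "det3 x y w = det3 p x y + det3 p y w + det3 p w x" by (simp add: det3_def algebra_simps)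
    ultimately show ?thesis using det_pos[OF X(1,2)] det_pos[OF X(2,3)] by linarith
  next
    case 2
    have "0 < det3 p y x" using 2 bpos X by blast
    moreover have "0 < det3 p y w" using 2 o r by (intro det_pos X sin_gt_zero) auto
    moreover have "0 < det3 p w x" using 2 o by (intro wpos) auto
    ultimately show ?thesis using corner_det[OF X] by blast
  next
    case 3
    have "0 < det3 p w y" using 3 bpos X by blast
    moreover have "0 < det3 p w x" using 3 o by (intro wpos) auto
    moreover have "0 < det3 p x y" using 3 o r by (intro det_pos X sin_gt_zero) auto
    ultimately have "0 < det3 y w x" using corner_det[OF X(2,3,1)] by blast
    then show ?thesis by (simp add: det3_rotate)
  next
    case 4
    have "0 < det3 p x w" using 4 o r by (intro det_pos X sin_gt_zero) auto
    moreover have "0 < det3 p x y" "0 < det3 p y w" using 4 o r by (auto intro!: det_pos X sin_gt_zero)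
    ultimately have "0 < det3 w x y" using corner_det[OF X(3,1,2)] by blast
    then show ?thesis by (simp add: det3_rotate)
  qed
qed

definition arc_count :: "real \<Rightarrow> nat" where
  "arc_count \<phi> = card {x\<in>X. \<phi> < \<theta> x \<and> \<theta> x < \<phi> + pi}"

lemma arc_count_half: assumes "0 \<le> \<phi>" "\<phi> \<le> pi" shows "\<exists>H\<in>open_half_planes_through p. card (X \<inter> H) = arc_count \<phi>"
proof -
  obtain H where H: "H \<in> open_half_planes_through p" "\<forall>x\<in>X. x \<in> H \<longleftrightarrow> 0 < sin (\<theta> x - \<phi>)" using half by blast
  have "x \<in> H \<longleftrightarrow> \<phi> < \<theta> x \<and> \<theta> x < \<phi> + pi" if "x \<in> X" for x
    using H(2) that range[OF that] sin_pos_iff[OF _ _ assms, of "\<theta> x"] by simp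
  then have eq: "X \<inter> H = {x\<in>X. \<phi> < \<theta> x \<and> \<theta> x < \<phi> + pi}" by auto
  show ?thesis unfolding arc_count_def using H(1) by (intro bexI[of _ H]) (simp_all only: eq)
qed

lemma balanced_count:
  assumes "balanced X p"
  obtains k where "\<And>\<phi>. 0 \<le> \<phi> \<Longrightarrow> \<phi> \<le> pi \<Longrightarrow> k \<le> arc_count \<phi>" "\<And>\<phi>. 0 \<le> \<phi> \<Longrightarrow> \<phi> \<le> pi \<Longrightarrow> 2 * arc_count \<phi> \<le> 3 * k"
proof -
  define k where "k = (INF H \<in> open_half_planes_through p. card (X \<inter> H))"
  have "k \<le> arc_count \<phi>" if r: "0 \<le> \<phi>" "\<phi> \<le> pi" for \<phi>
  proof -
    obtain H where H: "H \<in> open_half_planes_through p" "card (X \<inter> H) = arc_count \<phi>" using arc_count_half[OF r] by blast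
    have "k \<le> card (X \<inter> H)" unfolding k_def by (rule cINF_lower) (use H in auto)
    then show ?thesis using H(2) by simp
  qed
  moreover have "2 * arc_count \<phi> \<le> 3 * k" if r: "0 \<le> \<phi>" "\<phi> \<le> pi" for \<phi>
  proof -
    obtain H where H: "H \<in> open_half_planes_through p" "card (X \<inter> H) = arc_count \<phi>" using arc_count_half[OF r] by blast
    have "real (card (X \<inter> H)) \<le> 3/2 * real k" using assms H(1) unfolding balanced_def k_def by blast
    then show ?thesis using H(2) by linarith
  qed
  ultimately show ?thesis by (rule that)
qed

text \<open>Let \<open>k\<close> be the least number of vertices in a half-plane, so that \<open>card X \<le> 3 * k + 2\<close>. Let \<open>\<alpha>\<close> be the first
angle beyond \<open>pi\<close>. The half-plane that ends at \<open>\<alpha>\<close> shows that about \<open>k\<close> angles lie between \<open>\<alpha> - pi\<close> and \<open>pi\<close>; the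
first 751 and the last 601 of these vertices form the blocks before the puncture. If there were few
vertices opposite to the gap between these blocks, then the half-plane that starts at the end of the gap
would have about \<open>k\<close> vertices that also lie in the half-plane that starts at the beginning of the gap. The
gap contains about \<open>k\<close> further ones, which contradicts the bound \<open>3/2 * k\<close>. With 12002 vertices, \<open>k\<close> is at least
4000, and there are at least 467 vertices opposite to the gap, the number of those that are chosen there.\<close>

lemma selection:
  assumes bal: "balanced X p" and big: "12002 \<le> card X"
  obtains q :: "nat \<Rightarrow> point" where "\<And>i. i \<le> 1821 \<Longrightarrow> i \<noteq> 1353 \<Longrightarrow> q i \<in> X" "q 1353 = p" "q 0 = z"
    "\<And>i j. i < j \<Longrightarrow> j \<le> 1821 \<Longrightarrow> i \<noteq> 1353 \<Longrightarrow> j \<noteq> 1353 \<Longrightarrow> \<theta> (q i) < \<theta> (q j)"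
    "\<theta> (q 1352) < pi" "pi < \<theta> (q 1354)" "\<theta> (q 1354) - \<theta> (q 1) < pi" "pi < \<theta> (q 1355) - \<theta> (q 751)"
    "\<theta> (q 1821) - \<theta> (q 752) < pi"
proof -
  obtain k where k: "\<And>\<phi>. 0 \<le> \<phi> \<Longrightarrow> \<phi> \<le> pi \<Longrightarrow> k \<le> arc_count \<phi>" "\<And>\<phi>. 0 \<le> \<phi> \<Longrightarrow> \<phi> \<le> pi \<Longrightarrow> 2 * arc_count \<phi> \<le> 3 * k"
    by (rule balanced_count[OF bal]) blast
  have single: "card {x\<in>X. \<theta> x = c} \<le> 1" for c
    using inj\<theta> finX by (auto simp: card_le_Suc0_iff_eq inj_on_def)
  have "X \<subseteq> {x\<in>X. 0 < \<theta> x \<and> \<theta> x < 0 + pi} \<union> {x\<in>X. pi < \<theta> x \<and> \<theta> x < pi + pi} \<union> ({x\<in>X. \<theta> x = 0} \<union> {x\<in>X. \<theta> x = pi})"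
    using range by force
  then have "card X \<le> card ({x\<in>X. 0 < \<theta> x \<and> \<theta> x < 0 + pi} \<union> {x\<in>X. pi < \<theta> x \<and> \<theta> x < pi + pi} \<union> ({x\<in>X. \<theta> x = 0} \<union> {x\<in>X. \<theta> x = pi}))"
    by (intro card_mono) (use finX in auto)
  also have "\<dots> \<le> arc_count 0 + arc_count pi + (card {x\<in>X. \<theta> x = 0} + card {x\<in>X. \<theta> x = pi})"
    unfolding arc_count_def by (intro order_trans[OF card_Un_le] add_mono card_Un_le)
  finally have "card X \<le> 3 * k + 2" using single[of 0] single[of pi] k(2)[of 0] k(2)[of pi] by simp
  then have k4: "4000 \<le> k" using big by simp
  define Lo where "Lo = {x\<in>X. pi < \<theta> x}"
  have "{x\<in>X. pi < \<theta> x \<and> \<theta> x < pi + pi} \<subseteq> Lo" by (auto simp: Lo_def)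
  then have "arc_count pi \<le> card Lo" unfolding arc_count_def by (intro card_mono) (auto simp: Lo_def finX)
  then have "card Lo \<noteq> 0" using k(1)[of pi] k4 by simp
  then have Lo: "finite Lo" "Lo \<noteq> {}" by (simp_all add: card_eq_0_iff)
  obtain a where a: "a \<in> Lo" "\<And>x. x \<in> Lo \<Longrightarrow> \<theta> a \<le> \<theta> x" using ex_min_if_finite[of "\<theta> ` Lo"] Lo by (metis arg_min_if_finite(1) arg_min_least)
  define \<alpha> where "\<alpha> = \<theta> a"
  have aX: "a \<in> X" and al: "pi < \<alpha>" "\<alpha> < 2 * pi" using a(1) range by (auto simp: Lo_def \<alpha>_def)
  have none: "\<not> (pi < \<theta> x \<and> \<theta> x < \<alpha>)" if "x \<in> X" for x using a(2)[of x] that by (auto simp: Lo_def \<alpha>_def)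
  define S where "S = {x\<in>X. \<alpha> - pi < \<theta> x \<and> \<theta> x < pi}"
  have finS: "finite S" using finX by (simp add: S_def)
  have "{x\<in>X. \<alpha> - pi < \<theta> x \<and> \<theta> x < \<alpha> - pi + pi} \<subseteq> S \<union> {x\<in>X. \<theta> x = pi}" using none by (force simp: S_def)
  then have "arc_count (\<alpha> - pi) \<le> card (S \<union> {x\<in>X. \<theta> x = pi})" unfolding arc_count_def by (intro card_mono) (auto simp: finS finX)
  also have "\<dots> \<le> card S + 1" using card_Un_le[of S "{x\<in>X. \<theta> x = pi}"] single[of pi] by linarith
  finally have cS: "k \<le> card S + 1" using k(1)[of "\<alpha> - pi"] al by simp
  define M where "M = card S"
  have M: "k \<le> M + 1" "3999 \<le> M" using cS k4 by (auto simp: M_def)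
  obtain g where g: "g ` {..<M} = S" "\<And>i j. i < j \<Longrightarrow> j < M \<Longrightarrow> \<theta> (g i) < \<theta> (g j)"
    using increasing_enumeration[OF finS inj_on_subset[OF inj\<theta>]] unfolding M_def by (metis (no_types, lifting) S_def mem_Collect_eq subsetI)
  have gS: "g i \<in> X" "\<alpha> - pi < \<theta> (g i)" "\<theta> (g i) < pi" if "i < M" for i
    using g(1) that by (auto simp: S_def)
  have ginj: "inj_on g {..<M}" by (rule linorder_inj_onI') (use g(2) in fastforce)
  define t1 where "t1 = \<theta> (g 750)"
  define t2 where "t2 = \<theta> (g (M - 601))"
  have t: "0 \<le> t1" "t1 < t2" "t2 < pi" "\<alpha> - pi < t1"
    using gS[of 750] gS[of "M - 601"] g(2)[of 750 "M - 601"] M al by (auto simp: t1_def t2_def)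
  define S4 where "S4 = {x\<in>X. t1 + pi < \<theta> x \<and> \<theta> x < t2 + pi}"
  have finS4: "finite S4" using finX by (simp add: S4_def)
  \<comment> \<open>the vertices common to the half-planes that start at the two ends of the gap\<close>
  define B where "B = {x\<in>X. t2 < \<theta> x \<and> \<theta> x < t1 + pi}"
  have "g ` {751..M-601} \<union> B \<subseteq> {x\<in>X. t1 < \<theta> x \<and> \<theta> x < t1 + pi}"
  proof -
    have "t1 < \<theta> (g i) \<and> \<theta> (g i) < t1 + pi \<and> g i \<in> X" if "751 \<le> i" "i \<le> M - 601" for i
    proof -
      have "i < M" using that M by simp
      then show ?thesis using g(2)[of 750 i] gS[of i] that t(1) by (auto simp: t1_def)
    qed
    then show ?thesis using t by (auto simp: B_def)
  qed
  then have "card (g ` {751..M-601} \<union> B) \<le> arc_count t1" unfolding arc_count_def by (intro card_mono) (auto simp: finX)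
  moreover have "card (g ` {751..M-601} \<union> B) = card (g ` {751..M-601}) + card B"
  proof (rule card_Un_disjoint)
    have "\<theta> (g i) \<le> t2" if "i \<le> M - 601" for i using g(2)[of i "M - 601"] that M by (cases "i = M - 601") (auto simp: t2_def)
    then show "g ` {751..M-601} \<inter> B = {}" by (fastforce simp: B_def)
  qed (auto simp: B_def finX)
  moreover have "card (g ` {751..M-601}) = M - 1351"
    by (subst card_image) (use M in \<open>auto intro!: inj_on_subset[OF ginj]\<close>)
  ultimately have 1: "2 * (M - 1351 + card B) \<le> 3 * k" using k(2)[of t1] t by simp
  have "{x\<in>X. t2 < \<theta> x \<and> \<theta> x < t2 + pi} \<subseteq> B \<union> {x\<in>X. \<theta> x = t1 + pi} \<union> S4" by (force simp: B_def S4_def)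
  then have "arc_count t2 \<le> card (B \<union> {x\<in>X. \<theta> x = t1 + pi} \<union> S4)" unfolding arc_count_def by (intro card_mono) (auto simp: finX B_def S4_def)
  also have "\<dots> \<le> card B + 1 + card S4"
    using card_Un_le[of "B \<union> {x\<in>X. \<theta> x = t1 + pi}" S4] card_Un_le[of B "{x\<in>X. \<theta> x = t1 + pi}"] single[of "t1 + pi"] by linarith
  finally have 2: "k \<le> card B + 1 + card S4" using k(1)[of t2] t by simp
  have "2 * M + 2 * card B \<le> 3 * k + 2702" using 1 M(2) by arith
  then have c4: "467 \<le> card S4" using 2 M k4 by linarith
  obtain h where h: "h ` {..<card S4} = S4" "\<And>i j. i < j \<Longrightarrow> j < card S4 \<Longrightarrow> \<theta> (h i) < \<theta> (h j)"
    using increasing_enumeration[OF finS4 inj_on_subset[OF inj\<theta>]] by (metis (no_types, lifting) S4_def mem_Collect_eq subsetI)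
  have hS: "h i \<in> X" "t1 + pi < \<theta> (h i)" "\<theta> (h i) < t2 + pi" if "i < 467" for i
    using h(1) that c4 by (auto simp: S4_def)
  define q where "q i = (if i = 0 then z else if i \<le> 751 then g (i - 1) else if i \<le> 1352 then g (M + i - 1353)
    else if i = 1353 then p else if i = 1354 then a else h (i - 1355))" for i
  have qz: "q 0 = z" and qp: "q 1353 = p" and qa: "q 1354 = a" by (simp_all add: q_def)
  have q1: "q i = g (i - 1)" if "1 \<le> i" "i \<le> 751" for i using that by (simp add: q_def)
  have q2: "q i = g (M + i - 1353)" if "752 \<le> i" "i \<le> 1352" for i using that by (simp add: q_def)
  have q4: "q i = h (i - 1355)" if "1355 \<le> i" for i using that by (simp add: q_def)
  have qX: "q i \<in> X" if "i \<le> 1821" "i \<noteq> 1353" for i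
    using that zX aX gS(1) hS(1) M by (auto simp: q_def)
  have b1: "\<alpha> - pi < \<theta> (q i) \<and> \<theta> (q i) < pi" if "1 \<le> i" "i \<le> 1352" for i
    using q1[of i] q2[of i] gS[of "i - 1"] gS[of "M + i - 1353"] that M by (cases "i \<le> 751") auto
  have b4: "t1 + pi < \<theta> (q i) \<and> \<theta> (q i) < t2 + pi" if "1355 \<le> i" "i \<le> 1821" for i
    using q4[of i] hS[of "i - 1355"] that by auto
  have e1: "\<theta> (q 751) = t1" "\<theta> (q 752) = t2" using q1[of 751] q2[of 752] M by (auto simp: t1_def t2_def)
  have stepq: "\<theta> (q i) < \<theta> (q (Suc i))" if "Suc i \<le> 1821" "i \<noteq> 1352" "i \<noteq> 1353" for i
  proof -
    have "i \<le> 1351 \<or> i = 1354 \<or> 1355 \<le> i" using that by arith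
    then consider "i = 0" | "1 \<le> i" "Suc i \<le> 751" | "i = 751" | "752 \<le> i" "Suc i \<le> 1352" | "i = 1354" | "1355 \<le> i"
      by linarith
    then show ?thesis
    proof cases
      case 1 then show ?thesis using b1[of 1] al qz \<theta>z by simp
    next
      case 2 then show ?thesis using q1[of i] q1[of "Suc i"] g(2)[of "i - 1" i] M by simp
    next
      case 3 then show ?thesis using e1 t by simp
    next
      case 4 then show ?thesis using q2[of i] q2[of "Suc i"] g(2)[of "M + i - 1353" "M + Suc i - 1353"] M by simp
    next
      case 5 then show ?thesis using b4[of 1355] qa t by (simp add: \<alpha>_def)
    next
      case 6 then show ?thesis using q4[of i] q4[of "Suc i"] h(2)[of "i - 1355" "Suc i - 1355"] that c4 by simp
    qed
  qed
  have skip: "\<theta> (q 1352) < \<theta> (q 1354)" using b1[of 1352] al qa by (simp add: \<alpha>_def)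
  have ord: "\<theta> (q i) < \<theta> (q j)" if "i < j" "j \<le> 1821" "i \<noteq> 1353" "j \<noteq> 1353" for i j
    using that
  proof (induction j)
    case (Suc j)
    show ?case
    proof (cases "j = 1353")
      case True
      then have "i < 1352 \<or> i = 1352" using Suc.prems by linarith
      then show ?thesis
      proof
        assume i: "i < 1352"
        have mono: "i < n \<Longrightarrow> n \<le> 1352 \<Longrightarrow> \<theta> (q i) < \<theta> (q n)" for n
        proof (induction n)
          case (Suc n)
          then have "i = n \<or> i < n" by linarith
          then show ?case using Suc stepq[of n] by (elim disjE) (simp, force)
        qed simp
        show ?thesis using mono[of 1352] i skip True by simp
      qed (use skip True in simp)
    next
      case False
      have "i = j \<or> i < j" using Suc.prems by linarith
      then show ?thesis using Suc stepq[of j] False by (elim disjE) (simp, force)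
    qed
  qed simp
  show ?thesis
  proof (rule that[of q, OF qX qp qz ord])
    show "\<theta> (q 1352) < pi" using b1[of 1352] by simp
    show "pi < \<theta> (q 1354)" using al qa by (simp add: \<alpha>_def)
    show "\<theta> (q 1354) - \<theta> (q 1) < pi" using b1[of 1] qa by (simp add: \<alpha>_def)
    show "pi < \<theta> (q 1355) - \<theta> (q 751)" using b4[of 1355] e1 by simp
    show "\<theta> (q 1821) - \<theta> (q 752) < pi" using b4[of 1821] e1 by simp
  qed
qed

text \<open>On which side of a diagonal \<open>p\<close> lies is decided by comparing a difference of angles with \<open>pi\<close>, and by
monotonicity the five extreme differences suffice. A vertex that has not been chosen is beyond the hull edge
that joins the chosen vertices before and after it.\<close>

lemma placement:
  assumes bal: "balanced X p" and big: "12002 \<le> card X"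
  obtains q where "\<And>i. i \<le> 1821 \<Longrightarrow> q i \<in> X \<union> {p}" "inj_on q {..1821::nat}"
    "\<And>i j k. i < j \<Longrightarrow> j < k \<Longrightarrow> k \<le> 1821 \<Longrightarrow> \<not> (j = 1353 \<and> forb i k) \<Longrightarrow> 0 < det3 (q i) (q j) (q k)"
    "\<And>i k. forb i k \<Longrightarrow> k \<le> 1821 \<Longrightarrow> det3 (q i) (q 1353) (q k) < 0"
    "\<And>i j. i < j \<Longrightarrow> j \<le> 1821 \<Longrightarrow> open_segment (q i) (q j) \<inter> (X \<union> {p}) = {}"
    "\<And>y. y \<in> X \<union> {p} \<Longrightarrow> y \<notin> q ` {..1821} \<Longrightarrow> \<exists>(a,b)\<in>hullpairs. det3 (q a) (q b) y < 0"
proof (rule selection[OF bal big])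
  fix q :: "nat \<Rightarrow> point"
  assume qX: "\<And>i. i \<le> 1821 \<Longrightarrow> i \<noteq> 1353 \<Longrightarrow> q i \<in> X" and qp: "q 1353 = p" and qz: "q 0 = z"
    and ord: "\<And>i j. i < j \<Longrightarrow> j \<le> 1821 \<Longrightarrow> i \<noteq> 1353 \<Longrightarrow> j \<noteq> 1353 \<Longrightarrow> \<theta> (q i) < \<theta> (q j)"
    and T: "\<theta> (q 1352) < pi" "pi < \<theta> (q 1354)" "\<theta> (q 1354) - \<theta> (q 1) < pi" "pi < \<theta> (q 1355) - \<theta> (q 751)"
      "\<theta> (q 1821) - \<theta> (q 752) < pi"
  define t where "t i = \<theta> (q i)" for i
  have rg: "0 \<le> t i" "t i < 2 * pi" if "i \<le> 1821" "i \<noteq> 1353" for i using range[OF qX[OF that]] by (auto simp: t_def)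
  have le: "t i \<le> t j" if "i \<le> j" "j \<le> 1821" "i \<noteq> 1353" "j \<noteq> 1353" for i j
    using ord[of i j] that by (cases "i = j") (auto simp: t_def)
  have lt: "t i < t j" if "i < j" "j \<le> 1821" "i \<noteq> 1353" "j \<noteq> 1353" for i j using ord that by (auto simp: t_def)
  have lo: "t i < pi" if "i \<le> 1352" for i using le[of i 1352] T(1) that by (simp add: t_def)
  have hi: "pi < t i" if "1354 \<le> i" "i \<le> 1821" for i using le[of 1354 i] T(2) that by (simp add: t_def)
  have D: "0 < m (q i) (q j) \<and> det3 p (q i) (q j) = m (q i) (q j) * sin (t j - t i)" if "i \<le> 1821" "j \<le> 1821" "i \<noteq> 1353" "j \<noteq> 1353" for i j
    using det[OF qX qX] that by (auto simp: t_def)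
  have Dpos: "0 < det3 p (q i) (q j)" if "i < j" "j \<le> 1821" "j \<le> 1352 \<or> 1354 \<le> i" for i j
  proof -
    have "0 < t j - t i" using lt that by auto
    moreover have "t j - t i < pi" using that lo[of j] hi[of i] rg[of i] rg[of j] by auto
    ultimately have "0 < sin (t j - t i)" by (rule sin_gt_zero)
    then show ?thesis using D[of i j] that by auto
  qed
  have chi_mid: "0 < det3 (q i) p (q k)" if "i < 1353" "1353 < k" "k \<le> 1821" "\<not> forb i k" for i k
  proof -
    have "pi < t k - t i"
    proof (cases "i = 0")
      case True then show ?thesis using hi[of k] that qz \<theta>z by (simp add: t_def)
    next
      case False
      then have "i \<le> 751" "1355 \<le> k" using that by (auto simp: forb_def)
      then show ?thesis using le[of i 751] le[of 1355 k] T(4) that by (simp add: t_def)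
    qed
    moreover have "t k - t i < 2 * pi" using rg[of k] rg[of i] that by simp
    ultimately have "sin (t k - t i) < 0" by (rule sin_lt_zero)
    then have "0 < sin (t i - t k)" using sin_minus[of "t k - t i"] by simp
    then have "0 < det3 p (q k) (q i)" using D[of k i] that by auto
    then show ?thesis by (simp add: det3_rotate)
  qed
  have chi_neg: "det3 (q i) p (q k) < 0" if "forb i k" "k \<le> 1821" for i k
  proof -
    have b: "1 \<le> i" "i < 1353" "1353 < k" "k = 1354 \<or> 751 < i" using that(1) by (auto simp: forb_def)
    have "t k - t i < pi"
    proof (cases "k = 1354")
      case True then show ?thesis using le[of 1 i] T(3) b by (simp add: t_def)
    next
      case False then show ?thesis using le[of 752 i] le[of k 1821] T(5) b that by (simp add: t_def)
    qed
    moreover have "0 < t k - t i" using lt[of i k] b that by simp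
    ultimately have "0 < sin (t k - t i)" by (intro sin_gt_zero)
    then have "sin (t i - t k) < 0" using sin_minus[of "t k - t i"] by simp
    then have "det3 p (q k) (q i) < 0" using D[of k i] b that by (auto simp: mult_pos_neg)
    then show ?thesis by (simp add: det3_rotate)
  qed
  have chi: "0 < det3 (q i) (q j) (q k)" if o: "i < j" "j < k" "k \<le> 1821" and n: "\<not> (j = 1353 \<and> forb i k)" for i j k
  proof -
    consider "i = 1353" | "j = 1353" | "k = 1353" | "i \<noteq> 1353" "j \<noteq> 1353" "k \<noteq> 1353" by blast
    then show ?thesis
    proof cases
      case 1 then show ?thesis using Dpos[of j k] o qp by simp
    next
      case 2 then show ?thesis using chi_mid[of i k] o n qp by simp
    next
      case 3
      then have "0 < det3 p (q i) (q j)" using Dpos[of i j] o by simp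
      then show ?thesis using 3 qp by (simp add: det3_rotate)
    next
      case 4
      then show ?thesis using ord[of i j] ord[of j k] o by (intro convex_position qX) auto
    qed
  qed
  have inj: "inj_on q {..1821}"
  proof (rule linorder_inj_onI')
    fix i j :: nat assume ij: "i \<in> {..1821}" "j \<in> {..1821}" "i < j"
    show "q i \<noteq> q j"
    proof (cases "i = 1353 \<or> j = 1353")
      case True then show ?thesis using qX[of i] qX[of j] qp pX ij by auto
    next
      case False then show ?thesis using ord[of i j] ij by auto
    qed
  qed
  have qP: "q i \<in> P" if "i \<le> 1821" for i using qX[of i] qp XP that by (cases "i = 1353") auto
  have clear: "open_segment (q i) (q j) \<inter> (X \<union> {p}) = {}" if ij: "i < j" "j \<le> 1821" for i j
  proof -
    have "v \<notin> open_segment (q i) (q j)" if "v \<in> X" for v using ext[OF that] qP ij by auto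
    moreover have "p \<notin> open_segment (q i) (q j)"
    proof (cases "i = 1353 \<or> j = 1353")
      case True then show ?thesis using qp by (auto simp: open_segment_def)
    next
      case False
      have "det3 (q i) (q j) p \<noteq> 0"
      proof -
        consider "j < 1353" | "1353 < i" | "i < 1353" "1353 < j" using False by linarith
        then show ?thesis
        proof cases
          case 1 then show ?thesis using chi[of i j 1353] ij qp by simp
        next
          case 2 then show ?thesis using chi[of 1353 i j] ij qp by (simp add: det3_rotate)
        next
          case 3 
          then have "det3 (q i) p (q j) \<noteq> 0" using chi_mid[of i j] chi_neg[of i j] ij by fastforce
          then show ?thesis using det3_swap[of "q i" p "q j"] by simp
        qed
      qed
      moreover have "det3 (q i) (q j) x = 0" if "x \<in> open_segment (q i) (q j)" for x
      proof -
        have "\<exists>u. x = (1 - u) *\<^sub>R q i + u *\<^sub>R q j" using that unfolding in_segment by blast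
        then obtain u where "x = (1 - u) *\<^sub>R q i + u *\<^sub>R q j" by blast
        then show ?thesis by (simp add: det3_affine)
      qed
      ultimately show ?thesis by blast
    qed
    ultimately show ?thesis by blast
  qed
  have outside: "\<exists>(a,b)\<in>hullpairs. det3 (q a) (q b) y < 0" if y: "y \<in> X \<union> {p}" "y \<notin> q ` {..1821}" for y
  proof -
    have "p \<in> q ` {..1821}" by (rule image_eqI[of _ _ 1353]) (simp_all add: qp)
    then have yX: "y \<in> X" using y by blast
    have ne: "\<theta> y \<noteq> t i" if "i \<le> 1821" "i \<noteq> 1353" for i
      using inj\<theta> yX qX[OF that] y(2) that unfolding t_def inj_on_def by force
    define I where "I = {i. i \<le> 1821 \<and> i \<noteq> 1353 \<and> t i < \<theta> y}"
    have "t 0 < \<theta> y" using ne[of 0] range[OF yX] qz \<theta>z by (simp add: t_def)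
    then have I: "finite I" "I \<noteq> {}" by (auto simp: I_def)
    define i where "i = Max I"
    have i: "i \<le> 1821" "i \<noteq> 1353" "t i < \<theta> y" using Max_in[OF I] by (auto simp: i_def I_def)
    have nxt: "\<theta> y < t j" if "i < j" "j \<le> 1821" "j \<noteq> 1353" for j
      using Max_ge[OF I(1), of j] that ne[of j] unfolding i_def by (fastforce simp: I_def)
    have gap: "det3 (q i) (q j) y < 0" if "i < j" "j \<le> 1821" "j \<noteq> 1353" for j
    proof -
      have "0 < det3 (q i) y (q j)" using nxt[OF that] i that by (intro convex_position qX yX) (auto simp: t_def)
      then show ?thesis by (simp add: det3_swap[of _ y])
    qed
    consider "i = 1821" | "i = 1352" | "i < 1821" "i \<noteq> 1352" using i(1) by linarith
    then show ?thesis
    proof cases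
      case 1
      have "0 < det3 (q 0) (q 1821) y" using i(3) 1 lt[of 0 1821] by (intro convex_position qX yX) (auto simp: t_def)
      moreover have "det3 (q 1821) (q 0) y = - det3 (q 0) (q 1821) y" by (simp add: det3_def algebra_simps)
      ultimately show ?thesis by (intro bexI[of _ "(1821,0)"]) (auto simp: hullpairs_def)
    next
      case 2 then show ?thesis using gap[of 1354] by (intro bexI[of _ "(1352,1354)"]) (auto simp: hullpairs_def)
    next
      case 3 then show ?thesis using gap[of "Suc i"] i by (intro bexI[of _ "(i,Suc i)"]) (auto simp: hullpairs_def)
    qed
  qed
  have "q i \<in> X \<union> {p}" if "i \<le> 1821" for i using qX[OF that] qp by (cases "i = 1353") auto
  then show ?thesis using that[of q, OF _ inj chi _ clear outside] chi_neg qp by simp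
qed

end

section \<open>Large balanced polygons\<close>

theorem theorem1p2:
  shows "\<exists>N::nat. \<forall>(P::point set) (X::point set) (p::point).
    simple_polygon P X \<and> convex P \<and> p \<in> interior P \<and> balanced X p \<and> card X \<ge> N \<longrightarrow>
    (\<exists>\<epsilon>. line_segment \<epsilon> \<and>
       \<not> strongly_convex_in (flip_graph_containing \<epsilon> P (X \<union> {p})) (flip_graph P (X \<union> {p})))"
proof (intro exI[of _ 12002] allI impI)
  fix P X :: "point set" and p :: point
  assume A: "simple_polygon P X \<and> convex P \<and> p \<in> interior P \<and> balanced X p \<and> card X \<ge> 12002"
  then have P: "convex P" "compact P" "interior P \<noteq> {}" and p: "p \<in> interior P"
    and bal: "balanced X p" and big: "12002 \<le> card X"
    by (auto simp: simple_polygon_def)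
  obtain E where E: "polygon_edges P E" "X = segment_endpoints E" using A by (auto simp: simple_polygon_def)
  have XF: "X \<subseteq> frontier P"
  proof
    fix v assume "v \<in> X"
    then obtain w where w: "closed_segment v w \<in> E" by (auto simp: E(2) segment_endpoints_def)
    have "\<Union>E = frontier P" using E(1) by (simp add: polygon_edges_def)
    then show "v \<in> frontier P" using w by (metis UnionI ends_in_segment(1))
  qed
  have "frontier P \<subseteq> P" using P(2) compact_imp_closed frontier_subset_closed by blast
  moreover have "p \<notin> frontier P" using p by (simp add: frontier_def)
  moreover have "finite X" using big by (intro card_ge_0_finite) simp
  moreover have "v \<notin> open_segment a b" if "v \<in> X" "a \<in> P" "b \<in> P" for v a b
    using vertex_not_between[OF P E(1) _ that(2,3)] that(1) E(2) by blast
  ultimately have v: "vertices P X p" using XF P(1) p interior_subset[of P] by unfold_locales blast+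
  have "X \<noteq> {}" using big by auto
  then obtain z where z: "z \<in> X" by blast
  obtain \<theta> m where ang: "\<And>x. x \<in> X \<Longrightarrow> 0 \<le> \<theta> x \<and> \<theta> x < 2 * pi" "\<theta> z = 0"
    "\<And>x y. x \<in> X \<Longrightarrow> y \<in> X \<Longrightarrow> 0 < m x y \<and> det3 p x y = m x y * sin (\<theta> y - \<theta> x)"
    "inj_on \<theta> X" "\<And>\<phi>. \<exists>H\<in>open_half_planes_through p. \<forall>x\<in>X. x \<in> H \<longleftrightarrow> 0 < sin (\<theta> x - \<phi>)"
    using vertices.angles[OF v z] by metis
  have a: "angular P X p z \<theta> m"
    unfolding angular_def angular_axioms_def using v z ang by blast
  obtain q :: "nat \<Rightarrow> point" where q: "\<And>i. i \<le> 1821 \<Longrightarrow> q i \<in> X \<union> {p}" "inj_on q {..1821::nat}"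
    "\<And>i j k. i < j \<Longrightarrow> j < k \<Longrightarrow> k \<le> 1821 \<Longrightarrow> \<not> (j = 1353 \<and> forb i k) \<Longrightarrow> 0 < det3 (q i) (q j) (q k)"
    "\<And>i k. forb i k \<Longrightarrow> k \<le> 1821 \<Longrightarrow> det3 (q i) (q 1353) (q k) < 0"
    "\<And>i j. i < j \<Longrightarrow> j \<le> 1821 \<Longrightarrow> open_segment (q i) (q j) \<inter> (X \<union> {p}) = {}"
    "\<And>y. y \<in> X \<union> {p} \<Longrightarrow> y \<notin> q ` {..1821} \<Longrightarrow> \<exists>(a,b)\<in>hullpairs. det3 (q a) (q b) y < 0"
    using angular.placement[OF a bal big] by blast
  have vv: "convex P" "X \<subseteq> P" "p \<in> P" "finite X" using v by (auto simp: vertices_def)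
  have "placed P X p q"
    unfolding placed_def using vv q by blast
  then show "\<exists>\<epsilon>. line_segment \<epsilon> \<and>
       \<not> strongly_convex_in (flip_graph_containing \<epsilon> P (X \<union> {p})) (flip_graph P (X \<union> {p}))"
    by (rule placed.not_strongly_convex)
qed

end
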